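(* Let $(\mathscr{D},g,\mathscr{A})$ be a fluid type domain, with associated objects $Y,F,X_0,\mu,\rho,X,\mathcal{T},P,G$ as defined in the context. Then the following hold on $\mathscr{D}$. 1. $\nabla_g\cdot(\mu X)=\nabla_g\cdot(\mu X_0)=g(X_0,\nabla_g\cdot P)$. Moreover $\mu^2X\!\left(\frac{\rho}{\mu}\right)=\mu\, g(Y,\nabla_g\cdot P)-\rho\, g(X_0,\nabla_g\cdot P)$, and $g(Y,\nabla_g\cdot P)=\nabla_g\cdot({}^eP(Y))$. 2. $\nabla_g\cdot(\rho X)=\nabla_g\cdot(\rho X_0)=\nabla_g\cdot({}^eP(Y))=g(Y,\nabla_g\cdot P)$. 3. (a) $\mu D_XX=-\nabla_g\cdot P-g(X_0,\nabla_g\cdot P)\,X$; (b) $\mu D_{X_0}X_0=\rho\,{}^eF(X_0)-\mathrm{pr}_{\mathcal{T}^\perp}(\nabla_g\cdot P)$. 4. $\nabla_g\cdot F=\rho X_0+\frac12(F_{kl}F^{kl})\,Y-{}^eP(Y)$, i.e. $\nabla_iF^{ij}=\rho X_0^j+\frac12(F_{kl}F^{kl})Y^j-P^{ij}Y_i$.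
   Context: All objects are sufficiently smooth. $\mathscr{D}$ is an $n$-dimensional manifold with pseudo-Riemannian metric $g$; $W$ is a compact manifold of dimension $n-5$; $S^1$ is the oriented circle. A $g$-observation atlas $\mathscr{A}$ on $\mathscr{D}$ is a family of diffeomorphisms $\varphi_i:\mathcal V_i\to\Theta_i\times S^1\times W$ ($\mathcal V_i$ open in $\mathscr{D}$, $\bigcup_i\mathcal V_i=\mathscr{D}$, $\Theta_i\subset\mathbb{R}^4$ open) such that, writing $\varphi_i(x)=(x_i^1,x_i^2,x_i^3)$: the sets $S^1_x:=\varphi_i^{-1}(\{x_i^1\}\times S^1\times\{x_i^3\})$ (with the orientation transported from $S^1$) and $W_x:=\varphi_i^{-1}(\{x_i^1\}\times\{x_i^2\}\times W)$ do not depend on the index $i$ with $x\in\mathcal V_i$; if $H_x$ is the 4-dimensional $g$-orthogonal complement of $T_x(S^1_x)\oplus T_x(W_x)$, then $g|_{H_x}$ has signature $(-,+,+,+)$, $g|_{T_x(S^1_x)}$ is negative definite, $g|_{T_x(W_x)}$ is positive definite; and the vectors $\varphi_i^*(\partial/\partial t)$ ($t$ the first coordinate of $\Theta_i\subset\mathbb{R}^4$) are timelike and have pairwise negative $g$-product at each common point, thereby defining a time orientation of each $H_x$. The atlas is complete if it is maximal. In a triple $(\mathscr{D},g,\mathscr{A})$ the atlas $\mathscr{A}$ is a complete $g$-observation atlas. $Y$ is the vector field with $Y_x$ tangent to $S^1_x$, positively oriented, $g(Y,Y)=-1$. $G:=2(\mathrm{Ricc}_g-\frac12S_gg)$, where $\mathrm{Ricc}_g$,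 $S_g$ are the Ricci and scalar curvatures. For a bilinear form $B$, ${}^eB$ is the endomorphism with coordinates $B^i{}_j=g^{ik}B_{kj}$. $\flat$ is lowering indices with $g$. $D$ (coordinates $\nabla_i$) is the Levi-Civita connection of $g$; $\nabla_g\cdot Z=\nabla_iZ^i$ for a vector field, $(\nabla_g\cdot T)^j=\nabla_iT^{ij}$ for a 2-tensor (indices raised with $g$). For a function $f$, $X(f)$ is the derivative of $f$ along $X$. $(\mathscr{D},g,\mathscr{A})$ is a fluid type domain if: (i) for each $x$, the endomorphism $Z\mapsto \mathrm{pr}_{H_x}({}^eG(Z))$ of $H_x$ ($\mathrm{pr}_{H_x}$ the $g$-orthogonal projection) has an eigenvalue $-\mu(x)<0$ whose eigenspace is 1-dimensional and timelike; (ii) $Y$ is a Killing field for $g$. In a fluid type domain: $F=d(Y^\flat)$; $X_0$ is the vector field spanning this eigenspace, in the time orientation of $H_x$, with $g(X_0,X_0)=-1$; $\mu>0$ is the function above; $\rho:=G(X_0,Y)$; $X:=X_0+\frac{\rho}{\mu}Y$; $\mathcal{T}_x=\mathrm{span}(X_{0,x},Y_x)$; $\sigma$ is the function such that $G$ restricted to $\mathcal T_x$ equals $\mu X^\flat\otimes X^\flat+\sigma Y^\flat\otimes Y^\flat$; $P:=G-\mu X^\flat\otimes X^\flat-\sigma Y^\flat\otimes Y^\flat$. $\mathrm{pr}_{\mathcal{T}^\perp}$ is the $g$-orthogonal projection onto $\mathcal T^\perp$. *)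

theory Defs
  imports "HOL-Analysis.Analysis"
begin

section \<open>Smooth maps and smooth manifolds\<close>

text \<open>Class \<open>C\<^sup>k\<close> on an open set, by iterated directional derivatives.\<close>

primrec Ck_on :: "nat \<Rightarrow> 'a::euclidean_space set \<Rightarrow> ('a \<Rightarrow> 'b::real_normed_vector) \<Rightarrow> bool" where
  "Ck_on 0 S f \<longleftrightarrow> continuous_on S f"
| "Ck_on (Suc k) S f \<longleftrightarrow> (\<forall>x\<in>S. f differentiable (at x)) \<and>
     (\<forall>v. Ck_on k S (\<lambda>x. frechet_derivative f (at x) v))"

text \<open>Smoothness on an arbitrary subset of a Euclidean space: local extendability to a
  \<open>C\<^sup>\<infinity>\<close> map on an open set. On open sets, and on relatively open subsets of a linear
  subspace, this is ordinary smoothness.\<close>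

definition smooth_on :: "'a::euclidean_space set \<Rightarrow> ('a \<Rightarrow> 'b::real_normed_vector) \<Rightarrow> bool" where
  "smooth_on S f \<longleftrightarrow>
     (\<forall>x\<in>S. \<exists>U h. open U \<and> x \<in> U \<and> (\<forall>k. Ck_on k U h) \<and> (\<forall>y\<in>U \<inter> S. h y = f y))"

text \<open>A chart is a pair (domain, coordinate map); values of the map outside the domain are
  irrelevant.\<close>

type_synonym ('m, 'e) chart = "'m set \<times> ('m \<Rightarrow> 'e)"

definition chart_inv :: "('m, 'e) chart \<Rightarrow> 'e \<Rightarrow> 'm" where
  "chart_inv c = inv_into (fst c) (snd c)"

text \<open>A \<open>k\<close>-dimensional manifold is modelled on a \<open>k\<close>-dimensional linear subspace of a Euclidean
  type, so that \<open>k = 0\<close> (a discrete space) is included.\<close>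

definition smooth_manifold :: "nat \<Rightarrow> ('m::topological_space, 'e::euclidean_space) chart set \<Rightarrow> bool" where
  "smooth_manifold k M \<longleftrightarrow>
     (\<Union>c\<in>M. fst c) = UNIV \<and>
     (\<exists>E. subspace E \<and> dim E = k \<and>
       (\<forall>c\<in>M. open (fst c) \<and> openin (top_of_set E) (snd c ` fst c) \<and>
              homeomorphism (fst c) (snd c ` fst c) (snd c) (chart_inv c))) \<and>
     (\<forall>c\<in>M. \<forall>d\<in>M. smooth_on (snd c ` (fst c \<inter> fst d)) (snd d \<circ> chart_inv c))"

definition smooth_between ::
  "('m, 'e::euclidean_space) chart set \<Rightarrow> ('p, 'f::euclidean_space) chart set \<Rightarrow> 'm set \<Rightarrow> ('m \<Rightarrow> 'p) \<Rightarrow> bool" where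
  "smooth_between M N S f \<longleftrightarrow>
     (\<forall>c\<in>M. \<forall>d\<in>N. smooth_on (snd c ` (fst c \<inter> S \<inter> f -` fst d)) (snd d \<circ> f \<circ> chart_inv c))"

definition diffeomorphism_between ::
  "('m::topological_space, 'e::euclidean_space) chart set \<Rightarrow>
   ('p::topological_space, 'f::euclidean_space) chart set \<Rightarrow> 'm set \<Rightarrow> 'p set \<Rightarrow> ('m \<Rightarrow> 'p) \<Rightarrow> bool" where
  "diffeomorphism_between M N S T f \<longleftrightarrow>
     homeomorphism S T f (inv_into S f) \<and>
     smooth_between M N S f \<and> smooth_between N M T (inv_into S f)"

text \<open>The circle is the unit circle of the complex plane, oriented counterclockwise, with the
  angular charts (each omitting one point).\<close>

definition circle_charts :: "(complex, real) chart set" where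
  "circle_charts = range (\<lambda>a. (cis ` {a<..<a + 2 * pi}, inv_into {a<..<a + 2 * pi} cis))"

text \<open>Charts of \<open>\<real>\<^sup>4 \<times> S\<^sup>1 \<times> W\<close>.\<close>

definition product_charts ::
  "('w, 'e) chart set \<Rightarrow> ((real^4) \<times> complex \<times> 'w, (real^4) \<times> real \<times> 'e) chart set" where
  "product_charts W =
     {(UNIV \<times> fst a \<times> fst b, map_prod id (map_prod (snd a) (snd b))) | a b.
        a \<in> circle_charts \<and> b \<in> W}"

section \<open>Tensor calculus in charts\<close>

text \<open>A vector at \<open>x\<close> is represented by its components in every chart around \<open>x\<close>, related by the
  Jacobians of the chart changes, and likewise for 2-tensors. A component expression
  takes the chart and the point as arguments; it is meaningful for points of the chart domain.
  Scalars built from components also take the chart as an argument, though their values do not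
  depend on it.\<close>

type_synonym ('d, 'n) vfield = "('d, real^'n) chart \<Rightarrow> 'd \<Rightarrow> real^'n"
type_synonym ('d, 'n) tensor2 = "('d, real^'n) chart \<Rightarrow> 'd \<Rightarrow> real^'n^'n"
type_synonym ('d, 'n) scalar = "('d, real^'n) chart \<Rightarrow> 'd \<Rightarrow> real"

definition jacobian :: "('d, real^'n) chart \<Rightarrow> ('d, real^'n) chart \<Rightarrow> 'd \<Rightarrow> real^'n^'n" where
  "jacobian c d x = matrix (frechet_derivative (snd d \<circ> chart_inv c) (at (snd c x)))"

definition smooth_function :: "('d, real^'n) chart set \<Rightarrow> ('d \<Rightarrow> real) \<Rightarrow> bool" where
  "smooth_function D f \<longleftrightarrow> (\<forall>c\<in>D. smooth_on (snd c ` fst c) (f \<circ> chart_inv c))"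

definition smooth_vector_field :: "('d, real^'n) chart set \<Rightarrow> ('d, 'n::finite) vfield \<Rightarrow> bool" where
  "smooth_vector_field D Z \<longleftrightarrow>
     (\<forall>c\<in>D. smooth_on (snd c ` fst c) (Z c \<circ> chart_inv c)) \<and>
     (\<forall>c\<in>D. \<forall>d\<in>D. \<forall>x\<in>fst c \<inter> fst d. Z d x = jacobian c d x *v Z c x)"

definition smooth_bilinear_field :: "('d, real^'n) chart set \<Rightarrow> ('d, 'n::finite) tensor2 \<Rightarrow> bool" where
  "smooth_bilinear_field D B \<longleftrightarrow>
     (\<forall>c\<in>D. smooth_on (snd c ` fst c) (B c \<circ> chart_inv c)) \<and>
     (\<forall>c\<in>D. \<forall>d\<in>D. \<forall>x\<in>fst c \<inter> fst d.
        B c x = transpose (jacobian c d x) ** B d x ** jacobian c d x)"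

definition pseudo_riemannian :: "('d, real^'n) chart set \<Rightarrow> ('d, 'n::finite) tensor2 \<Rightarrow> bool" where
  "pseudo_riemannian D g \<longleftrightarrow> smooth_bilinear_field D g \<and>
     (\<forall>c\<in>D. \<forall>x\<in>fst c. transpose (g c x) = g c x \<and> invertible (g c x))"

definition form :: "real^'n^'n \<Rightarrow> real^'n \<Rightarrow> real^'n \<Rightarrow> real" where
  "form B u v = (\<Sum>i\<in>UNIV. \<Sum>j\<in>UNIV. B $ i $ j * u $ i * v $ j)"

definition outer :: "real^'n \<Rightarrow> real^'n \<Rightarrow> real^'n^'n" where
  "outer a b = (\<chi> i j. a $ i * b $ j)"

definition partial :: "('d, real^'n) chart \<Rightarrow> 'n \<Rightarrow> ('d \<Rightarrow> real) \<Rightarrow> 'd \<Rightarrow> real" where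
  "partial c i f x = frechet_derivative (f \<circ> chart_inv c) (at (snd c x)) (axis i 1)"

definition directional :: "('d, 'n::finite) vfield \<Rightarrow> ('d, 'n::finite) scalar \<Rightarrow> ('d, 'n::finite) scalar" where
  "directional X f c x = (\<Sum>i\<in>UNIV. X c x $ i * partial c i (f c) x)"

definition ginv :: "('d, 'n::finite) tensor2 \<Rightarrow> ('d, 'n::finite) tensor2" where
  "ginv g c x = matrix_inv (g c x)"

definition flat :: "('d, 'n::finite) tensor2 \<Rightarrow> ('d, 'n::finite) vfield \<Rightarrow> ('d, 'n::finite) vfield" where
  "flat g Z c x = (\<chi> i. \<Sum>j\<in>UNIV. g c x $ i $ j * Z c x $ j)"

text \<open>\<open>B\<^sup>i\<^sub>j = g\<^sup>i\<^sup>k B\<^sub>k\<^sub>j\<close>\<close>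

definition endo :: "('d, 'n::finite) tensor2 \<Rightarrow> ('d, 'n::finite) tensor2 \<Rightarrow> ('d, 'n::finite) tensor2" where
  "endo g B c x = (\<chi> i j. \<Sum>k\<in>UNIV. ginv g c x $ i $ k * B c x $ k $ j)"

text \<open>\<open>T\<^sup>i\<^sup>j = g\<^sup>i\<^sup>k g\<^sup>j\<^sup>l T\<^sub>k\<^sub>l\<close>\<close>

definition raise :: "('d, 'n::finite) tensor2 \<Rightarrow> ('d, 'n::finite) tensor2 \<Rightarrow> ('d, 'n::finite) tensor2" where
  "raise g T c x =
     (\<chi> i j. \<Sum>k\<in>UNIV. \<Sum>l\<in>UNIV. ginv g c x $ i $ k * ginv g c x $ j $ l * T c x $ k $ l)"

text \<open>The symbols \<open>\<Gamma>\<^sup>k\<^sub>i\<^sub>j\<close> of the Levi-Civita connection, with arguments in the order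
  \<open>k i j\<close>; the lemma \<open>christoffel_iff\<close> below characterizes them.\<close>

definition christoffel ::
  "('d, 'n::finite) tensor2 \<Rightarrow> ('d, real^'n) chart \<Rightarrow> 'd \<Rightarrow> 'n \<Rightarrow> 'n \<Rightarrow> 'n \<Rightarrow> real" where
  "christoffel g c x k i j = (1/2) * (\<Sum>l\<in>UNIV. ginv g c x $ k $ l *
     (partial c i (\<lambda>y. g c y $ j $ l) x + partial c j (\<lambda>y. g c y $ i $ l) x
      - partial c l (\<lambda>y. g c y $ i $ j) x))"

text \<open>\<open>\<nabla>\<^sub>i Z\<^sup>j\<close>\<close>

definition nabla_vec ::
  "('d, 'n::finite) tensor2 \<Rightarrow> ('d, 'n::finite) vfield \<Rightarrow> ('d, real^'n) chart \<Rightarrow> 'd \<Rightarrow> 'n \<Rightarrow> 'n \<Rightarrow> real" where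
  "nabla_vec g Z c x i j = partial c i (\<lambda>y. Z c y $ j) x
     + (\<Sum>k\<in>UNIV. christoffel g c x j i k * Z c x $ k)"

text \<open>\<open>D\<^sub>X Z\<close>\<close>

definition covariant :: "('d, 'n::finite) tensor2 \<Rightarrow> ('d, 'n::finite) vfield \<Rightarrow> ('d, 'n::finite) vfield \<Rightarrow> ('d, 'n::finite) vfield" where
  "covariant g X Z c x = (\<chi> j. \<Sum>i\<in>UNIV. X c x $ i * nabla_vec g Z c x i j)"

definition div_vec :: "('d, 'n::finite) tensor2 \<Rightarrow> ('d, 'n::finite) vfield \<Rightarrow> ('d, 'n::finite) scalar" where
  "div_vec g Z c x = (\<Sum>i\<in>UNIV. nabla_vec g Z c x i i)"

text \<open>\<open>\<nabla>\<^sub>m T\<^sup>i\<^sup>j\<close>, for a covariant 2-tensor \<open>T\<close> with its indices raised\<close>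

definition nabla_raised ::
  "('d, 'n::finite) tensor2 \<Rightarrow> ('d, 'n::finite) tensor2 \<Rightarrow> ('d, real^'n) chart \<Rightarrow> 'd \<Rightarrow> 'n \<Rightarrow> 'n \<Rightarrow> 'n \<Rightarrow> real" where
  "nabla_raised g T c x m i j = partial c m (\<lambda>y. raise g T c y $ i $ j) x
     + (\<Sum>k\<in>UNIV. christoffel g c x i m k * raise g T c x $ k $ j)
     + (\<Sum>k\<in>UNIV. christoffel g c x j m k * raise g T c x $ i $ k)"

definition div_tensor :: "('d, 'n::finite) tensor2 \<Rightarrow> ('d, 'n::finite) tensor2 \<Rightarrow> ('d, 'n::finite) vfield" where
  "div_tensor g T c x = (\<chi> j. \<Sum>i\<in>UNIV. nabla_raised g T c x i i j)"

text \<open>\<open>R\<^sub>j\<^sub>k = \<partial>\<^sub>i \<Gamma>\<^sup>i\<^sub>j\<^sub>k - \<partial>\<^sub>j \<Gamma>\<^sup>i\<^sub>i\<^sub>k + \<Gamma>\<^sup>i\<^sub>i\<^sub>m \<Gamma>\<^sup>m\<^sub>j\<^sub>k - \<Gamma>\<^sup>i\<^sub>j\<^sub>m \<Gamma>\<^sup>m\<^sub>i\<^sub>k\<close>, the sign for which round spheres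
  have positive Ricci curvature\<close>

definition ricci :: "('d, 'n::finite) tensor2 \<Rightarrow> ('d, 'n::finite) tensor2" where
  "ricci g c x = (\<chi> j k. \<Sum>i\<in>UNIV.
       partial c i (\<lambda>y. christoffel g c y i j k) x - partial c j (\<lambda>y. christoffel g c y i i k) x
       + (\<Sum>m\<in>UNIV. christoffel g c x i i m * christoffel g c x m j k
                    - christoffel g c x i j m * christoffel g c x m i k))"

definition scalar_curvature :: "('d, 'n::finite) tensor2 \<Rightarrow> ('d, 'n::finite) scalar" where
  "scalar_curvature g c x = (\<Sum>j\<in>UNIV. \<Sum>k\<in>UNIV. ginv g c x $ j $ k * ricci g c x $ j $ k)"

text \<open>Twice the Einstein tensor.\<close>

definition gravity :: "('d, 'n::finite) tensor2 \<Rightarrow> ('d, 'n::finite) tensor2" where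
  "gravity g c x = 2 *\<^sub>R (ricci g c x - ((1/2) * scalar_curvature g c x) *\<^sub>R g c x)"

text \<open>\<open>(d\<alpha>)\<^sub>i\<^sub>j = \<partial>\<^sub>i \<alpha>\<^sub>j - \<partial>\<^sub>j \<alpha>\<^sub>i\<close>\<close>

definition ext_deriv :: "('d, 'n::finite) vfield \<Rightarrow> ('d, 'n::finite) tensor2" where
  "ext_deriv \<alpha> c x =
     (\<chi> i j. partial c i (\<lambda>y. \<alpha> c y $ j) x - partial c j (\<lambda>y. \<alpha> c y $ i) x)"

text \<open>\<open>B\<^sub>k\<^sub>l B\<^sup>k\<^sup>l\<close>\<close>

definition square_norm :: "('d, 'n::finite) tensor2 \<Rightarrow> ('d, 'n::finite) tensor2 \<Rightarrow> ('d, 'n::finite) scalar" where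
  "square_norm g B c x = (\<Sum>k\<in>UNIV. \<Sum>l\<in>UNIV. B c x $ k $ l * raise g B c x $ k $ l)"

text \<open>The components of the Lie derivative \<open>L\<^sub>Z g\<close>.\<close>

definition lie_metric :: "('d, 'n::finite) vfield \<Rightarrow> ('d, 'n::finite) tensor2 \<Rightarrow> ('d, 'n::finite) tensor2" where
  "lie_metric Z g c x = (\<chi> i j. \<Sum>k\<in>UNIV.
       Z c x $ k * partial c k (\<lambda>y. g c y $ i $ j) x
       + g c x $ k $ j * partial c i (\<lambda>y. Z c y $ k) x
       + g c x $ i $ k * partial c j (\<lambda>y. Z c y $ k) x)"

definition killing :: "('d, real^'n) chart set \<Rightarrow> ('d, 'n::finite) tensor2 \<Rightarrow> ('d, 'n::finite) vfield \<Rightarrow> bool" where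
  "killing D g Z \<longleftrightarrow> (\<forall>c\<in>D. \<forall>x\<in>fst c. lie_metric Z g c x = 0)"

section \<open>Linear algebra of bilinear forms\<close>

definition orth_compl :: "('v \<Rightarrow> 'v \<Rightarrow> real) \<Rightarrow> 'v set \<Rightarrow> 'v set" where
  "orth_compl B V = {u. \<forall>v\<in>V. B u v = 0}"

definition orth_proj :: "('v::real_vector \<Rightarrow> 'v \<Rightarrow> real) \<Rightarrow> 'v set \<Rightarrow> 'v \<Rightarrow> 'v" where
  "orth_proj B V z = (THE u. u \<in> V \<and> (\<forall>v\<in>V. B (z - u) v = 0))"

definition has_signature :: "('v::euclidean_space \<Rightarrow> 'v \<Rightarrow> real) \<Rightarrow> 'v set \<Rightarrow> nat \<Rightarrow> nat \<Rightarrow> bool" where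
  "has_signature B V r s \<longleftrightarrow>
     (\<exists>N P. finite N \<and> finite P \<and> card N = r \<and> card P = s \<and> N \<inter> P = {} \<and>
        independent (N \<union> P) \<and> span (N \<union> P) = V \<and>
        (\<forall>u\<in>N \<union> P. \<forall>v\<in>N \<union> P. u \<noteq> v \<longrightarrow> B u v = 0) \<and>
        (\<forall>u\<in>N. B u u = -1) \<and> (\<forall>u\<in>P. B u u = 1))"

section \<open>Observation atlases\<close>

text \<open>Components in the chart \<open>c\<close> of the vectors at \<open>x\<close> tangent to a submanifold \<open>N\<close>, as velocities
  of curves in \<open>N\<close>.\<close>

definition tangent_space :: "('d, real^'n) chart \<Rightarrow> 'd \<Rightarrow> 'd set \<Rightarrow> (real^'n) set" where
  "tangent_space c x N =
     {v. \<exists>\<gamma> \<epsilon>. \<epsilon> > 0 \<and> \<gamma> 0 = x \<and> \<gamma> ` {-\<epsilon><..<\<epsilon>} \<subseteq> N \<inter> fst c \<and>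
          smooth_on {-\<epsilon><..<\<epsilon>} (snd c \<circ> \<gamma>) \<and> v = vector_derivative (snd c \<circ> \<gamma>) (at (0::real))}"

type_synonym ('d, 'w) obs = "('d, (real^4) \<times> complex \<times> 'w) chart"

definition circle_fibre :: "('d, 'w) obs \<Rightarrow> 'd \<Rightarrow> 'd set" where
  "circle_fibre a x = {y \<in> fst a. fst (snd a y) = fst (snd a x) \<and>
                                  snd (snd (snd a y)) = snd (snd (snd a x))}"

definition compact_fibre :: "('d, 'w) obs \<Rightarrow> 'd \<Rightarrow> 'd set" where
  "compact_fibre a x = {y \<in> fst a. fst (snd a y) = fst (snd a x) \<and>
                                   fst (snd (snd a y)) = fst (snd (snd a x))}"

text \<open>Components in \<open>c\<close> of the pullbacks by \<open>a\<close> of the positively oriented unit tangent of the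
  circle and of the first coordinate vector \<open>\<partial>/\<partial>t\<close> of \<open>\<real>\<^sup>4\<close>.\<close>

definition circle_vector :: "('d, real^'n) chart \<Rightarrow> ('d, 'w) obs \<Rightarrow> 'd \<Rightarrow> real^'n" where
  "circle_vector c a x = (case snd a x of (p, z, w) \<Rightarrow>
     vector_derivative (\<lambda>s. snd c (chart_inv a (p, z * cis s, w))) (at 0))"

definition time_vector :: "('d, real^'n) chart \<Rightarrow> ('d, 'w) obs \<Rightarrow> 'd \<Rightarrow> real^'n" where
  "time_vector c a x = (case snd a x of (p, z, w) \<Rightarrow>
     vector_derivative (\<lambda>s. snd c (chart_inv a (p + s *\<^sub>R axis 1 1, z, w))) (at 0))"

text \<open>\<open>S\<^sup>1\<^sub>x\<close> and \<open>W\<^sub>x\<close> as sets attached to an atlas. In an observation atlas all members of these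
  unions coincide.\<close>

definition circle_at :: "('d, 'w) obs set \<Rightarrow> 'd \<Rightarrow> 'd set" where
  "circle_at A x = (\<Union>a\<in>{a \<in> A. x \<in> fst a}. circle_fibre a x)"

definition compact_at :: "('d, 'w) obs set \<Rightarrow> 'd \<Rightarrow> 'd set" where
  "compact_at A x = (\<Union>a\<in>{a \<in> A. x \<in> fst a}. compact_fibre a x)"

text \<open>Components of \<open>H\<^sub>x\<close>: the orthogonal complement of \<open>T\<^sub>x(S\<^sup>1\<^sub>x) \<oplus> T\<^sub>x(W\<^sub>x)\<close>.\<close>

definition horizontal ::
  "('d, 'n::finite) tensor2 \<Rightarrow> ('d, 'w) obs set \<Rightarrow> ('d, real^'n) chart \<Rightarrow> 'd \<Rightarrow> (real^'n) set" where
  "horizontal g A c x = orth_compl (form (g c x))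
     {u + w | u w. u \<in> tangent_space c x (circle_at A x) \<and> w \<in> tangent_space c x (compact_at A x)}"

definition observation_atlas ::
  "('d::topological_space, real^'n) chart set \<Rightarrow> ('w::topological_space, 'e::euclidean_space) chart set \<Rightarrow>
   ('d, 'n::finite) tensor2 \<Rightarrow> ('d, 'w) obs set \<Rightarrow> bool" where
  "observation_atlas D W g A \<longleftrightarrow>
     (\<Union>a\<in>A. fst a) = UNIV \<and>
     (\<forall>a\<in>A. open (fst a) \<and>
        (\<exists>\<Theta>. open \<Theta> \<and> diffeomorphism_between D (product_charts W)
                          (fst a) (\<Theta> \<times> sphere 0 1 \<times> UNIV) (snd a))) \<and>
     (\<forall>a\<in>A. \<forall>b\<in>A. \<forall>x\<in>fst a \<inter> fst b.
        circle_fibre a x = circle_fibre b x \<and> compact_fibre a x = compact_fibre b x \<and>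
        (\<forall>c\<in>D. x \<in> fst c \<longrightarrow> (\<exists>r>0. circle_vector c a x = r *\<^sub>R circle_vector c b x))) \<and>
     (\<forall>c\<in>D. \<forall>x\<in>fst c.
        has_signature (form (g c x)) (horizontal g A c x) 1 3 \<and>
        (\<forall>v\<in>tangent_space c x (circle_at A x). v \<noteq> 0 \<longrightarrow> form (g c x) v v < 0) \<and>
        (\<forall>v\<in>tangent_space c x (compact_at A x). v \<noteq> 0 \<longrightarrow> form (g c x) v v > 0)) \<and>
     (\<forall>a\<in>A. \<forall>b\<in>A. \<forall>c\<in>D. \<forall>x\<in>fst a \<inter> fst b \<inter> fst c.
        form (g c x) (time_vector c a x) (time_vector c b x) < 0)"

definition complete_observation_atlas ::
  "('d::topological_space, real^'n) chart set \<Rightarrow> ('w::topological_space, 'e::euclidean_space) chart set \<Rightarrow>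
   ('d, 'n::finite) tensor2 \<Rightarrow> ('d, 'w) obs set \<Rightarrow> bool" where
  "complete_observation_atlas D W g A \<longleftrightarrow> observation_atlas D W g A \<and>
     (\<forall>A'. observation_atlas D W g A' \<and> A \<subseteq> A' \<longrightarrow> A' = A)"

section \<open>Fluid type domains\<close>

definition circle_field ::
  "('d, real^'n) chart set \<Rightarrow> ('d, 'n::finite) tensor2 \<Rightarrow> ('d, 'w) obs set \<Rightarrow> ('d, 'n::finite) vfield \<Rightarrow> bool" where
  "circle_field D g A Y \<longleftrightarrow> smooth_vector_field D Y \<and>
     (\<forall>c\<in>D. \<forall>x\<in>fst c.
        Y c x \<in> tangent_space c x (circle_at A x) \<and>
        (\<forall>a\<in>A. x \<in> fst a \<longrightarrow> (\<exists>r>0. Y c x = r *\<^sub>R circle_vector c a x)) \<and>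
        form (g c x) (Y c x) (Y c x) = -1)"

text \<open>The eigenspace, for the eigenvalue \<open>l\<close>, of the endomorphism \<open>Z \<mapsto> pr\<^sub>H(\<^sup>eG(Z))\<close> of \<open>H\<^sub>x\<close>.\<close>

definition fluid_eigenspace ::
  "('d, 'n::finite) tensor2 \<Rightarrow> ('d, 'w) obs set \<Rightarrow> ('d, real^'n) chart \<Rightarrow> 'd \<Rightarrow> real \<Rightarrow> (real^'n) set" where
  "fluid_eigenspace g A c x l =
     {z \<in> horizontal g A c x.
        orth_proj (form (g c x)) (horizontal g A c x) (endo g (gravity g) c x *v z) = l *\<^sub>R z}"

definition timelike_eigenline ::
  "('d, 'n::finite) tensor2 \<Rightarrow> ('d, 'w) obs set \<Rightarrow> ('d, real^'n) chart \<Rightarrow> 'd \<Rightarrow> real \<Rightarrow> bool" where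
  "timelike_eigenline g A c x l \<longleftrightarrow>
     dim (fluid_eigenspace g A c x l) = 1 \<and>
     (\<forall>z\<in>fluid_eigenspace g A c x l. z \<noteq> 0 \<longrightarrow> form (g c x) z z < 0)"

definition fluid_type_domain ::
  "('d::{second_countable_topology,t2_space}, real^'n) chart set \<Rightarrow>
   ('w::{second_countable_topology,t2_space}, real^'n) chart set \<Rightarrow>
   ('d, 'n::finite) tensor2 \<Rightarrow> ('d, 'w) obs set \<Rightarrow> bool" where
  "fluid_type_domain D W g A \<longleftrightarrow>
     smooth_manifold CARD('n) D \<and> pseudo_riemannian D g \<and>
     5 \<le> CARD('n) \<and> smooth_manifold (CARD('n) - 5) W \<and> compact (UNIV :: 'w set) \<and>
     complete_observation_atlas D W g A \<and>
     (\<forall>x. \<exists>m>0. \<forall>c\<in>D. x \<in> fst c \<longrightarrow> timelike_eigenline g A c x (- m)) \<and>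
     (\<forall>Y. circle_field D g A Y \<longrightarrow> killing D g Y)"

text \<open>The density \<open>\<mu>\<close> and the field \<open>X\<^sub>0\<close>. A timelike vector of \<open>H\<^sub>x\<close> is in the time orientation
  when its product with the time vectors of the atlas is negative.\<close>

definition fluid_density_and_velocity ::
  "('d, real^'n) chart set \<Rightarrow> ('d, 'n::finite) tensor2 \<Rightarrow> ('d, 'w) obs set \<Rightarrow>
   ('d \<Rightarrow> real) \<Rightarrow> ('d, 'n::finite) vfield \<Rightarrow> bool" where
  "fluid_density_and_velocity D g A \<mu> X0 \<longleftrightarrow>
     smooth_function D \<mu> \<and> smooth_vector_field D X0 \<and> (\<forall>x. \<mu> x > 0) \<and>
     (\<forall>c\<in>D. \<forall>x\<in>fst c.
        timelike_eigenline g A c x (- \<mu> x) \<and>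
        span {X0 c x} = fluid_eigenspace g A c x (- \<mu> x) \<and>
        form (g c x) (X0 c x) (X0 c x) = -1 \<and>
        (\<forall>a\<in>A. x \<in> fst a \<longrightarrow> form (g c x) (X0 c x) (time_vector c a x) < 0))"

section \<open>Characterization of the Christoffel symbols\<close>

lemma partial_cong_on:
  assumes D: "smooth_manifold CARD('n) D" "c \<in> D" "x \<in> fst c"
    and eq: "\<And>y. y \<in> fst c \<Longrightarrow> f y = h y"
  shows "partial c i f x = partial (c :: ('d::topological_space, real^'n) chart) i h x"
proof -
  obtain E :: "(real^'n) set" where E: "subspace E" "dim E = CARD('n)"
    and hom: "openin (top_of_set E) (snd c ` fst c)"
    using D by (auto simp: smooth_manifold_def)
  have "E = UNIV"
    using E dim_eq_full[of E] span_eq_iff[of E] by simp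
  then have op: "open (snd c ` fst c)"
    using hom by simp
  have inv: "chart_inv c y \<in> fst c" if "y \<in> snd c ` fst c" for y
    using that by (simp add: chart_inv_def inv_into_into)
  have fh: "(f \<circ> chart_inv c) z = (h \<circ> chart_inv c) z" if "z \<in> snd c ` fst c" for z
    using eq inv[OF that] by simp
  have x: "snd c x \<in> snd c ` fst c"
    using D(3) by (rule imageI)
  have "(f \<circ> chart_inv c has_derivative L) (at (snd c x)) \<longleftrightarrow>
        (h \<circ> chart_inv c has_derivative L) (at (snd c x))" for L
    by (intro iffI; erule has_derivative_transform_within_open[OF _ op x]) (simp_all only: fh)
  then show ?thesis
    by (simp add: partial_def frechet_derivative_def)
qed

text \<open>The Christoffel symbols are the unique torsion-free connection coefficients for which
  \<open>\<nabla>g = 0\<close>.\<close>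

lemma christoffel_iff:
  fixes D :: "('d::topological_space, real^'n) chart set"
  assumes D: "smooth_manifold CARD('n) D" "c \<in> D" "x \<in> fst c"
    and g: "pseudo_riemannian D g"
  shows "\<Gamma> = christoffel g c x \<longleftrightarrow>
     (\<forall>k i j. \<Gamma> k i j = \<Gamma> k j i) \<and>
     (\<forall>m i j. partial c m (\<lambda>y. g c y $ i $ j) x
        = (\<Sum>k\<in>UNIV. \<Gamma> k m i * g c x $ k $ j) + (\<Sum>k\<in>UNIV. \<Gamma> k m j * g c x $ i $ k))"
    (is "_ \<longleftrightarrow> ?sym \<and> ?metric")
proof -
  define p where "p m i j = partial c m (\<lambda>y. g c y $ i $ j) x" for m i j
  have gs: "g c y $ i $ j = g c y $ j $ i" if "y \<in> fst c" for y i j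
  proof -
    have "transpose (g c y) = g c y"
      using g D(2) that by (simp add: pseudo_riemannian_def)
    from this[symmetric] have "g c y $ i $ j = transpose (g c y) $ i $ j"
      by simp
    then show ?thesis by (simp add: transpose_def)
  qed
  have ps: "p m i j = p m j i" for m i j
    unfolding p_def by (rule partial_cong_on[OF D]) (simp add: gs)
  have inv: "invertible (g c x)"
    using g D by (simp add: pseudo_riemannian_def)
  have gg: "g c x ** ginv g c x = mat 1 \<and> ginv g c x ** g c x = mat 1"
    unfolding ginv_def matrix_inv_def
    by (rule someI_ex) (use inv in \<open>simp add: invertible_def\<close>)
  have gi: "(\<Sum>l\<in>UNIV. g c x $ k $ l * ginv g c x $ l $ j) = (if k = j then 1 else 0)" for k j
  proof -
    have "g c x ** ginv g c x = mat 1"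
      by (simp add: gg)
    then have "(g c x ** ginv g c x) $ k $ j = mat 1 $ k $ j" by simp
    then show ?thesis by (simp add: matrix_matrix_mult_def mat_def)
  qed
  have ig: "(\<Sum>l\<in>UNIV. ginv g c x $ k $ l * g c x $ l $ j) = (if k = j then 1 else 0)" for k j
  proof -
    have "ginv g c x ** g c x = mat 1"
      by (simp add: gg)
    then have "(ginv g c x ** g c x) $ k $ j = mat 1 $ k $ j" by simp
    then show ?thesis by (simp add: matrix_matrix_mult_def mat_def)
  qed
  have chr: "christoffel g c x k i j =
      (1/2) * (\<Sum>l\<in>UNIV. ginv g c x $ k $ l * (p i j l + p j i l - p l i j))" for k i j
    by (simp add: christoffel_def p_def)
  have lower: "(\<Sum>k\<in>UNIV. g c x $ m $ k * christoffel g c x k i j) = (1/2) * (p i j m + p j i m - p m i j)"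
    for m i j
  proof -
    have "(\<Sum>k\<in>UNIV. g c x $ m $ k * christoffel g c x k i j)
        = (\<Sum>k\<in>UNIV. \<Sum>l\<in>UNIV. (1/2) * (g c x $ m $ k * ginv g c x $ k $ l * (p i j l + p j i l - p l i j)))"
      unfolding chr by (simp add: sum_distrib_left mult_ac)
    also have "\<dots> = (\<Sum>l\<in>UNIV. (1/2) * ((\<Sum>k\<in>UNIV. g c x $ m $ k * ginv g c x $ k $ l) * (p i j l + p j i l - p l i j)))"
      by (subst sum.swap) (simp only: sum_distrib_left sum_distrib_right)
    also have "\<dots> = (1/2) * (p i j m + p j i m - p m i j)"
      unfolding gi sum_distrib_left[symmetric] by (simp add: if_distrib[of "\<lambda>t. t * _"] cong: if_cong)
    finally show ?thesis .
  qed
  show ?thesis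
  proof (intro iffI)
    assume G: "\<Gamma> = christoffel g c x"
    have "?sym"
      unfolding G chr by (simp add: ps algebra_simps)
    moreover have "?metric"
    proof (intro allI)
      fix m i j
      have "(\<Sum>k\<in>UNIV. \<Gamma> k m i * g c x $ k $ j) = (\<Sum>k\<in>UNIV. g c x $ j $ k * \<Gamma> k m i)"
        by (intro sum.cong refl) (simp add: gs[OF D(3), of _ j] mult.commute)
      moreover have "(\<Sum>k\<in>UNIV. \<Gamma> k m j * g c x $ i $ k) = (\<Sum>k\<in>UNIV. g c x $ i $ k * \<Gamma> k m j)"
        by (simp add: mult.commute)
      ultimately show "partial c m (\<lambda>y. g c y $ i $ j) x
        = (\<Sum>k\<in>UNIV. \<Gamma> k m i * g c x $ k $ j) + (\<Sum>k\<in>UNIV. \<Gamma> k m j * g c x $ i $ k)"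
        using lower[of j m i] lower[of i m j] ps[of m j i]
        unfolding G p_def[symmetric] by (simp only:) (simp add: field_simps)
    qed
    ultimately show "?sym \<and> ?metric" ..
  next
    assume a: "?sym \<and> ?metric"
    define q where "q l i j = (\<Sum>k\<in>UNIV. g c x $ l $ k * \<Gamma> k i j)" for l i j
    have qs: "q l i j = q l j i" for l i j
      unfolding q_def using a by (intro sum.cong refl) metis
    have pq: "p m i j = q j m i + q i m j" for m i j
    proof -
      have "(\<Sum>k\<in>UNIV. \<Gamma> k m i * g c x $ k $ j) = q j m i"
        unfolding q_def by (intro sum.cong refl) (simp add: gs[OF D(3), of _ j] mult.commute)
      moreover have "(\<Sum>k\<in>UNIV. \<Gamma> k m j * g c x $ i $ k) = q i m j"
        unfolding q_def by (simp add: mult.commute)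
      moreover have "p m i j = (\<Sum>k\<in>UNIV. \<Gamma> k m i * g c x $ k $ j) + (\<Sum>k\<in>UNIV. \<Gamma> k m j * g c x $ i $ k)"
        using a by (simp add: p_def)
      ultimately show ?thesis by simp
    qed
    have ql: "(1/2) * (p i j l + p j i l - p l i j) = q l i j" for i j l
      unfolding pq qs[of l j i] qs[of j l i] qs[of i l j] by simp
    have "christoffel g c x k i j = \<Gamma> k i j" for k i j
    proof -
      have "christoffel g c x k i j = (\<Sum>l\<in>UNIV. ginv g c x $ k $ l * q l i j)"
        unfolding chr by (simp add: ql[symmetric] sum_distrib_left mult_ac)
      also have "\<dots> = (\<Sum>m\<in>UNIV. (\<Sum>l\<in>UNIV. ginv g c x $ k $ l * g c x $ l $ m) * \<Gamma> m i j)"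
        unfolding q_def by (simp add: sum_distrib_left sum_distrib_right mult_ac) (rule sum.swap)
      also have "\<dots> = \<Gamma> k i j"
        by (simp add: ig if_distrib[of "\<lambda>t. t * _"] cong: if_cong)
      finally show ?thesis .
    qed
    then show "\<Gamma> = christoffel g c x" by (intro ext) simp
  qed
qed

end

theory Submission
  imports Defs
begin

text \<open>In a chart everything becomes matrix calculus: the connection is a matrix \<open>\<Gamma>\<^sub>u\<close> depending linearly on a
  direction \<open>u\<close>, with \<open>\<partial>\<^sub>u g = \<Gamma>\<^sub>u\<^sup>T g + g \<Gamma>\<^sub>u\<close> and \<open>\<Gamma>\<^sub>u v = \<Gamma>\<^sub>v u\<close>, and the curvature is
  \<open>R(u,v) = \<partial>\<^sub>u \<Gamma>\<^sub>v - \<partial>\<^sub>v \<Gamma>\<^sub>u + [\<Gamma>\<^sub>u, \<Gamma>\<^sub>v]\<close>. Besides the contracted Bianchi identity \<open>\<nabla> \<cdot> G = 0\<close> and the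
  identities \<open>L\<^sub>Y G = 0\<close>, \<open>\<nabla>\<^sub>w(\<nabla>Y) = R(w,Y)\<close> for the Killing field \<open>Y\<close>, the proof needs that \<open>Y\<close> preserves
  \<open>X0\<close>, \<open>\<mu>\<close>, \<open>\<rho>\<close> and \<open>\<sigma>\<close>. For this, \<open>H\<^sub>x\<close> is spanned by the gradients of the four functions
  \<open>x\<^sub>i\<^sup>1\<close>, which are constant along \<open>Y\<close>, so that these gradients commute with \<open>Y\<close>; differentiating the
  eigenvalue equation \<open>G(X0, Z) = - \<mu> g(X0, Z)\<close> for such \<open>Z\<close> along \<open>Y\<close> shows that \<open>[Y, X0]\<close> lies in the
  eigenline of \<open>X0\<close>, while \<open>g(X0, X0) = -1\<close> makes it orthogonal to \<open>X0\<close>. Then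
  \<open>\<nabla> \<cdot> P = - \<nabla> \<cdot> (\<mu> X) X - \<mu> D\<^sub>X X\<close>, and the claims follow by taking frame_products with \<open>X0\<close> and \<open>Y\<close>.\<close>

section \<open>Smooth maps and directional derivatives\<close>

text \<open>No flow of Y and no adapted coordinates are constructed: invariance under Y is expressed
  by infinitesimal identities, and every claim is checked in one chart at a time. The obstacle is
  that the eigenvalue equation for X0 sees only H, so that \<rho> = G(X0, Y) stays free. This is why
  X0 is corrected to X = X0 + (\<rho>/\<mu>) Y, for which G on the span of X0 and Y has no mixed
  term. In the divergence of G the rank-one part \<sigma> Y Y contributes nothing, since Y(\<sigma>)
  = 0, div Y = 0 and D_Y Y = 0, the last because Y has constant length. The formula for the
  divergence of F is not a frame product. With A the covariant derivative of Y, F = -2 g A; the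
  identity for the derivative of A contracts to div F = -2 Ric(Y), and differentiating A Y = 0 gives
  Ric(Y, Y) = - tr(A A), a quarter of the square of F. Writing 2 Ric(Y) = G(Y) + S Y and eliminating
  S by the (Y, Y) entry of G leaves \<rho> X0, the square of F and P(Y).\<close>

definition Cinf_on :: "'a::euclidean_space set \<Rightarrow> ('a \<Rightarrow> 'b::real_normed_vector) \<Rightarrow> bool" where
  "Cinf_on S f \<longleftrightarrow> (\<forall>k. Ck_on k S f)"

text \<open>Putting the direction first lets derivatives iterate as \<open>dd u (dd v f)\<close>.
  Where \<open>f\<close> is not differentiable the value is arbitrary, hence the differentiability
  side conditions below.\<close>

definition dd :: "'a::euclidean_space \<Rightarrow> ('a \<Rightarrow> 'b::real_normed_vector) \<Rightarrow> 'a \<Rightarrow> 'b" where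
  "dd u f x = frechet_derivative f (at x) u"

lemma differentiable_at_cong_open:
  assumes "open S" "x \<in> S" "\<And>y. y \<in> S \<Longrightarrow> f y = h y" "f differentiable (at x)"
  shows "h differentiable (at x)"
  using assms has_derivative_transform_within_open[of f _ x UNIV S h]
  unfolding differentiable_def by blast

text \<open>\<open>frechet_derivative\<close> is defined by choice, so agreement near
  \<open>x\<close> is used to show that both functions have the same derivatives there. Identities
  valid on an open set are differentiated through this rule.\<close>

lemma dd_cong:
  assumes "open S" "x \<in> S" "\<And>y. y \<in> S \<Longrightarrow> f y = h y"
  shows "dd u f x = dd u h x"
proof -
  have "(f has_derivative L) (at x) \<longleftrightarrow> (h has_derivative L) (at x)" for L
    using assms has_derivative_transform_within_open[of f L x UNIV S h]
      has_derivative_transform_within_open[of h L x UNIV S f] by auto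
  then show ?thesis
    by (simp add: dd_def frechet_derivative_def)
qed

lemma dd_eqI: "(f has_derivative f') (at x) \<Longrightarrow> dd u f x = f' u"
  unfolding dd_def by (metis frechet_derivative_at)

lemma has_derivative_dd: "f differentiable (at x) \<Longrightarrow> (f has_derivative (\<lambda>u. dd u f x)) (at x)"
  unfolding dd_def by (simp add: frechet_derivative_works)

section \<open>Closure properties of \<open>Ck_on\<close> and \<open>Cinf_on\<close>\<close>

lemma Ck_on_cong:
  assumes "open S" "\<And>x. x \<in> S \<Longrightarrow> f x = h x"
  shows "Ck_on k S f \<longleftrightarrow> Ck_on k S h"
  using assms(2)
proof (induction k arbitrary: f h)
  case 0
  then show ?case by (auto intro: continuous_on_cong[THEN iffD1, rotated -1])
next
  case (Suc k)
  have "f differentiable (at x) \<longleftrightarrow> h differentiable (at x)" if "x \<in> S" for x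
    using differentiable_at_cong_open[OF assms(1) that, of f h]
      differentiable_at_cong_open[OF assms(1) that, of h f] Suc.prems by auto
  moreover have "Ck_on k S (\<lambda>x. frechet_derivative f (at x) v) \<longleftrightarrow> Ck_on k S (\<lambda>x. frechet_derivative h (at x) v)" for v
    by (rule Suc.IH) (use dd_cong[OF assms(1) _ Suc.prems] in \<open>simp add: dd_def\<close>)
  ultimately show ?case by auto
qed

text \<open>Lets the closure rules work with an explicit derivative instead of the chosen
  \<open>frechet_derivative\<close>.\<close>

lemma Ck_on_SucI:
  assumes "open S" "\<And>x. x \<in> S \<Longrightarrow> (f has_derivative f' x) (at x)"
    and "\<And>v. Ck_on k S (\<lambda>x. f' x v)"
  shows "Ck_on (Suc k) S f"
proof -
  have "Ck_on k S (\<lambda>x. frechet_derivative f (at x) v)" for v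
    using assms(3)[of v]
    by (subst Ck_on_cong[OF assms(1)]) (auto simp: frechet_derivative_at[OF assms(2), symmetric])
  then show ?thesis using assms(2) by (auto simp: differentiable_def)
qed

lemma Ck_on_SucD:
  assumes "Ck_on (Suc k) S f"
  shows "x \<in> S \<Longrightarrow> (f has_derivative (\<lambda>u. dd u f x)) (at x)" "Ck_on k S (dd v f)"
  using assms has_derivative_dd[of f x] by (auto simp: dd_def[abs_def])

lemma Ck_on_pred: "Ck_on (Suc k) S f \<Longrightarrow> Ck_on k S f"
proof (induction k arbitrary: f)
  case 0
  then have "f differentiable_on S"
    by (auto simp: differentiable_on_def intro: differentiable_at_withinI)
  then show ?case by (simp add: differentiable_imp_continuous_on)
next
  case (Suc k)
  then show ?case by (metis Ck_on.simps(2))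
qed

lemma Ck_on_subset: "Ck_on k S f \<Longrightarrow> T \<subseteq> S \<Longrightarrow> Ck_on k T f"
  by (induction k arbitrary: f) (auto intro: continuous_on_subset)

lemma Ck_on_local:
  assumes "\<And>x. x \<in> S \<Longrightarrow> \<exists>T. open T \<and> x \<in> T \<and> Ck_on k T f"
  shows "Ck_on k S f"
  using assms
proof (induction k arbitrary: f)
  case 0
  then show ?case
    by (metis Ck_on.simps(1) continuous_at_imp_continuous_on continuous_on_eq_continuous_at)
next
  case (Suc k)
  have "f differentiable (at x)" if "x \<in> S" for x
    using Suc.prems[OF that] by auto
  moreover have "Ck_on k S (\<lambda>x. frechet_derivative f (at x) v)" for v
    by (rule Suc.IH) (use Suc.prems in \<open>simp; blast\<close>)
  ultimately show ?case by simp
qed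

lemma Ck_on_const: "open S \<Longrightarrow> Ck_on k S (\<lambda>x. c)"
  by (induction k arbitrary: c) (simp, rule Ck_on_SucI[where f'="\<lambda>x v. 0"], auto)

lemma Ck_on_add:
  assumes "open S" "Ck_on k S f" "Ck_on k S h"
  shows "Ck_on k S (\<lambda>x. f x + h x)"
  using assms(2,3)
proof (induction k arbitrary: f h)
  case 0
  then show ?case by (auto intro: continuous_on_add)
next
  case (Suc k)
  show ?case
    by (rule Ck_on_SucI[OF assms(1) has_derivative_add[OF Ck_on_SucD(1)[OF Suc.prems(1)] Ck_on_SucD(1)[OF Suc.prems(2)]]])
      (assumption | rule Suc.IH Ck_on_SucD(2)[OF Suc.prems(1)] Ck_on_SucD(2)[OF Suc.prems(2)])+
qed

text \<open>The product rule expresses the derivative by two products of the same shape at order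
  \<open>k\<close>, hence the induction over all pairs. One rule covers scalar, inner, matrix and
  outer products.\<close>

lemma Ck_on_bilinear:
  assumes "open S" "bounded_bilinear B" "Ck_on k S f" "Ck_on k S h"
  shows "Ck_on k S (\<lambda>x. B (f x) (h x))"
  using assms(3,4)
proof (induction k arbitrary: f h)
  case 0
  then show ?case by (auto intro: bounded_bilinear.continuous_on[OF assms(2)])
next
  case (Suc k)
  show ?case
    by (rule Ck_on_SucI[OF assms(1) bounded_bilinear.FDERIV[OF assms(2) Ck_on_SucD(1)[OF Suc.prems(1)] Ck_on_SucD(1)[OF Suc.prems(2)]]])
      (assumption | rule Ck_on_add assms(1) Suc.IH Ck_on_SucD(2)[OF Suc.prems(1)] Ck_on_SucD(2)[OF Suc.prems(2)]
        Ck_on_pred[OF Suc.prems(1)] Ck_on_pred[OF Suc.prems(2)])+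
qed

lemma Ck_on_linear:
  assumes "open S" "bounded_linear T" "Ck_on k S f"
  shows "Ck_on k S (\<lambda>x. T (f x))"
  using assms(3)
proof (induction k arbitrary: f)
  case 0
  then show ?case by (auto intro: bounded_linear.continuous_on[OF assms(2)])
next
  case (Suc k)
  show ?case
    by (rule Ck_on_SucI[OF assms(1) bounded_linear.has_derivative[OF assms(2) Ck_on_SucD(1)[OF Suc.prems]]])
      (assumption | rule Suc.IH Ck_on_SucD(2)[OF Suc.prems])+
qed

text \<open>\<open>f\<close> stays fixed in the induction: the derivative of \<open>1/f\<close>
  involves \<open>1/f\<close> itself, whose smoothness of order \<open>k\<close> is the induction
  hypothesis.\<close>

lemma Ck_on_inverse:
  fixes f :: "'a::euclidean_space \<Rightarrow> real"
  assumes "open S" "\<And>x. x \<in> S \<Longrightarrow> f x \<noteq> 0" "Ck_on k S f"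
  shows "Ck_on k S (\<lambda>x. inverse (f x))"
  using assms(3)
proof (induction k)
  case 0
  then show ?case using assms(2) by (auto intro: continuous_on_inverse)
next
  case (Suc k)
  note inv = Suc.IH[OF Ck_on_pred[OF Suc.prems]]
  note mul = Ck_on_bilinear[OF assms(1) bounded_bilinear_mult]
  show ?case
  proof (rule Ck_on_SucI[OF assms(1) Deriv.has_derivative_inverse[OF assms(2) Ck_on_SucD(1)[OF Suc.prems]]])
    show "Ck_on k S (\<lambda>x. - (inverse (f x) * dd v f x * inverse (f x)))" for v
      by (intro Ck_on_linear[OF assms(1) bounded_linear_minus[OF bounded_linear_ident]] mul inv Ck_on_SucD(2)[OF Suc.prems])
  qed
qed

lemma Cinf_on_cong: "open S \<Longrightarrow> (\<And>x. x \<in> S \<Longrightarrow> f x = h x) \<Longrightarrow> Cinf_on S f \<longleftrightarrow> Cinf_on S h"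
  unfolding Cinf_on_def using Ck_on_cong[of S f h] by simp

lemma Cinf_on_subset: "Cinf_on S f \<Longrightarrow> T \<subseteq> S \<Longrightarrow> Cinf_on T f"
  unfolding Cinf_on_def using Ck_on_subset by blast

lemma Cinf_on_local:
  "(\<And>x. x \<in> S \<Longrightarrow> \<exists>T. open T \<and> x \<in> T \<and> Cinf_on T f) \<Longrightarrow> Cinf_on S f"
  unfolding Cinf_on_def by (intro allI Ck_on_local) blast

text \<open>On an open set each local extension coincides with \<open>f\<close> near the point, so
  the extension clause disappears.\<close>

lemma smooth_on_open:
  assumes "open S" "smooth_on S f"
  shows "Cinf_on S f"
proof (rule Cinf_on_local)
  fix x assume "x \<in> S"
  then obtain T h where T: "open T" "x \<in> T" "\<forall>k. Ck_on k T h" "\<forall>y\<in>T \<inter> S. h y = f y"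
    using assms(2) unfolding smooth_on_def by blast
  have "Cinf_on (T \<inter> S) h"
    using T(3) Ck_on_subset unfolding Cinf_on_def by blast
  then have "Cinf_on (T \<inter> S) f"
    using Cinf_on_cong[of "T \<inter> S" h f] T assms(1) by auto
  then show "\<exists>T. open T \<and> x \<in> T \<and> Cinf_on T f"
    using T \<open>x \<in> S\<close> assms(1) by blast
qed

lemma Cinf_on_differentiable: "Cinf_on S f \<Longrightarrow> x \<in> S \<Longrightarrow> f differentiable (at x)"
  unfolding Cinf_on_def by (metis Ck_on.simps(2))

lemma Cinf_on_has_derivative: "Cinf_on S f \<Longrightarrow> x \<in> S \<Longrightarrow> (f has_derivative (\<lambda>u. dd u f x)) (at x)"
  by (rule has_derivative_dd[OF Cinf_on_differentiable])

lemma Cinf_on_dd: "Cinf_on S f \<Longrightarrow> Cinf_on S (dd v f)"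
  unfolding Cinf_on_def using Ck_on_SucD(2) by blast

lemma Cinf_on_continuous: "Cinf_on S f \<Longrightarrow> continuous_on S f"
  unfolding Cinf_on_def by (metis Ck_on.simps(1))

lemma Cinf_on_const: "open S \<Longrightarrow> Cinf_on S (\<lambda>x. c)"
  by (simp add: Cinf_on_def Ck_on_const)

lemma Cinf_on_linear: "open S \<Longrightarrow> bounded_linear T \<Longrightarrow> Cinf_on S f \<Longrightarrow> Cinf_on S (\<lambda>x. T (f x))"
  by (simp add: Cinf_on_def Ck_on_linear)

lemma Cinf_on_bilinear:
  "open S \<Longrightarrow> bounded_bilinear B \<Longrightarrow> Cinf_on S f \<Longrightarrow> Cinf_on S h \<Longrightarrow> Cinf_on S (\<lambda>x. B (f x) (h x))"
  by (simp add: Cinf_on_def Ck_on_bilinear)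

lemma Cinf_on_add: "open S \<Longrightarrow> Cinf_on S f \<Longrightarrow> Cinf_on S h \<Longrightarrow> Cinf_on S (\<lambda>x. f x + h x)"
  by (simp add: Cinf_on_def Ck_on_add)

lemma Cinf_on_minus: "open S \<Longrightarrow> Cinf_on S f \<Longrightarrow> Cinf_on S (\<lambda>x. - f x)"
  using Cinf_on_linear[OF _ bounded_linear_minus[OF bounded_linear_ident]] .

lemma Cinf_on_diff: "open S \<Longrightarrow> Cinf_on S f \<Longrightarrow> Cinf_on S h \<Longrightarrow> Cinf_on S (\<lambda>x. f x - h x)"
  using Cinf_on_add[of S f "\<lambda>x. - h x"] Cinf_on_minus[of S h] by simp

lemma Cinf_on_sum: "open S \<Longrightarrow> (\<And>i. i \<in> I \<Longrightarrow> Cinf_on S (f i)) \<Longrightarrow> Cinf_on S (\<lambda>x. \<Sum>i\<in>I. f i x)"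
  by (induction I rule: infinite_finite_induct) (auto intro: Cinf_on_const Cinf_on_add)

lemma Cinf_on_scaleR: "open S \<Longrightarrow> Cinf_on S f \<Longrightarrow> Cinf_on S h \<Longrightarrow> Cinf_on S (\<lambda>x. f x *\<^sub>R h x)"
  using Cinf_on_bilinear[OF _ bounded_bilinear_scaleR] .

lemma Cinf_on_mult:
  fixes f :: "'a::euclidean_space \<Rightarrow> real"
  shows "open S \<Longrightarrow> Cinf_on S f \<Longrightarrow> Cinf_on S h \<Longrightarrow> Cinf_on S (\<lambda>x. f x * h x)"
  using Cinf_on_bilinear[OF _ bounded_bilinear_mult] .

lemma Cinf_on_prod:
  fixes f :: "'i \<Rightarrow> 'a::euclidean_space \<Rightarrow> real"
  shows "open S \<Longrightarrow> (\<And>i. i \<in> I \<Longrightarrow> Cinf_on S (f i)) \<Longrightarrow> Cinf_on S (\<lambda>x. \<Prod>i\<in>I. f i x)"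
  by (induction I rule: infinite_finite_induct) (auto intro: Cinf_on_const Cinf_on_mult)

lemma Cinf_on_inner: "open S \<Longrightarrow> Cinf_on S f \<Longrightarrow> Cinf_on S h \<Longrightarrow> Cinf_on S (\<lambda>x. f x \<bullet> h x)"
  using Cinf_on_bilinear[OF _ bounded_bilinear_inner] .

lemma Cinf_on_divide:
  fixes f :: "'a::euclidean_space \<Rightarrow> real"
  assumes "open S" "Cinf_on S f" "Cinf_on S h" "\<And>x. x \<in> S \<Longrightarrow> h x \<noteq> 0"
  shows "Cinf_on S (\<lambda>x. f x / h x)"
  using assms unfolding divide_inverse by (intro Cinf_on_mult) (auto simp: Cinf_on_def Ck_on_inverse)

lemma Cinf_on_nth: "open S \<Longrightarrow> Cinf_on S f \<Longrightarrow> Cinf_on S (\<lambda>x. f x $ i)"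
  using Cinf_on_linear[OF _ bounded_linear_vec_nth] .

lemma Cinf_on_vec:
  fixes f :: "'i::finite \<Rightarrow> 'a::euclidean_space \<Rightarrow> 'b::euclidean_space"
  assumes "open S" "\<And>i. Cinf_on S (f i)"
  shows "Cinf_on S (\<lambda>x. \<chi> i. f i x)"
proof -
  have lin: "bounded_linear (\<lambda>b::'b. axis i b :: 'b^'i)" for i
    by (auto simp: linear_conv_bounded_linear[symmetric] vec_eq_iff axis_def intro!: linearI)
  have "(\<chi> i. f i x) = (\<Sum>i\<in>UNIV. axis i (f i x))" for x
    by (simp add: vec_eq_iff axis_def if_distrib sum.delta cong: if_cong)
  then show ?thesis
    using assms Cinf_on_sum[OF assms(1), of UNIV "\<lambda>i x. axis i (f i x)"] Cinf_on_linear[OF assms(1) lin] by simp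
qed

section \<open>Smoothness of matrix operations\<close>

lemma bounded_bilinear_matrix_mult:
  "bounded_bilinear ((**) :: real^'n::finite^'m::finite \<Rightarrow> real^'p::finite^'n \<Rightarrow> real^'p^'m)"
  unfolding bilinear_conv_bounded_bilinear[symmetric] bilinear_def
  by (auto simp: matrix_matrix_mult_def vec_eq_iff algebra_simps sum.distrib sum_distrib_left intro!: linearI)

lemma bounded_bilinear_matrix_vector:
  "bounded_bilinear ((*v) :: real^'n::finite^'m::finite \<Rightarrow> real^'n \<Rightarrow> real^'m)"
  unfolding bilinear_conv_bounded_bilinear[symmetric] bilinear_def
  by (auto simp: matrix_vector_mult_def vec_eq_iff algebra_simps sum.distrib sum_distrib_left intro!: linearI)

lemma bounded_linear_transpose: "bounded_linear (transpose :: real^'n::finite^'m::finite \<Rightarrow> real^'m^'n)"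
  by (auto simp: linear_conv_bounded_linear[symmetric] transpose_def vec_eq_iff intro!: linearI)

lemma bounded_linear_trace: "bounded_linear (trace :: real^'n::finite^'n \<Rightarrow> real)"
  by (auto simp: linear_conv_bounded_linear[symmetric] trace_def sum.distrib sum_distrib_left intro!: linearI)

lemma matrix_inv_works:
  fixes M :: "real^'n::finite^'n"
  assumes "invertible M"
  shows "M ** matrix_inv M = mat 1" "matrix_inv M ** M = mat 1"
proof -
  have "M ** matrix_inv M = mat 1 \<and> matrix_inv M ** M = mat 1"
    unfolding matrix_inv_def by (rule someI_ex) (use assms in \<open>simp add: invertible_def\<close>)
  then show "M ** matrix_inv M = mat 1" "matrix_inv M ** M = mat 1" by auto
qed

text \<open>Cramer's rule: the entries of the inverse are quotients of determinants, which makes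
  their smooth dependence on the matrix visible.\<close>

lemma matrix_inv_component:
  fixes M :: "real^'n::finite^'n"
  assumes "invertible M"
  shows "matrix_inv M $ k $ j = det (\<chi> i l. if l = k then (if i = j then 1 else 0) else M $ i $ l) / det M"
proof -
  have "M *v (matrix_inv M *v axis j 1) = axis j 1"
    by (simp add: matrix_vector_mul_assoc matrix_inv_works[OF assms])
  moreover have "det M \<noteq> 0" using assms by (simp add: invertible_det_nz)
  ultimately have "matrix_inv M *v axis j 1 = (\<chi> k. det (\<chi> i l. if l = k then axis j 1 $ i else M $ i $ l) / det M)"
    using cramer by blast
  moreover have "(matrix_inv M *v axis j 1) $ k = matrix_inv M $ k $ j"
    by (simp add: matrix_vector_mult_basis column_def)
  ultimately show ?thesis by (simp add: axis_def eq_commute cong: if_cong)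
qed

lemma Cinf_on_det:
  fixes M :: "'a::euclidean_space \<Rightarrow> real^'n::finite^'n"
  assumes "open S" "\<And>i j. Cinf_on S (\<lambda>x. M x $ i $ j)"
  shows "Cinf_on S (\<lambda>x. det (M x))"
  unfolding det_def
  by (intro Cinf_on_sum Cinf_on_mult Cinf_on_const Cinf_on_prod assms)

lemma Cinf_on_matrix_inv:
  fixes M :: "'a::euclidean_space \<Rightarrow> real^'n::finite^'n"
  assumes "open S" "Cinf_on S M" "\<And>x. x \<in> S \<Longrightarrow> invertible (M x)"
  shows "Cinf_on S (\<lambda>x. matrix_inv (M x))"
proof -
  have entry: "Cinf_on S (\<lambda>x. M x $ i $ j)" for i j
    by (intro Cinf_on_nth assms)
  have "Cinf_on S (\<lambda>x. matrix_inv (M x) $ k $ j)" for k j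
  proof -
    have "Cinf_on S (\<lambda>x. det (\<chi> i l. if l = k then (if i = j then 1 else 0) else M x $ i $ l) / det (M x))"
    proof (intro Cinf_on_divide Cinf_on_det assms entry)
      show "Cinf_on S (\<lambda>x. (\<chi> i l. if l = k then (if i = j then 1 else 0) else M x $ i $ l) $ i' $ j')" for i' j'
        by (cases "j' = k"; cases "i' = j") (simp_all add: Cinf_on_const assms(1) entry)
    qed (use assms(3) invertible_det_nz in blast)
    then show ?thesis
      by (subst Cinf_on_cong[OF assms(1)]) (auto simp: matrix_inv_component assms(3))
  qed
  then have "Cinf_on S (\<lambda>x. \<chi> k j. matrix_inv (M x) $ k $ j)"
    by (intro Cinf_on_vec assms)
  then show ?thesis by simp
qed

section \<open>Rules of differentiation for \<open>dd\<close>\<close>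

lemma dd_add: "f differentiable (at x) \<Longrightarrow> h differentiable (at x) \<Longrightarrow> dd u (\<lambda>y. f y + h y) x = dd u f x + dd u h x"
  by (rule dd_eqI) (intro has_derivative_add has_derivative_dd)

lemma dd_diff: "f differentiable (at x) \<Longrightarrow> h differentiable (at x) \<Longrightarrow> dd u (\<lambda>y. f y - h y) x = dd u f x - dd u h x"
  by (rule dd_eqI) (intro has_derivative_diff has_derivative_dd)

lemma dd_minus: "f differentiable (at x) \<Longrightarrow> dd u (\<lambda>y. - f y) x = - dd u f x"
  by (rule dd_eqI) (intro has_derivative_minus has_derivative_dd)

lemma dd_const: "dd u (\<lambda>y. c) x = 0"
  by (rule dd_eqI) simp

lemma dd_sum:
  "(\<And>i. i \<in> I \<Longrightarrow> f i differentiable (at x)) \<Longrightarrow> dd u (\<lambda>y. \<Sum>i\<in>I. f i y) x = (\<Sum>i\<in>I. dd u (f i) x)"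
  by (rule dd_eqI) (intro has_derivative_sum has_derivative_dd)

lemma dd_linear:
  assumes "bounded_linear T" "f differentiable (at x)"
  shows "dd u (\<lambda>y. T (f y)) x = T (dd u f x)"
  by (rule dd_eqI[OF bounded_linear.has_derivative[OF assms(1) has_derivative_dd[OF assms(2)]]])

lemma dd_bilinear:
  assumes "bounded_bilinear B" "f differentiable (at x)" "h differentiable (at x)"
  shows "dd u (\<lambda>y. B (f y) (h y)) x = B (f x) (dd u h x) + B (dd u f x) (h x)"
  by (rule dd_eqI[OF bounded_bilinear.FDERIV[OF assms(1) assms(2,3)[THEN has_derivative_dd]]])

lemmas dd_scaleR = dd_bilinear[OF bounded_bilinear_scaleR]
  and dd_mult = dd_bilinear[OF bounded_bilinear_mult]
  and dd_inner = dd_bilinear[OF bounded_bilinear_inner]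
  and dd_matrix_mult = dd_bilinear[OF bounded_bilinear_matrix_mult]
  and dd_matrix_vector = dd_bilinear[OF bounded_bilinear_matrix_vector]
  and dd_nth = dd_linear[OF bounded_linear_vec_nth]
  and dd_transpose = dd_linear[OF bounded_linear_transpose]
  and dd_trace = dd_linear[OF bounded_linear_trace]

lemma linear_dd: "f differentiable (at x) \<Longrightarrow> linear (\<lambda>u. dd u f x)"
  using has_derivative_dd has_derivative_linear by blast

section \<open>Symmetry of second derivatives\<close>

lemma mixed_difference:
  fixes f :: "'a::euclidean_space \<Rightarrow> real"
  assumes C: "Cinf_on S f" and h: "0 < h"
    and S: "\<And>s t. 0 \<le> s \<Longrightarrow> s \<le> h \<Longrightarrow> 0 \<le> t \<Longrightarrow> t \<le> h \<Longrightarrow> x + s *\<^sub>R u + t *\<^sub>R v \<in> S"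
  shows "\<exists>s t. 0 < s \<and> s < h \<and> 0 < t \<and> t < h \<and>
    f (x + h *\<^sub>R u + h *\<^sub>R v) - f (x + h *\<^sub>R u) - f (x + h *\<^sub>R v) + f x
      = h * (h * dd v (dd u f) (x + s *\<^sub>R u + t *\<^sub>R v))"
proof -
  let ?p = "\<lambda>s. f (x + s *\<^sub>R u + h *\<^sub>R v) - f (x + s *\<^sub>R u)"
  have d: "((\<lambda>s. k (a s)) has_real_derivative dd w k (a s)) (at s)"
    if "Cinf_on S k" "a s \<in> S" "(a has_vector_derivative w) (at s)" for k :: "'a \<Rightarrow> real" and a s w
  proof -
    have "((\<lambda>s. k (a s)) has_derivative (\<lambda>r. dd (r *\<^sub>R w) k (a s))) (at s)"
      using has_derivative_compose[OF that(3)[unfolded has_vector_derivative_def] Cinf_on_has_derivative[OF that(1,2)]] .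
    moreover have "dd (r *\<^sub>R w) k (a s) = dd w k (a s) * r" for r
      using linear_scale[OF linear_dd[OF Cinf_on_differentiable[OF that(1,2)]]] by simp
    ultimately show ?thesis
      by (simp add: has_field_derivative_def)
  qed
  \<comment> \<open>The mean value theorem in direction \<open>u\<close>, applied to
    \<open>?p\<close>, and afterwards in direction \<open>v\<close>, applied to
    \<open>dd u f\<close>.\<close>
  have "\<exists>s. 0 < s \<and> s < h \<and> ?p h - ?p 0 = (h - 0) * (dd u f (x + s *\<^sub>R u + h *\<^sub>R v) - dd u f (x + s *\<^sub>R u))"
  proof (rule MVT2[OF h])
    fix s assume s: "0 \<le> s" "s \<le> h"
    show "(?p has_real_derivative dd u f (x + s *\<^sub>R u + h *\<^sub>R v) - dd u f (x + s *\<^sub>R u)) (at s)"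
      by (intro DERIV_diff d[OF C]; (use S[of s h] S[of s 0] s h in simp; fail)?)
        (auto intro!: derivative_eq_intros)
  qed
  then obtain s where s: "0 < s" "s < h"
    "?p h - ?p 0 = h * (dd u f (x + s *\<^sub>R u + h *\<^sub>R v) - dd u f (x + s *\<^sub>R u + 0 *\<^sub>R v))" by auto
  have "\<exists>t. 0 < t \<and> t < h \<and> dd u f (x + s *\<^sub>R u + h *\<^sub>R v) - dd u f (x + s *\<^sub>R u + 0 *\<^sub>R v)
      = (h - 0) * dd v (dd u f) (x + s *\<^sub>R u + t *\<^sub>R v)"
  proof (rule MVT2[OF h])
    fix t assume t: "0 \<le> t" "t \<le> h"
    show "((\<lambda>t. dd u f (x + s *\<^sub>R u + t *\<^sub>R v)) has_real_derivative dd v (dd u f) (x + s *\<^sub>R u + t *\<^sub>R v)) (at t)"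
      by (intro d[OF Cinf_on_dd[OF C]]; (use S[of s t] s t in simp; fail)?)
        (auto intro!: derivative_eq_intros)
  qed
  then obtain t where t: "0 < t" "t < h" "dd u f (x + s *\<^sub>R u + h *\<^sub>R v) - dd u f (x + s *\<^sub>R u + 0 *\<^sub>R v)
      = h * dd v (dd u f) (x + s *\<^sub>R u + t *\<^sub>R v)" by auto
  have "f (x + h *\<^sub>R u + h *\<^sub>R v) - f (x + h *\<^sub>R u) - f (x + h *\<^sub>R v) + f x
      = h * (h * dd v (dd u f) (x + s *\<^sub>R u + t *\<^sub>R v))"
    using s(3) unfolding t(3) by simp
  then show ?thesis using s t by blast
qed

text \<open>Schwarz's theorem. Both orders of differentiation represent the same second difference
  over a small parallelogram, at different intermediate points; continuity at \<open>x\<close> then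
  excludes different values.\<close>

lemma dd_commute_real:
  fixes f :: "'a::euclidean_space \<Rightarrow> real"
  assumes "open S" "x \<in> S" "Cinf_on S f"
  shows "dd u (dd v f) x = dd v (dd u f) x"
proof (rule ccontr)
  let ?a = "dd u (dd v f)" and ?b = "dd v (dd u f)"
  assume ne: "?a x \<noteq> ?b x"
  \<comment> \<open>Half the gap: numbers within \<open>e\<close> of \<open>?a x\<close> and of
    \<open>?b x\<close> cannot be equal.\<close>
  define e where "e = dist (?a x) (?b x) / 2"
  have "e > 0" using ne by (simp add: e_def)
  have "continuous_on S ?a" "continuous_on S ?b"
    by (intro Cinf_on_continuous Cinf_on_dd assms)+
  then have "continuous (at x) ?a" "continuous (at x) ?b"
    using assms(1,2) by (auto simp: continuous_on_eq_continuous_at)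
  then obtain r1 r2 where r: "r1 > 0" "r2 > 0" "\<And>y. dist y x < r1 \<Longrightarrow> dist (?a y) (?a x) < e"
    "\<And>y. dist y x < r2 \<Longrightarrow> dist (?b y) (?b x) < e"
    using \<open>e > 0\<close> unfolding continuous_at_eps_delta by metis
  obtain r3 where r3: "r3 > 0" "ball x r3 \<subseteq> S"
    using assms(1,2) by (meson open_contains_ball)
  define r where "r = min r1 (min r2 r3)"
  \<comment> \<open>Keeps the parallelogram inside the ball of radius \<open>r\<close>; the summand
    1 makes the denominator positive even when both directions vanish.\<close>
  define h where "h = r / (2 * (norm u + norm v + 1))"
  have pos: "norm u + norm v + 1 > 0"
    using norm_ge_zero[of u] norm_ge_zero[of v] by linarith
  have "r > 0" using r r3 by (simp add: r_def)
  then have h: "h > 0" using pos by (simp add: h_def)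
  have near: "dist (x + s *\<^sub>R u + t *\<^sub>R v) x < r" if "0 \<le> s" "s \<le> h" "0 \<le> t" "t \<le> h" for s t
  proof -
    have "dist (x + s *\<^sub>R u + t *\<^sub>R v) x = norm (s *\<^sub>R u + t *\<^sub>R v)"
      by (simp add: dist_norm add.assoc)
    also have "\<dots> \<le> s * norm u + t * norm v"
      using norm_triangle_ineq[of "s *\<^sub>R u" "t *\<^sub>R v"] that by simp
    also have "\<dots> \<le> h * norm u + h * norm v"
      using that by (intro add_mono mult_right_mono) auto
    also have "\<dots> < 2 * (h * (norm u + norm v + 1))"
    proof -
      have "0 \<le> h * norm u" "0 \<le> h * norm v" using h by simp_all
      then show ?thesis using h unfolding ring_distribs by linarith
    qed
    also have "\<dots> = r" using pos by (simp add: h_def field_simps)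
    finally show ?thesis .
  qed
  have inS: "x + s *\<^sub>R u + t *\<^sub>R v \<in> S" if "0 \<le> s" "s \<le> h" "0 \<le> t" "t \<le> h" for s t
    using near[OF that] r3(2) by (auto simp: r_def dist_commute subset_iff)
  obtain s t where st: "0 < s" "s < h" "0 < t" "t < h"
    "f (x + h *\<^sub>R u + h *\<^sub>R v) - f (x + h *\<^sub>R u) - f (x + h *\<^sub>R v) + f x = h * (h * ?b (x + s *\<^sub>R u + t *\<^sub>R v))"
    using mixed_difference[OF assms(3) h inS] by auto
  have inS': "x + s *\<^sub>R v + t *\<^sub>R u \<in> S" if "0 \<le> s" "s \<le> h" "0 \<le> t" "t \<le> h" for s t
    using inS[OF that(3,4,1,2)] by (simp add: algebra_simps)
  obtain s' t' where st': "0 < s'" "s' < h" "0 < t'" "t' < h"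
    "f (x + h *\<^sub>R v + h *\<^sub>R u) - f (x + h *\<^sub>R v) - f (x + h *\<^sub>R u) + f x = h * (h * ?a (x + s' *\<^sub>R v + t' *\<^sub>R u))"
    using mixed_difference[OF assms(3) h inS'] by auto
  have "h * (h * ?a (x + s' *\<^sub>R v + t' *\<^sub>R u)) = h * (h * ?b (x + s *\<^sub>R u + t *\<^sub>R v))"
    using st(5) st'(5) by (auto simp: algebra_simps)
  then have eq: "?a (x + t' *\<^sub>R u + s' *\<^sub>R v) = ?b (x + s *\<^sub>R u + t *\<^sub>R v)"
    using h by (simp add: add.assoc add.commute[of "t' *\<^sub>R u"])
  have "dist (?a (x + t' *\<^sub>R u + s' *\<^sub>R v)) (?a x) < e" "dist (?b (x + s *\<^sub>R u + t *\<^sub>R v)) (?b x) < e"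
    using near[of t' s'] near[of s t] st st' by (auto intro!: r simp: r_def)
  then show False
    using dist_triangle_half_r[of _ "?a x" "2 * e" "?b x"] by (simp add: eq e_def)
qed

text \<open>Reduces to the scalar case by pairing with a fixed vector \<open>b\<close>.\<close>

lemma dd_commute:
  fixes f :: "'a::euclidean_space \<Rightarrow> 'b::real_inner"
  assumes "open S" "x \<in> S" "Cinf_on S f"
  shows "dd u (dd v f) x = dd v (dd u f) x"
proof -
  note diff = Cinf_on_differentiable
  have *: "dd u (dd v (\<lambda>y. b \<bullet> f y)) x = b \<bullet> dd u (dd v f) x" for b u v
  proof -
    have "dd u (dd v (\<lambda>y. b \<bullet> f y)) x = dd u (\<lambda>y. b \<bullet> dd v f y) x"
      by (rule dd_cong[OF assms(1,2)])
        (simp add: dd_linear[OF bounded_linear_inner_right diff[OF assms(3)]])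
    also have "\<dots> = b \<bullet> dd u (dd v f) x"
      by (intro dd_linear bounded_linear_inner_right diff[OF Cinf_on_dd[OF assms(3)]] assms)
    finally show ?thesis .
  qed
  have "b \<bullet> dd u (dd v f) x = b \<bullet> dd v (dd u f) x" for b
    unfolding *[symmetric]
    by (intro dd_commute_real[OF assms(1,2)] Cinf_on_linear[OF assms(1) bounded_linear_inner_right] assms)
  then show ?thesis by (metis vector_eq_ldot)
qed

text \<open>For operators whose direction moves with the point, such as
  \<open>\<Gamma> (Y y) y\<close> or \<open>dd (Y y) g y\<close>. Expansion in a basis turns them
  into sums of products with the smooth coefficients of \<open>V\<close>, and the Leibniz rule gives
  the extra term.\<close>

lemma
  fixes L :: "'a::euclidean_space \<Rightarrow> 'c::euclidean_space \<Rightarrow> 'b::real_normed_vector"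
  assumes S: "open S" and lin: "\<And>y. y \<in> S \<Longrightarrow> linear (\<lambda>w. L w y)"
    and L: "\<And>w. Cinf_on S (L w)" and V: "Cinf_on S V"
  shows Cinf_on_apply: "Cinf_on S (\<lambda>y. L (V y) y)"
    and dd_apply: "x \<in> S \<Longrightarrow> dd u (\<lambda>y. L (V y) y) x = dd u (L (V x)) x + L (dd u V x) x"
proof -
  have eq: "L w y = (\<Sum>b\<in>Basis. (w \<bullet> b) *\<^sub>R L b y)" if "y \<in> S" for w y
  proof -
    have "L w y = L (\<Sum>b\<in>Basis. (w \<bullet> b) *\<^sub>R b) y"
      by (simp only: euclidean_representation)
    also have "\<dots> = (\<Sum>b\<in>Basis. (w \<bullet> b) *\<^sub>R L b y)"
      by (simp only: linear_sum[OF lin[OF that]] linear_scale[OF lin[OF that]])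
    finally show ?thesis .
  qed
  have sm: "Cinf_on S (\<lambda>y. (V y \<bullet> b) *\<^sub>R L b y)" for b
    by (intro Cinf_on_scaleR S L Cinf_on_inner V Cinf_on_const)
  show "Cinf_on S (\<lambda>y. L (V y) y)"
    by (subst Cinf_on_cong[OF S eq]) (auto intro: Cinf_on_sum S sm)
  assume x: "x \<in> S"
  have "dd u (\<lambda>y. L (V y) y) x = dd u (\<lambda>y. \<Sum>b\<in>Basis. (V y \<bullet> b) *\<^sub>R L b y) x"
    by (rule dd_cong[OF S x eq])
  also have "\<dots> = (\<Sum>b\<in>Basis. dd u (\<lambda>y. (V y \<bullet> b) *\<^sub>R L b y) x)"
    by (intro dd_sum Cinf_on_differentiable[OF sm x])
  also have "\<dots> = (\<Sum>b\<in>Basis. (V x \<bullet> b) *\<^sub>R dd u (L b) x + (dd u V x \<bullet> b) *\<^sub>R L b x)"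
  proof (rule sum.cong[OF refl])
    fix b :: 'a assume "b \<in> Basis"
    show "dd u (\<lambda>y. (V y \<bullet> b) *\<^sub>R L b y) x = (V x \<bullet> b) *\<^sub>R dd u (L b) x + (dd u V x \<bullet> b) *\<^sub>R L b x"
      using dd_scaleR[of "\<lambda>y. V y \<bullet> b" x "L b" u] dd_linear[OF bounded_linear_inner_left, of V x u b]
        Cinf_on_differentiable[OF L x] Cinf_on_differentiable[OF V x]
        Cinf_on_differentiable[OF Cinf_on_inner[OF S V Cinf_on_const[OF S]] x] by simp
  qed
  also have "\<dots> = (\<Sum>b\<in>Basis. (V x \<bullet> b) *\<^sub>R dd u (L b) x) + L (dd u V x) x"
    by (simp add: sum.distrib eq[OF x, of "dd u V x"])
  also have "(\<Sum>b\<in>Basis. (V x \<bullet> b) *\<^sub>R dd u (L b) x) = dd u (L (V x)) x"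
  proof -
    have "dd u (L (V x)) x = dd u (\<lambda>y. \<Sum>b\<in>Basis. (V x \<bullet> b) *\<^sub>R L b y) x"
      by (rule dd_cong[OF S x eq])
    also have "\<dots> = (\<Sum>b\<in>Basis. dd u (\<lambda>y. (V x \<bullet> b) *\<^sub>R L b y) x)"
      by (intro dd_sum Cinf_on_differentiable[OF Cinf_on_scaleR[OF S Cinf_on_const[OF S] L] x])
    also have "\<dots> = (\<Sum>b\<in>Basis. (V x \<bullet> b) *\<^sub>R dd u (L b) x)"
      by (intro sum.cong refl dd_linear bounded_linear_scaleR_right Cinf_on_differentiable[OF L x])
    finally show ?thesis ..
  qed
  finally show "dd u (\<lambda>y. L (V y) y) x = dd u (L (V x)) x + L (dd u V x) x" .
qed

section \<open>Metric connections and curvature\<close>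

text \<open>Normal form for noncommutative matrix algebra: sums expanded, transposes pushed to the
  factors, products nested to the left, and successive actions on a vector merged into one
  matrix.\<close>

lemmas matrix_distrib =
  bounded_bilinear.add_left[OF bounded_bilinear_matrix_mult]
  bounded_bilinear.add_right[OF bounded_bilinear_matrix_mult]
  bounded_bilinear.diff_left[OF bounded_bilinear_matrix_mult]
  bounded_bilinear.diff_right[OF bounded_bilinear_matrix_mult]
  bounded_bilinear.minus_left[OF bounded_bilinear_matrix_mult]
  bounded_bilinear.minus_right[OF bounded_bilinear_matrix_mult]
  bounded_bilinear.scaleR_left[OF bounded_bilinear_matrix_mult]
  bounded_bilinear.scaleR_right[OF bounded_bilinear_matrix_mult]
  bounded_bilinear.zero_left[OF bounded_bilinear_matrix_mult]
  bounded_bilinear.zero_right[OF bounded_bilinear_matrix_mult]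
  bounded_bilinear.add_left[OF bounded_bilinear_matrix_vector]
  bounded_bilinear.add_right[OF bounded_bilinear_matrix_vector]
  bounded_bilinear.diff_left[OF bounded_bilinear_matrix_vector]
  bounded_bilinear.diff_right[OF bounded_bilinear_matrix_vector]
  bounded_bilinear.minus_left[OF bounded_bilinear_matrix_vector]
  bounded_bilinear.minus_right[OF bounded_bilinear_matrix_vector]
  bounded_bilinear.scaleR_left[OF bounded_bilinear_matrix_vector]
  bounded_bilinear.scaleR_right[OF bounded_bilinear_matrix_vector]
  bounded_bilinear.zero_left[OF bounded_bilinear_matrix_vector]
  bounded_bilinear.zero_right[OF bounded_bilinear_matrix_vector]
  linear_add[OF bounded_linear.linear[OF bounded_linear_transpose]]
  linear_diff[OF bounded_linear.linear[OF bounded_linear_transpose]]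
  linear_neg[OF bounded_linear.linear[OF bounded_linear_transpose]]
  linear_scale[OF bounded_linear.linear[OF bounded_linear_transpose]]
  linear_0[OF bounded_linear.linear[OF bounded_linear_transpose]]
  matrix_transpose_mul matrix_mul_assoc matrix_vector_mul_assoc transpose_transpose

lemma inner_matrix_vector:
  fixes A :: "real^'n::finite^'m::finite"
  shows "u \<bullet> (A *v v) = (transpose A *v u) \<bullet> v"
  by (simp add: dot_lmul_matrix)

lemma matrix_eqI_inner:
  fixes A :: "real^'n::finite^'m::finite"
  assumes "\<And>u v. u \<bullet> (A *v v) = u \<bullet> (B *v v)"
  shows "A = B"
  using assms vector_eq_ldot[of "A *v _"] by (metis matrix_eq vector_eq_ldot)

text \<open>Takes a map rather than a matrix, since contractions such as
  \<open>\<lambda>e. Riem e u y *v v\<close> are given as functions.\<close>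

definition tr :: "(real^'n \<Rightarrow> real^'n::finite) \<Rightarrow> real" where
  "tr f = (\<Sum>i\<in>UNIV. f (axis i 1) $ i)"

lemma tr_add: "tr (\<lambda>w. f w + h w) = tr f + tr h"
  and tr_diff: "tr (\<lambda>w. f w - h w) = tr f - tr h"
  and tr_minus: "tr (\<lambda>w. - f w) = - tr f"
  and tr_scaleR: "tr (\<lambda>w. c *\<^sub>R f w) = c * tr f"
  by (simp_all add: tr_def sum.distrib sum_subtractf sum_negf sum_distrib_left)

lemma tr_inner: "tr f = (\<Sum>i\<in>UNIV. axis i 1 \<bullet> f (axis i 1))"
  by (simp add: tr_def inner_axis')

lemma trace_eq_tr: "trace A = tr ((*v) A)"
  by (simp add: trace_def tr_def matrix_vector_mult_basis column_def)

text \<open>Cancels the connection terms acting on a contracted index, so that differentiation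
  commutes with traces.\<close>

lemma tr_cyclic:
  assumes "linear f"
  shows "tr (\<lambda>w. A *v f w) = tr (\<lambda>w. f (A *v w))"
proof -
  have f: "matrix f *v w = f w" for w
    using assms by (simp add: linear_matrix_vector_mul_eq)
  have "tr (\<lambda>w. A *v f w) = trace (A ** matrix f)" "tr (\<lambda>w. f (A *v w)) = trace (matrix f ** A)"
    unfolding trace_eq_tr tr_def matrix_vector_mul_assoc[symmetric] f by (rule refl)+
  then show ?thesis by (simp only: trace_mul_sym[of A "matrix f"])
qed

lemma trace_inner: "trace A = (\<Sum>i\<in>UNIV. axis i 1 \<bullet> (A *v axis i 1))"
  by (simp add: trace_eq_tr tr_inner)

locale metric_connection =
  fixes U :: "(real^'n::finite) set" and g :: "real^'n \<Rightarrow> real^'n^'n"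
    and \<Gamma> :: "real^'n \<Rightarrow> real^'n \<Rightarrow> real^'n^'n"
  assumes open_U: "open U" and g_smooth: "Cinf_on U g"
    and g_sym: "y \<in> U \<Longrightarrow> transpose (g y) = g y"
    and g_inv: "y \<in> U \<Longrightarrow> invertible (g y)"
    and \<Gamma>_smooth: "Cinf_on U (\<Gamma> u)"
    and \<Gamma>_linear: "y \<in> U \<Longrightarrow> linear (\<lambda>u. \<Gamma> u y)"
    and \<Gamma>_sym: "y \<in> U \<Longrightarrow> \<Gamma> u y *v v = \<Gamma> v y *v u"
    and dd_g: "y \<in> U \<Longrightarrow> dd u g y = transpose (\<Gamma> u y) ** g y + g y ** \<Gamma> u y"
begin

definition h :: "real^'n \<Rightarrow> real^'n^'n" where
  "h y = matrix_inv (g y)"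

lemma gh: "y \<in> U \<Longrightarrow> g y ** h y = mat 1" and hg: "y \<in> U \<Longrightarrow> h y ** g y = mat 1"
  using matrix_inv_works[OF g_inv] by (simp_all add: h_def)

text \<open>The first two rules carry a left factor \<open>A\<close> because
  \<open>matrix_distrib\<close> nests products to the left.\<close>

lemma h_cancel:
  "y \<in> U \<Longrightarrow> A ** g y ** h y = A" "y \<in> U \<Longrightarrow> A ** h y ** g y = A"
  "y \<in> U \<Longrightarrow> g y *v (h y *v v) = v" "y \<in> U \<Longrightarrow> h y *v (g y *v v) = v"
  by (simp_all add: matrix_mul_assoc[symmetric] matrix_vector_mul_assoc gh hg)

lemma h_smooth: "Cinf_on U h"
  unfolding h_def[abs_def] by (rule Cinf_on_matrix_inv[OF open_U g_smooth g_inv])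

lemma h_sym: "y \<in> U \<Longrightarrow> transpose (h y) = h y"
  by (metis g_sym gh hg matrix_mul_assoc matrix_mul_lid matrix_mul_rid matrix_transpose_mul transpose_mat)

lemmas smooth =
  Cinf_on_add[OF open_U] Cinf_on_diff[OF open_U] Cinf_on_minus[OF open_U] Cinf_on_const[OF open_U]
  Cinf_on_scaleR[OF open_U] Cinf_on_mult[OF open_U] Cinf_on_inner[OF open_U]
  Cinf_on_bilinear[OF open_U bounded_bilinear_matrix_mult]
  Cinf_on_bilinear[OF open_U bounded_bilinear_matrix_vector]
  Cinf_on_linear[OF open_U bounded_linear_transpose]
  Cinf_on_linear[OF open_U bounded_linear_trace]
  Cinf_on_dd g_smooth h_smooth \<Gamma>_smooth


lemmas ddU = dd_add dd_diff dd_minus dd_scaleR dd_mult dd_inner dd_matrix_mult dd_matrix_vector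
  dd_transpose dd_trace dd_const Cinf_on_differentiable[where S=U]

lemmas \<Gamma>_lin = linear_add[OF \<Gamma>_linear] linear_diff[OF \<Gamma>_linear] linear_neg[OF \<Gamma>_linear]
  linear_scale[OF \<Gamma>_linear] linear_0[OF \<Gamma>_linear]

lemma dd_dir:
  assumes "y \<in> U" "Cinf_on U f"
  shows "dd (a + b) f y = dd a f y + dd b f y" "dd (a - b) f y = dd a f y - dd b f y"
    "dd (- a) f y = - dd a f y" "dd (c *\<^sub>R a) f y = c *\<^sub>R dd a f y"
proof -
  note L = linear_dd[OF Cinf_on_differentiable[OF assms(2,1)]]
  show "dd (a + b) f y = dd a f y + dd b f y" "dd (a - b) f y = dd a f y - dd b f y"
    "dd (- a) f y = - dd a f y" "dd (c *\<^sub>R a) f y = c *\<^sub>R dd a f y"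
    by (rule linear_add[OF L] linear_diff[OF L] linear_neg[OF L] linear_scale[OF L])+
qed

lemma dd_\<Gamma>_dir: "y \<in> U \<Longrightarrow> linear (\<lambda>u. dd w (\<Gamma> u) y)"
proof (intro linearI)
  assume y: "y \<in> U"
  fix a b c
  have "dd w (\<Gamma> (a + b)) y = dd w (\<lambda>y. \<Gamma> a y + \<Gamma> b y) y" "dd w (\<Gamma> (c *\<^sub>R a)) y = dd w (\<lambda>y. c *\<^sub>R \<Gamma> a y) y"
    by (auto intro!: dd_cong[OF open_U y] simp: \<Gamma>_lin)
  then show "dd w (\<Gamma> (a + b)) y = dd w (\<Gamma> a) y + dd w (\<Gamma> b) y" "dd w (\<Gamma> (c *\<^sub>R a)) y = c *\<^sub>R dd w (\<Gamma> a) y"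
    using y by (simp_all add: ddU smooth)
qed

lemma dd_\<Gamma>_sym:
  assumes y: "y \<in> U"
  shows "dd w (\<Gamma> u) y *v v = dd w (\<Gamma> v) y *v u"
proof -
  have "dd w (\<lambda>y. \<Gamma> u y *v v) y = dd w (\<lambda>y. \<Gamma> v y *v u) y"
    by (rule dd_cong[OF open_U y]) (rule \<Gamma>_sym)
  then show ?thesis using y by (simp add: ddU smooth)
qed

text \<open>Derivative of \<open>g y ** h y = mat 1\<close>; in covariant terms, the inverse metric
  is parallel.\<close>

lemma dd_h:
  assumes y: "y \<in> U"
  shows "dd u h y = - (\<Gamma> u y ** h y) - h y ** transpose (\<Gamma> u y)"
proof -
  have "dd u (\<lambda>y. g y ** h y) y = dd u (\<lambda>y. mat 1) y"
    by (rule dd_cong[OF open_U y]) (rule gh)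
  then have "g y ** dd u h y + dd u g y ** h y = 0"
    using y by (simp add: ddU smooth)
  then have "h y ** (g y ** dd u h y + dd u g y ** h y) = 0"
    by (simp add: matrix_distrib)
  then have "dd u h y + h y ** transpose (\<Gamma> u y) + \<Gamma> u y ** h y = 0"
    using y by (simp add: matrix_distrib dd_g h_cancel hg add.assoc)
  then show ?thesis
    by (simp add: eq_neg_iff_add_eq_0 algebra_simps)
qed

section \<open>Curvature and the Bianchi identities\<close>

definition Riem :: "real^'n \<Rightarrow> real^'n \<Rightarrow> real^'n \<Rightarrow> real^'n^'n" where
  "Riem u v y = dd u (\<Gamma> v) y - dd v (\<Gamma> u) y + \<Gamma> u y ** \<Gamma> v y - \<Gamma> v y ** \<Gamma> u y"

lemma Riem_smooth: "Cinf_on U (Riem u v)"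
  unfolding Riem_def[abs_def] by (simp add: smooth)

lemma Riem_antisym: "Riem u v y = - Riem v u y"
  by (simp add: Riem_def)

lemma Riem_linear1: "y \<in> U \<Longrightarrow> linear (\<lambda>u. Riem u v y)"
  by (intro linearI) (simp_all add: Riem_def linear_add[OF dd_\<Gamma>_dir] linear_scale[OF dd_\<Gamma>_dir] dd_dir \<Gamma>_smooth
    \<Gamma>_lin matrix_distrib algebra_simps)

lemma Riem_linear2: "y \<in> U \<Longrightarrow> linear (\<lambda>v. Riem u v y)"
  by (subst Riem_antisym) (intro linear_compose_neg Riem_linear1)

lemmas Riem_lin = linear_add[OF Riem_linear1] linear_scale[OF Riem_linear1] linear_neg[OF Riem_linear1] linear_diff[OF Riem_linear1]
  linear_add[OF Riem_linear2] linear_scale[OF Riem_linear2] linear_neg[OF Riem_linear2] linear_diff[OF Riem_linear2]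

text \<open>Second derivatives of \<open>g\<close> commute; inserting \<open>dd_g\<close> twice
  leaves exactly the curvature terms.\<close>

lemma Riem_skew:
  assumes y: "y \<in> U"
  shows "g y ** Riem u v y + transpose (Riem u v y) ** g y = 0"
proof -
  have *: "dd a (dd b g) y = dd a (\<lambda>y. transpose (\<Gamma> b y) ** g y + g y ** \<Gamma> b y) y" for a b
    by (rule dd_cong[OF open_U y]) (rule dd_g)
  show ?thesis
    using dd_commute[OF open_U y g_smooth, of u v] y unfolding *
    by (simp add: ddU smooth Riem_def matrix_distrib dd_g algebra_simps)
qed

text \<open>In the cyclic sum the derivative terms and the quadratic terms cancel separately, both
  by the symmetry of \<open>\<Gamma>\<close>.\<close>

lemma Bianchi1:
  assumes y: "y \<in> U"
  shows "Riem u v y *v w + Riem v w y *v u + Riem w u y *v v = 0"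
proof -
  have *: "A ** \<Gamma> a y *v b = A ** \<Gamma> b y *v a" for A a b
    using \<Gamma>_sym[OF y, of a b] by (simp add: matrix_vector_mul_assoc[symmetric])
  show ?thesis
    unfolding Riem_def
    by (simp add: matrix_distrib dd_\<Gamma>_sym[OF y, of u v w] dd_\<Gamma>_sym[OF y, of v w u] dd_\<Gamma>_sym[OF y, of w u v]
     *[of _ u v] *[of _ v w] *[of _ w u])
qed

text \<open>The covariant derivative of the curvature, with \<open>u\<close> and \<open>v\<close>
  constant in the chart; the last two terms account for the covariant derivatives of these two
  vectors.\<close>

definition nRiem :: "real^'n \<Rightarrow> real^'n \<Rightarrow> real^'n \<Rightarrow> real^'n \<Rightarrow> real^'n^'n" where
  "nRiem w u v y = dd w (Riem u v) y + \<Gamma> w y ** Riem u v y - Riem u v y ** \<Gamma> w y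
     - Riem (\<Gamma> w y *v u) v y - Riem u (\<Gamma> w y *v v) y"

lemma nRiem_antisym:
  assumes y: "y \<in> U"
  shows "nRiem w u v y = - nRiem w v u y"
proof -
  have "dd w (Riem u v) y = dd w (\<lambda>y. - Riem v u y) y"
    by (rule dd_cong[OF open_U y]) (rule Riem_antisym)
  then show ?thesis
    using y unfolding nRiem_def Riem_antisym[of u v y] Riem_antisym[of "\<Gamma> w y *v u" v] Riem_antisym[of u "\<Gamma> w y *v v"]
    by (simp add: ddU Riem_smooth matrix_distrib)
qed

lemma dd_Riem_dir: "y \<in> U \<Longrightarrow> linear (\<lambda>u. dd w (Riem u v) y)"
proof (intro linearI)
  assume y: "y \<in> U"
  fix a b c
  have "dd w (Riem (a + b) v) y = dd w (\<lambda>y. Riem a v y + Riem b v y) y" "dd w (Riem (c *\<^sub>R a) v) y = dd w (\<lambda>y. c *\<^sub>R Riem a v y) y"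
    by (auto intro!: dd_cong[OF open_U y] simp: Riem_lin)
  then show "dd w (Riem (a + b) v) y = dd w (Riem a v) y + dd w (Riem b v) y" "dd w (Riem (c *\<^sub>R a) v) y = c *\<^sub>R dd w (Riem a v) y"
    using y by (simp_all add: ddU smooth Riem_smooth)
qed

lemma nRiem_linear2: "y \<in> U \<Longrightarrow> linear (\<lambda>u. nRiem w u v y)"
  by (intro linearI) (simp_all add: nRiem_def linear_add[OF dd_Riem_dir] linear_scale[OF dd_Riem_dir] Riem_lin matrix_distrib algebra_simps)

text \<open>The cyclic sum cancels the second derivatives of \<open>\<Gamma>\<close> by their
  symmetry, and the terms with a differentiated argument pair off by \<open>r\<close>; the remaining
  products cancel algebraically.\<close>

lemma Bianchi2:
  assumes y: "y \<in> U"
  shows "nRiem w u v y + nRiem u v w y + nRiem v w u y = 0"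
proof -
  have *: "dd a (Riem b c) y = dd a (dd b (\<Gamma> c)) y - dd a (dd c (\<Gamma> b)) y
     + (\<Gamma> b y ** dd a (\<Gamma> c) y + dd a (\<Gamma> b) y ** \<Gamma> c y) - (\<Gamma> c y ** dd a (\<Gamma> b) y + dd a (\<Gamma> c) y ** \<Gamma> b y)" for a b c
    using y unfolding Riem_def[abs_def] by (simp add: ddU smooth)
  have r: "Riem (\<Gamma> a y *v b) c y = - Riem c (\<Gamma> b y *v a) y" for a b c
    by (simp only: \<Gamma>_sym[OF y, of a b] Riem_antisym[of "\<Gamma> b y *v a" c])
  show ?thesis
    unfolding nRiem_def * r
    by (simp add: Riem_def[of u v] Riem_def[of v w] Riem_def[of w u] matrix_distrib algebra_simps
      dd_commute[OF open_U y \<Gamma>_smooth, of u v] dd_commute[OF open_U y \<Gamma>_smooth, of v w] dd_commute[OF open_U y \<Gamma>_smooth, of w u])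
qed

text \<open>Derivative of \<open>Riem_skew\<close>, the metric being parallel.\<close>

lemma nRiem_skew:
  assumes y: "y \<in> U"
  shows "g y ** nRiem w u v y + transpose (nRiem w u v y) ** g y = 0"
proof -
  have "dd w (\<lambda>y. g y ** Riem u v y + transpose (Riem u v y) ** g y) y = dd w (\<lambda>y. 0) y"
    by (rule dd_cong[OF open_U y]) (rule Riem_skew)
  then have 1: "g y ** dd w (Riem u v) y + dd w g y ** Riem u v y
      + (transpose (Riem u v y) ** dd w g y + transpose (dd w (Riem u v) y) ** g y) = 0"
    using y by (simp add: ddU smooth Riem_smooth)
  have 2: "transpose (Riem a b y) ** g y = - (g y ** Riem a b y)" for a b
    using Riem_skew[OF y, of a b] by (simp add: eq_neg_iff_add_eq_0 add.commute)
  have 3: "A ** transpose (Riem a b y) ** g y = - (A ** g y ** Riem a b y)" for A a b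
    using arg_cong[OF 2, of "\<lambda>M. A ** M", of a b] by (simp add: matrix_distrib)
  have 4: "transpose (Riem a b y) ** g y ** A = - (g y ** Riem a b y ** A)" for A a b
    by (simp add: 2 matrix_distrib)
  have 5: "transpose (Riem u v y) ** transpose (\<Gamma> w y) ** g y
     = - (g y ** dd w (Riem u v) y) - transpose (\<Gamma> w y) ** g y ** Riem u v y - g y ** \<Gamma> w y ** Riem u v y
       + g y ** Riem u v y ** \<Gamma> w y - transpose (dd w (Riem u v) y) ** g y"
    using 1 y by (simp add: dd_g matrix_distrib 4 algebra_simps eq_neg_iff_add_eq_0)
  show ?thesis
    unfolding nRiem_def using y by (simp add: matrix_distrib 2 3 4 5)
qed

end

lemma vec_expansion: "(\<Sum>i\<in>UNIV. x $ i *\<^sub>R axis i 1) = (x :: real^'n::finite)"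
  using basis_expansion[of x] by (simp add: scalar_mult_eq_scaleR)

lemma linear_expansion:
  fixes f :: "real^'n::finite \<Rightarrow> 'b::real_vector"
  assumes "linear f"
  shows "f x = (\<Sum>i\<in>UNIV. x $ i *\<^sub>R f (axis i 1))"
proof -
  have "f x = f (\<Sum>i\<in>UNIV. x $ i *\<^sub>R axis i 1)"
    by (simp only: vec_expansion)
  also have "\<dots> = (\<Sum>i\<in>UNIV. x $ i *\<^sub>R f (axis i 1))"
    by (simp only: linear_sum[OF assms] linear_scale[OF assms])
  finally show ?thesis .
qed

lemma form_as_matrix:
  fixes b :: "real^'n::finite \<Rightarrow> real^'n \<Rightarrow> real"
  assumes "\<And>u. linear (b u)" "\<And>v. linear (\<lambda>u. b u v)"
  shows "u \<bullet> ((\<chi> j k. b (axis j 1) (axis k 1)) *v v) = b u v"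
proof -
  have "b u v = (\<Sum>j\<in>UNIV. u $ j * (\<Sum>k\<in>UNIV. v $ k * b (axis j 1) (axis k 1)))"
    by (subst linear_expansion[OF assms(2)], subst linear_expansion[OF assms(1)]) simp
  then show ?thesis
    by (simp add: inner_vec_def matrix_vector_mult_def mult.commute)
qed

lemma tr_linear:
  assumes "\<And>w. linear (\<lambda>u. f u w)"
  shows "linear (\<lambda>u. tr (f u))"
  by (intro linearI) (simp_all add: tr_def linear_add[OF assms] linear_scale[OF assms] sum.distrib sum_distrib_left)

lemma tr_sum: "tr (\<lambda>w. \<Sum>k\<in>K. f k w) = (\<Sum>k\<in>K. tr (f k))"
  unfolding tr_def sum_component by (rule sum.swap)

lemma linear_matrix_apply: "linear L \<Longrightarrow> linear (\<lambda>u. L u *v v)"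
  for L :: "'a::real_vector \<Rightarrow> real^'n::finite^'m::finite"
  by (intro linearI) (simp_all add: linear_add linear_scale matrix_distrib)

section \<open>Ricci and scalar curvature\<close>

context metric_connection
begin

text \<open>Contraction over the first argument of \<open>Riem\<close>, which is the sign convention
  of \<open>ricci\<close>.\<close>

definition Ric :: "real^'n \<Rightarrow> real^'n^'n" where
  "Ric y = (\<chi> j k. tr (\<lambda>e. Riem e (axis j 1) y *v axis k 1))"

lemma Ric_form: "y \<in> U \<Longrightarrow> u \<bullet> (Ric y *v v) = tr (\<lambda>e. Riem e u y *v v)"
  unfolding Ric_def
  by (rule form_as_matrix) (auto intro!: tr_linear linear_matrix_apply Riem_linear2)

lemma Ric_smooth: "Cinf_on U Ric"
  unfolding Ric_def[abs_def] tr_def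
  by (intro Cinf_on_vec[OF open_U] Cinf_on_sum[OF open_U] Cinf_on_nth[OF open_U] smooth Riem_smooth)

text \<open>By \<open>Bianchi1\<close> the antisymmetric part is the trace of
  \<open>Riem u v y\<close>, and this vanishes because that matrix is skew with respect to
  \<open>g\<close>.\<close>

lemma Ric_sym:
  assumes y: "y \<in> U"
  shows "transpose (Ric y) = Ric y"
proof (rule matrix_eqI_inner)
  fix u v
  have "tr ((*v) (Riem u v y)) = 0"
  proof -
    have R: "Riem u v y = - h y ** transpose (Riem u v y) ** g y"
      using arg_cong[OF Riem_skew[OF y, of u v], of "\<lambda>A. h y ** A"] y
      by (simp add: matrix_distrib hg h_cancel eq_neg_iff_add_eq_0)
    have "trace (Riem u v y) = - trace (h y ** transpose (Riem u v y) ** g y)"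
      by (subst R) (simp add: matrix_distrib trace_def sum_negf)
    also have "\<dots> = - trace (transpose (Riem u v y))"
      using y by (subst trace_mul_sym) (simp add: matrix_distrib gh)
    also have "\<dots> = - trace (Riem u v y)"
      by (simp add: trace_def transpose_def)
    finally show ?thesis by (simp add: trace_eq_tr)
  qed
  moreover have "Riem e u y *v v = Riem e v y *v u - Riem u v y *v e" for e
    using Bianchi1[OF y, of e u v] Riem_antisym[of v e y]
    by (simp add: matrix_distrib algebra_simps eq_neg_iff_add_eq_0)
  ultimately have "tr (\<lambda>e. Riem e u y *v v) = tr (\<lambda>e. Riem e v y *v u)"
    by (simp add: tr_diff)
  then show "u \<bullet> (transpose (Ric y) *v v) = u \<bullet> (Ric y *v v)"
    using inner_matrix_vector[of v "Ric y" u] Ric_form[OF y, of u v] Ric_form[OF y, of v u]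
    by (simp add: inner_commute)
qed

definition nRic :: "real^'n \<Rightarrow> real^'n \<Rightarrow> real^'n^'n" where
  "nRic w y = dd w Ric y - transpose (\<Gamma> w y) ** Ric y - Ric y ** \<Gamma> w y"

lemma dd_Ric_form:
  assumes y: "y \<in> U"
  shows "u \<bullet> (dd w Ric y *v v) = tr (\<lambda>e. dd w (Riem e u) y *v v)"
proof -
  have "dd w (\<lambda>y. u \<bullet> (Ric y *v v)) y = dd w (\<lambda>y. \<Sum>i\<in>UNIV. (Riem (axis i 1) u y *v v) $ i) y"
    by (rule dd_cong[OF open_U y]) (simp add: Ric_form tr_def)
  also have "\<dots> = (\<Sum>i\<in>UNIV. (dd w (Riem (axis i 1) u) y *v v) $ i)"
  proof (subst dd_sum)
    fix i :: 'n
    have C: "Cinf_on U (\<lambda>y. Riem (axis i 1) u y *v v)"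
      by (intro smooth Riem_smooth)
    then show "(\<lambda>y. (Riem (axis i 1) u y *v v) $ i) differentiable (at y)"
      using Cinf_on_differentiable[OF Cinf_on_nth[OF open_U C] y] by simp
  next
    have "dd w (\<lambda>y. (Riem (axis i 1) u y *v v) $ i) y = (dd w (Riem (axis i 1) u) y *v v) $ i" for i
      using y by (simp add: dd_nth ddU smooth Riem_smooth)
    then show "(\<Sum>i\<in>UNIV. dd w (\<lambda>y. (Riem (axis i 1) u y *v v) $ i) y) = (\<Sum>i\<in>UNIV. (dd w (Riem (axis i 1) u) y *v v) $ i)"
      by simp
  qed
  finally show ?thesis
    using y by (simp add: tr_def ddU smooth Ric_smooth)
qed

text \<open>The two terms in which \<open>\<Gamma>\<close> acts on the contracted index cancel by
  \<open>tr_cyclic\<close>; the others are the correction terms of \<open>nRic\<close>.\<close>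

lemma nRic_form:
  assumes y: "y \<in> U"
  shows "u \<bullet> (nRic w y *v v) = tr (\<lambda>e. nRiem w e u y *v v)"
proof -
  have lin: "linear (\<lambda>e. Riem e u y *v v)"
    by (intro linear_matrix_apply Riem_linear1 y)
  have "tr (\<lambda>e. nRiem w e u y *v v) = tr (\<lambda>e. dd w (Riem e u) y *v v + \<Gamma> w y *v (Riem e u y *v v)
      - Riem e u y *v (\<Gamma> w y *v v) - Riem (\<Gamma> w y *v e) u y *v v - Riem e (\<Gamma> w y *v u) y *v v)"
    by (simp add: nRiem_def matrix_distrib)
  also have "\<dots> = u \<bullet> (dd w Ric y *v v) - u \<bullet> (Ric y *v (\<Gamma> w y *v v)) - (\<Gamma> w y *v u) \<bullet> (Ric y *v v)"
    by (simp add: tr_add tr_diff dd_Ric_form[OF y] Ric_form[OF y] tr_cyclic[OF lin])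
  also have "\<dots> = u \<bullet> (nRic w y *v v)"
    using inner_matrix_vector[of "u" "transpose (\<Gamma> w y)" "Ric y *v v"]
    by (simp add: nRic_def matrix_distrib inner_diff_right)
  finally show ?thesis ..
qed

lemma nRic_sym:
  assumes y: "y \<in> U"
  shows "transpose (nRic w y) = nRic w y"
proof -
  have "dd w (\<lambda>y. transpose (Ric y)) y = dd w Ric y"
    by (rule dd_cong[OF open_U y]) (rule Ric_sym)
  then have "transpose (dd w Ric y) = dd w Ric y"
    using y by (simp add: ddU Ric_smooth)
  then show ?thesis
    using y by (simp add: nRic_def matrix_distrib Ric_sym algebra_simps)
qed

lemma nRic_linear: "y \<in> U \<Longrightarrow> linear (\<lambda>w. nRic w y)"
  by (intro linearI) (simp_all add: nRic_def dd_dir Ric_smooth \<Gamma>_lin matrix_distrib algebra_simps)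

definition Scal :: "real^'n \<Rightarrow> real" where
  "Scal y = trace (h y ** Ric y)"

lemma Scal_smooth: "Cinf_on U Scal"
  unfolding Scal_def[abs_def] by (intro smooth Ric_smooth)

text \<open>The inverse metric is parallel, so the derivative falls on \<open>Ric\<close> alone and
  becomes covariant.\<close>

lemma dd_Scal:
  assumes y: "y \<in> U"
  shows "dd w Scal y = trace (h y ** nRic w y)"
proof -
  have "dd w Scal y = trace (h y ** dd w Ric y) - trace (\<Gamma> w y ** (h y ** Ric y)) - trace (h y ** transpose (\<Gamma> w y) ** Ric y)"
    using y unfolding Scal_def[abs_def]
    by (simp add: ddU smooth Ric_smooth dd_h matrix_distrib trace_add trace_sub)
      (simp add: trace_def sum_negf)
  then show ?thesis
    using trace_mul_sym[of "\<Gamma> w y" "h y ** Ric y"] by (simp add: nRic_def matrix_distrib trace_sub)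
qed

text \<open>Trace of \<open>Bianchi2\<close> over two pairs of indices: each of the two terms on the
  right of \<open>B\<close> contributes one divergence of the Ricci tensor, whence the factor
  2.\<close>

lemma contracted_Bianchi:
  assumes y: "y \<in> U"
  shows "2 * tr (\<lambda>e. h y *v (nRic e y *v w)) = dd w Scal y"
proof -
  let ?b = "\<lambda>i. axis i 1 :: real^'n"
  have B: "nRiem w e f y = nRiem e w f y - nRiem f w e y" for e f
    using Bianchi2[OF y, of w e f] nRiem_antisym[OF y, of e f w]
    by (simp add: eq_neg_iff_add_eq_0 algebra_simps)
  have "dd w Scal y = (\<Sum>k\<in>UNIV. ?b k \<bullet> (h y *v (nRic w y *v ?b k)))"
    by (simp add: dd_Scal[OF y] trace_inner matrix_vector_mul_assoc)
  also have "\<dots> = (\<Sum>k\<in>UNIV. (h y *v ?b k) \<bullet> (nRic w y *v ?b k))"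
    using inner_matrix_vector[of "?b _" "h y"] by (simp add: h_sym[OF y])
  also have "\<dots> = (\<Sum>k\<in>UNIV. tr (\<lambda>e. nRiem e w (h y *v ?b k) y *v ?b k - nRiem (h y *v ?b k) w e y *v ?b k))"
    by (simp add: nRic_form[OF y] B matrix_distrib)
  also have "\<dots> = tr (\<lambda>e. \<Sum>k\<in>UNIV. nRiem e w (h y *v ?b k) y *v ?b k)
       - (\<Sum>k\<in>UNIV. tr (\<lambda>e. nRiem (h y *v ?b k) w e y *v ?b k))"
    by (simp add: tr_diff sum_subtractf tr_sum)
  also have "tr (\<lambda>e. \<Sum>k\<in>UNIV. nRiem e w (h y *v ?b k) y *v ?b k) = tr (\<lambda>e. h y *v (nRic e y *v w))"
  proof -
    have "(\<Sum>k\<in>UNIV. nRiem e w (h y *v ?b k) y *v ?b k) = h y *v (nRic e y *v w)" (is "?V = _") for e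
    proof -
      \<comment> \<open>Tested against \<open>z\<close> after lowering with \<open>g\<close>, where
        \<open>nRiem_skew\<close> moves \<open>z\<close> into the curvature;
        \<open>tr_cyclic\<close> then cancels \<open>h\<close> against \<open>g\<close> and leaves a
        trace that defines \<open>nRic\<close>.\<close>
      have "z \<bullet> (g y *v ?V) = z \<bullet> (nRic e y *v w)" for z
      proof -
        have lin: "linear (\<lambda>f. nRiem e f w y *v z)"
          by (intro linear_matrix_apply nRiem_linear2 y)
        have "z \<bullet> (g y *v (nRiem e w f y *v b)) = (g y *v (nRiem e f w y *v z)) \<bullet> b" for f b
        proof -
          have "transpose (g y ** nRiem e w f y) = g y ** nRiem e f w y"
            using nRiem_skew[OF y, of e w f] y
            by (simp add: nRiem_antisym[OF y, of e f w] matrix_distrib g_sym eq_neg_iff_add_eq_0 add.commute)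
          then show ?thesis
            using inner_matrix_vector[of z "g y ** nRiem e w f y" b] by (simp only: matrix_vector_mul_assoc)
        qed
        then have "z \<bullet> (g y *v ?V) = (\<Sum>k\<in>UNIV. ?b k \<bullet> (g y *v (nRiem e (h y *v ?b k) w y *v z)))"
          by (simp add: linear_sum[OF matrix_vector_mul_linear] inner_sum_right inner_commute)
        also have "\<dots> = tr (\<lambda>f. nRiem e f w y *v z)"
          using tr_cyclic[OF linear_compose[OF matrix_vector_mul_linear[of "h y"] lin], of "g y"] y
          by (simp add: tr_inner h_cancel o_def)
        also have "\<dots> = w \<bullet> (nRic e y *v z)"
          by (simp add: nRic_form[OF y])
        also have "\<dots> = z \<bullet> (nRic e y *v w)"
          using inner_matrix_vector[of w "nRic e y" z] by (simp add: nRic_sym[OF y] inner_commute)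
        finally show ?thesis .
      qed
      then have "g y *v ?V = nRic e y *v w"
        by (intro vector_eq_ldot[where 'a="real^'n", THEN iffD1] allI)
      then have "h y *v (g y *v ?V) = h y *v (nRic e y *v w)"
        by (rule arg_cong)
      then show ?thesis by (simp only: h_cancel(4)[OF y])
    qed
    then show ?thesis by simp
  qed
  also have "(\<Sum>k\<in>UNIV. tr (\<lambda>e. nRiem (h y *v ?b k) w e y *v ?b k)) = - tr (\<lambda>e. h y *v (nRic e y *v w))"
  proof -
    have lin: "linear (\<lambda>e. nRic e y *v w)"
      by (intro linear_matrix_apply nRic_linear y)
    have "tr (\<lambda>e. nRiem f w e y *v b) = - (w \<bullet> (nRic f y *v b))" for f b
    proof -
      have "nRiem f w e y *v b = - (nRiem f e w y *v b)" for e
        by (simp only: nRiem_antisym[OF y, of f w e] matrix_distrib)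
      then show ?thesis by (simp only: tr_minus nRic_form[OF y])
    qed
    moreover have "w \<bullet> (nRic f y *v b) = b \<bullet> (nRic f y *v w)" for f b
      using inner_matrix_vector[of w "nRic f y" b] by (simp add: nRic_sym[OF y] inner_commute)
    ultimately have "(\<Sum>k\<in>UNIV. tr (\<lambda>e. nRiem (h y *v ?b k) w e y *v ?b k)) = - tr (\<lambda>e. nRic (h y *v e) y *v w)"
      by (simp add: sum_negf tr_inner)
    then show ?thesis by (simp add: tr_cyclic[OF lin])
  qed
  finally show ?thesis by simp
qed

end

section \<open>Divergences and Killing fields\<close>

lemma outer_mult_vec: "outer a b *v z = (b \<bullet> z) *\<^sub>R a"
  by (simp add: outer_def matrix_vector_mult_def inner_vec_def vec_eq_iff sum_distrib_left mult_ac)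

lemma matrix_mult_outer: "M ** outer a b = outer (M *v a) b"
  by (simp add: outer_def matrix_vector_mult_def matrix_matrix_mult_def vec_eq_iff sum_distrib_left mult_ac)

lemma outer_mult_matrix: "outer a b ** M = outer a (transpose M *v b)"
  by (simp add: outer_def vector_matrix_mult_def matrix_matrix_mult_def vec_eq_iff sum_distrib_left mult_ac)

lemma bounded_bilinear_outer: "bounded_bilinear (outer :: real^'n::finite \<Rightarrow> real^'n \<Rightarrow> real^'n^'n)"
  unfolding bilinear_conv_bounded_bilinear[symmetric] bilinear_def
  by (auto simp: outer_def vec_eq_iff algebra_simps intro!: linearI)

lemmas dd_outer = dd_bilinear[OF bounded_bilinear_outer]

lemma tr_rank_one: "linear L \<Longrightarrow> tr (\<lambda>e. L e *\<^sub>R v) = L v"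
  by (subst linear_expansion[of L v]) (simp_all add: tr_def mult.commute)

lemma form_sym:
  fixes T :: "real^'n::finite^'n"
  shows "transpose T = T \<Longrightarrow> u \<bullet> (T *v v) = v \<bullet> (T *v u)"
  using inner_matrix_vector[of u T v] by (simp add: inner_commute del: transpose_matrix_vector)

context metric_connection
begin

definition cov :: "real^'n \<Rightarrow> (real^'n \<Rightarrow> real^'n) \<Rightarrow> real^'n \<Rightarrow> real^'n" where
  "cov u Z y = dd u Z y + \<Gamma> u y *v Z y"

definition dv :: "(real^'n \<Rightarrow> real^'n) \<Rightarrow> real^'n \<Rightarrow> real" where
  "dv Z y = tr (\<lambda>e. cov e Z y)"

text \<open>Both indices of \<open>M\<close> are upper ones, hence two positive correction terms;
  \<open>dv2\<close> contracts the first index.\<close>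

definition nab :: "real^'n \<Rightarrow> (real^'n \<Rightarrow> real^'n^'n) \<Rightarrow> real^'n \<Rightarrow> real^'n^'n" where
  "nab w M y = dd w M y + \<Gamma> w y ** M y + M y ** transpose (\<Gamma> w y)"

definition dv2 :: "(real^'n \<Rightarrow> real^'n^'n) \<Rightarrow> real^'n \<Rightarrow> real^'n" where
  "dv2 M y = (\<chi> j. \<Sum>i\<in>UNIV. nab (axis i 1) M y $ i $ j)"

definition up :: "(real^'n \<Rightarrow> real^'n^'n) \<Rightarrow> real^'n \<Rightarrow> real^'n^'n" where
  "up T y = h y ** T y ** h y"

definition Grav :: "real^'n \<Rightarrow> real^'n^'n" where
  "Grav y = 2 *\<^sub>R (Ric y - ((1/2) * Scal y) *\<^sub>R g y)"

lemmas smooth' = smooth Riem_smooth Ric_smooth Scal_smooth Cinf_on_bilinear[OF open_U bounded_bilinear_outer]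

lemmas ddU' = ddU dd_outer

lemma Grav_smooth: "Cinf_on U Grav"
  unfolding Grav_def[abs_def] by (intro smooth')

lemma Grav_sym: "y \<in> U \<Longrightarrow> transpose (Grav y) = Grav y"
  by (simp add: Grav_def matrix_distrib Ric_sym g_sym)

lemma cov_cong:
  assumes "y \<in> U" "\<And>y. y \<in> U \<Longrightarrow> Z y = Z' y"
  shows "cov u Z y = cov u Z' y"
  using dd_cong[OF open_U assms] assms by (simp add: cov_def)

lemma dv_cong:
  assumes "y \<in> U" "\<And>y. y \<in> U \<Longrightarrow> Z y = Z' y"
  shows "dv Z y = dv Z' y"
  using cov_cong[OF assms] by (simp add: dv_def)

lemma dv2_cong:
  assumes "y \<in> U" "\<And>y. y \<in> U \<Longrightarrow> M y = M' y"
  shows "dv2 M y = dv2 M' y"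
  using dd_cong[OF open_U assms] assms by (simp add: dv2_def nab_def)

lemma cov_linear: "y \<in> U \<Longrightarrow> Cinf_on U Z \<Longrightarrow> linear (\<lambda>u. cov u Z y)"
  by (intro linearI) (simp_all add: cov_def dd_dir \<Gamma>_lin matrix_distrib algebra_simps)

lemma cov_add: "y \<in> U \<Longrightarrow> Cinf_on U Z \<Longrightarrow> Cinf_on U Z' \<Longrightarrow> cov u (\<lambda>y. Z y + Z' y) y = cov u Z y + cov u Z' y"
  by (simp add: cov_def ddU smooth matrix_distrib)

lemma cov_scaleR: "y \<in> U \<Longrightarrow> Cinf_on U f \<Longrightarrow> Cinf_on U Z \<Longrightarrow>
    cov u (\<lambda>y. f y *\<^sub>R Z y) y = dd u f y *\<^sub>R Z y + f y *\<^sub>R cov u Z y"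
  by (simp add: cov_def ddU smooth matrix_distrib scaleR_add_right)

lemma tr_dd: "y \<in> U \<Longrightarrow> Cinf_on U f \<Longrightarrow> tr (\<lambda>e. dd e f y *\<^sub>R v) = dd v f y"
  by (rule tr_rank_one[OF linear_dd[OF Cinf_on_differentiable]])

lemma tr_dd_mult: "y \<in> U \<Longrightarrow> Cinf_on U f \<Longrightarrow> tr (\<lambda>e. (c * dd e f y) *\<^sub>R v) = c * dd v f y"
  using tr_scaleR[of c "\<lambda>e. dd e f y *\<^sub>R v"] by (simp add: tr_dd)

lemma dv_add: "y \<in> U \<Longrightarrow> Cinf_on U Z \<Longrightarrow> Cinf_on U Z' \<Longrightarrow> dv (\<lambda>y. Z y + Z' y) y = dv Z y + dv Z' y"
  by (simp add: dv_def cov_add tr_add)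

lemma dv_scaleR: "y \<in> U \<Longrightarrow> Cinf_on U f \<Longrightarrow> Cinf_on U Z \<Longrightarrow>
    dv (\<lambda>y. f y *\<^sub>R Z y) y = dd (Z y) f y + f y * dv Z y"
  by (simp add: dv_def cov_scaleR tr_add tr_scaleR tr_dd)

lemma dd_metric:
  assumes y: "y \<in> U" and Z: "Cinf_on U Z" "Cinf_on U Z'"
  shows "dd u (\<lambda>y. Z y \<bullet> (g y *v Z' y)) y = cov u Z y \<bullet> (g y *v Z' y) + Z y \<bullet> (g y *v cov u Z' y)"
  using y Z inner_matrix_vector[of "Z y" "transpose (\<Gamma> u y)" "g y *v Z' y"]
  by (simp add: cov_def ddU smooth dd_g matrix_distrib inner_add_left inner_add_right)

text \<open>The inverse metric is parallel, so raising indices commutes with covariant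
  differentiation.\<close>

lemma nab_up:
  assumes y: "y \<in> U" and T: "Cinf_on U T"
  shows "nab w (up T) y = h y ** (dd w T y - transpose (\<Gamma> w y) ** T y - T y ** \<Gamma> w y) ** h y"
  using y T unfolding nab_def up_def[abs_def]
  by (simp add: ddU smooth dd_h matrix_distrib algebra_simps)

lemma dv2_inner: "dv2 M y \<bullet> z = tr (\<lambda>e. nab e M y *v z)"
proof -
  have "dv2 M y \<bullet> z = (\<Sum>j\<in>UNIV. \<Sum>i\<in>UNIV. nab (axis i 1) M y $ i $ j * z $ j)"
    by (simp add: dv2_def inner_vec_def sum_distrib_right)
  also have "\<dots> = tr (\<lambda>e. nab e M y *v z)"
    by (subst sum.swap) (simp add: tr_def matrix_vector_mult_def)
  finally show ?thesis .
qed

lemma dv2_diff: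
  assumes "y \<in> U" "Cinf_on U M" "Cinf_on U M'"
  shows "dv2 (\<lambda>y. M y - M' y) y = dv2 M y - dv2 M' y"
  using assms by (simp add: dv2_def nab_def ddU matrix_distrib vec_eq_iff sum.distrib sum_subtractf)

text \<open>The covariant derivative of \<open>Grav\<close> is twice \<open>nRic\<close> minus the
  derivative of \<open>Scal\<close> times \<open>g\<close>; the divergences of the two parts agree
  by \<open>contracted_Bianchi\<close>.\<close>

lemma dv2_Grav:
  assumes y: "y \<in> U"
  shows "dv2 (up Grav) y = 0"
proof -
  have D: "dd w Grav y - transpose (\<Gamma> w y) ** Grav y - Grav y ** \<Gamma> w y = 2 *\<^sub>R nRic w y - dd w Scal y *\<^sub>R g y" for w
    using y unfolding Grav_def[abs_def]
    by (simp add: ddU smooth' dd_g nRic_def matrix_distrib algebra_simps)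
  have "dv2 (up Grav) y \<bullet> z = 0" for z
  proof -
    have "dv2 (up Grav) y \<bullet> z = tr (\<lambda>e. 2 *\<^sub>R (h y *v (nRic e y *v (h y *v z))) - dd e Scal y *\<^sub>R (h y *v z))"
      using y by (simp add: dv2_inner nab_up Grav_smooth D matrix_distrib hg)
    also have "\<dots> = 0"
      using contracted_Bianchi[OF y, of "h y *v z"] y
      by (simp add: tr_diff tr_scaleR tr_dd Scal_smooth)
    finally show ?thesis .
  qed
  then show ?thesis by (metis inner_eq_zero_iff)
qed

text \<open>Leibniz rule: differentiating \<open>f\<close> and the contracted factor yields the
  divergence, differentiating the other factor yields the acceleration
  \<open>cov (Z y) Z y\<close>.\<close>

lemma dv2_outer:
  assumes y: "y \<in> U" and "Cinf_on U f" "Cinf_on U Z"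
  shows "dv2 (\<lambda>y. f y *\<^sub>R outer (Z y) (Z y)) y = dv (\<lambda>y. f y *\<^sub>R Z y) y *\<^sub>R Z y + f y *\<^sub>R cov (Z y) Z y"
proof -
  have lin: "linear (\<lambda>e. f y * (cov e Z y \<bullet> z))" for z
    by (intro linearI) (simp_all add: linear_add[OF cov_linear[OF y assms(3)]] linear_scale[OF cov_linear[OF y assms(3)]]
      inner_add_left algebra_simps)
  have "nab w (\<lambda>y. f y *\<^sub>R outer (Z y) (Z y)) y
      = dd w f y *\<^sub>R outer (Z y) (Z y) + f y *\<^sub>R (outer (cov w Z y) (Z y) + outer (Z y) (cov w Z y))" for w
    using assms by (simp add: nab_def ddU' smooth' matrix_distrib matrix_mult_outer outer_mult_matrix cov_def
      bounded_bilinear.add_left[OF bounded_bilinear_outer] bounded_bilinear.add_right[OF bounded_bilinear_outer] algebra_simps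
      del: transpose_matrix_vector)
  then have "dv2 (\<lambda>y. f y *\<^sub>R outer (Z y) (Z y)) y \<bullet> z
      = tr (\<lambda>e. (Z y \<bullet> z) *\<^sub>R dd e f y *\<^sub>R Z y + f y *\<^sub>R (Z y \<bullet> z) *\<^sub>R cov e Z y + f y *\<^sub>R (cov e Z y \<bullet> z) *\<^sub>R Z y)" for z
    by (simp add: dv2_inner matrix_distrib outer_mult_vec scaleR_add_right mult.commute add.assoc)
  also have "\<dots> z = (dv (\<lambda>y. f y *\<^sub>R Z y) y *\<^sub>R Z y + f y *\<^sub>R cov (Z y) Z y) \<bullet> z" for z
    using assms by (simp add: tr_add tr_scaleR tr_rank_one[OF lin] tr_dd_mult dv_scaleR inner_add_left dv_def[of Z] algebra_simps)
  finally show ?thesis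
    by (intro vector_eq_rdot[where 'a="real^'n", THEN iffD1] allI)
qed

end

section \<open>Killing fields of constant length\<close>

definition deriv_matrix :: "(real^'n \<Rightarrow> real^'n) \<Rightarrow> real^'n::finite \<Rightarrow> real^'n^'n" where
  "deriv_matrix Z y = (\<chi> i j. dd (axis j 1) Z y $ i)"

locale killing_field = metric_connection U g \<Gamma>
  for U :: "(real^'n::finite) set" and g and \<Gamma> +
  fixes Y :: "real^'n \<Rightarrow> real^'n"
  assumes Y_smooth: "Cinf_on U Y"
    and Y_killing: "y \<in> U \<Longrightarrow> dd (Y y) g y + transpose (deriv_matrix Y y) ** g y + g y ** deriv_matrix Y y = 0"
    and Y_norm: "y \<in> U \<Longrightarrow> Y y \<bullet> (g y *v Y y) = -1"
begin

abbreviation N :: "real^'n \<Rightarrow> real^'n^'n" where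
  "N \<equiv> deriv_matrix Y"

lemma N_smooth: "Cinf_on U N"
  unfolding deriv_matrix_def[abs_def] by (intro Cinf_on_vec[OF open_U] Cinf_on_nth[OF open_U] Cinf_on_dd Y_smooth)

lemma N_apply:
  assumes y: "y \<in> U"
  shows "N y *v u = dd u Y y"
  using linear_expansion[OF linear_dd[OF Cinf_on_differentiable[OF Y_smooth y]], of u]
  by (simp add: deriv_matrix_def matrix_vector_mult_def vec_eq_iff mult.commute)

lemma dd_N_sym:
  assumes y: "y \<in> U"
  shows "dd u N y *v v = dd v N y *v u"
proof -
  have *: "dd a N y *v b = dd a (dd b Y) y" for a b
  proof -
    have "dd a (\<lambda>y. N y *v b) y = dd a (dd b Y) y"
      by (rule dd_cong[OF open_U y N_apply])
    then show ?thesis using y by (simp add: ddU smooth N_smooth)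
  qed
  show ?thesis unfolding * by (rule dd_commute[OF open_U y Y_smooth])
qed

lemma dd_Y_g: "y \<in> U \<Longrightarrow> dd (Y y) g y = - (transpose (N y) ** g y) - g y ** N y"
  using Y_killing[of y] by (simp add: eq_neg_iff_add_eq_0 algebra_simps)

text \<open>The flow of a Killing field preserves the connection.\<close>

lemma dd_Y_\<Gamma>:
  assumes y: "y \<in> U"
  shows "dd (Y y) (\<Gamma> u) y = N y ** \<Gamma> u y - \<Gamma> u y ** N y - \<Gamma> (N y *v u) y - dd u N y"
proof -
  \<comment> \<open>\<open>C u\<close> is the Lie derivative of the connection along
    \<open>Y\<close>, a tensor symmetric in its two lower arguments.\<close>
  define C where "C u = dd (Y y) (\<Gamma> u) y + \<Gamma> u y ** N y - N y ** \<Gamma> u y + \<Gamma> (N y *v u) y + dd u N y" for u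
  have sym: "C u *v v = C v *v u" for u v
  proof -
    have "\<Gamma> u y ** N y *v v = \<Gamma> (N y *v v) y *v u" for u v
      using \<Gamma>_sym[OF y, of u "N y *v v"] by (simp add: matrix_vector_mul_assoc)
    moreover have "N y ** \<Gamma> u y *v v = N y ** \<Gamma> v y *v u"
      using \<Gamma>_sym[OF y, of u v] by (simp add: matrix_vector_mul_assoc[symmetric])
    ultimately show ?thesis
      using dd_\<Gamma>_sym[OF y, of "Y y" u v] dd_N_sym[OF y, of u v]
      by (simp add: C_def matrix_distrib)
  qed
  \<comment> \<open>Derivative of the Killing equation in direction \<open>u\<close>, with the
    derivatives of \<open>g\<close> expressed by \<open>\<Gamma>\<close>.\<close>
  have skew: "g y ** C u + transpose (C u) ** g y = 0" for u
  proof -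
    have "dd u (\<lambda>y. dd (Y y) g y) y = dd u (\<lambda>y. - (transpose (N y) ** g y) - g y ** N y) y"
      by (rule dd_cong[OF open_U y dd_Y_g])
    moreover have "dd u (\<lambda>y. dd (Y y) g y) y = dd u (dd (Y y) g) y + dd (N y *v u) g y"
      unfolding N_apply[OF y]
      by (rule dd_apply[OF open_U _ _ Y_smooth y]) (auto intro!: linear_dd Cinf_on_differentiable[OF g_smooth] smooth)
    moreover have "dd u (dd (Y y) g) y = dd (Y y) (\<lambda>y. transpose (\<Gamma> u y) ** g y + g y ** \<Gamma> u y) y"
      unfolding dd_commute[OF open_U y g_smooth, of u] by (rule dd_cong[OF open_U y dd_g])
    ultimately have "dd (Y y) (\<lambda>y. transpose (\<Gamma> u y) ** g y + g y ** \<Gamma> u y) y + dd (N y *v u) g y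
        - dd u (\<lambda>y. - (transpose (N y) ** g y) - g y ** N y) y = 0"
      by simp
    also have "dd (Y y) (\<lambda>y. transpose (\<Gamma> u y) ** g y + g y ** \<Gamma> u y) y + dd (N y *v u) g y
        - dd u (\<lambda>y. - (transpose (N y) ** g y) - g y ** N y) y = g y ** C u + transpose (C u) ** g y"
      using y by (simp add: ddU smooth N_smooth C_def dd_Y_g dd_g[of y u] dd_g[of y "N y *v u"] matrix_distrib algebra_simps)
    finally show ?thesis .
  qed
  \<comment> \<open>Symmetric in the first two slots and antisymmetric in the last two: six
    alternating swaps return \<open>T u v w\<close> with the opposite sign.\<close>
  define T where "T u v w = w \<bullet> (g y *v (C u *v v))" for u v w
  have T1: "T u v w = T v u w" for u v w
    by (simp add: T_def sym)
  have T2: "T u v w = - T u w v" for u v w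
  proof -
    have "transpose (g y ** C u) = - (g y ** C u)"
      using skew[of u] y by (simp add: matrix_distrib g_sym eq_neg_iff_add_eq_0 add.commute)
    then show ?thesis
      using inner_matrix_vector[of w "g y ** C u" v] by (simp add: T_def matrix_distrib inner_commute del: transpose_matrix_vector)
  qed
  have "T u v w = 0" for u v w
    using T1[of u v w] T2[of v u w] T1[of v w u] T2[of w v u] T1[of w u v] T2[of u w v] by simp
  then have "g y ** C u = 0"
    by (intro matrix_eqI_inner) (simp add: T_def matrix_vector_mul_assoc)
  then have "h y ** (g y ** C u) = 0" by (simp add: matrix_distrib)
  then have "C u = 0" using y by (simp add: matrix_distrib hg)
  then show ?thesis by (simp add: C_def eq_neg_iff_add_eq_0 algebra_simps)
qed

text \<open>The endomorphism \<open>u \<mapsto> D_u Y\<close>. By symmetry of the connection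
  \<open>\<Gamma> u y *v Y y\<close> may be written with \<open>\<Gamma> (Y y) y\<close>, which
  makes it a matrix.\<close>

definition A :: "real^'n \<Rightarrow> real^'n^'n" where
  "A y = N y + \<Gamma> (Y y) y"

lemma A_apply: "y \<in> U \<Longrightarrow> A y *v u = cov u Y y"
  by (simp add: A_def matrix_distrib N_apply cov_def \<Gamma>_sym[of y u])

lemma A_smooth: "Cinf_on U A"
  unfolding A_def[abs_def] by (intro smooth N_smooth Cinf_on_apply[OF open_U \<Gamma>_linear \<Gamma>_smooth Y_smooth])

text \<open>The Killing equation in covariant form, after replacing the derivative of
  \<open>g\<close> by \<open>dd_g\<close>.\<close>

lemma A_skew: "y \<in> U \<Longrightarrow> transpose (A y) ** g y = - (g y ** A y)"
  using Y_killing[of y] by (simp add: dd_g A_def matrix_distrib eq_neg_iff_add_eq_0 algebra_simps)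

lemma A_skew_form:
  assumes y: "y \<in> U"
  shows "(A y *v u) \<bullet> (g y *v v) = - (u \<bullet> (g y *v (A y *v v)))"
  using inner_matrix_vector[of u "transpose (A y)" "g y *v v"] y
  by (simp add: matrix_distrib A_skew)

lemma A_skew_form': "y \<in> U \<Longrightarrow> (A y *v u) \<bullet> (g y *v u) = 0"
  using A_skew_form[of y u u] form_sym[OF g_sym, of y u "A y *v u"] by (simp add: inner_commute)

text \<open>Kostant's identity: inserting \<open>dd_Y_\<Gamma>\<close> for the derivative of
  \<open>\<Gamma>\<close> along \<open>Y\<close> cancels the second derivatives of
  \<open>Y\<close>.\<close>

lemma nab_A:
  assumes y: "y \<in> U"
  shows "dd w A y + \<Gamma> w y ** A y - A y ** \<Gamma> w y = Riem w (Y y) y"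
proof -
  have "dd w A y = dd w N y + (dd w (\<Gamma> (Y y)) y + \<Gamma> (N y *v w) y)"
    using y dd_apply[OF open_U \<Gamma>_linear \<Gamma>_smooth Y_smooth y, of w] unfolding A_def[abs_def] N_apply[OF y]
    by (simp add: ddU N_smooth Cinf_on_apply[OF open_U \<Gamma>_linear \<Gamma>_smooth Y_smooth])
  then show ?thesis
    by (simp add: Riem_def dd_Y_\<Gamma>[OF y] A_def matrix_distrib)
qed

text \<open>Since \<open>g(Y, Y)\<close> is constant, every \<open>A u\<close> is orthogonal to
  \<open>Y\<close>, and skewness moves \<open>A\<close> onto \<open>Y\<close>. Geometrically, the
  orbits of \<open>Y\<close> are geodesics.\<close>

lemma A_Y:
  assumes y: "y \<in> U"
  shows "A y *v Y y = 0"
proof -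
  have "u \<bullet> (g y *v (A y *v Y y)) = 0" for u
  proof -
    have "dd u (\<lambda>y. Y y \<bullet> (g y *v Y y)) y = dd u (\<lambda>y. -1) y"
      by (rule dd_cong[OF open_U y Y_norm])
    then have "(A y *v u) \<bullet> (g y *v Y y) = 0"
      using form_sym[OF g_sym[OF y], of "Y y" "A y *v u"]
      by (simp add: dd_metric[OF y Y_smooth Y_smooth] A_apply[OF y] dd_const)
    then show ?thesis using A_skew_form[OF y, of u "Y y"] by simp
  qed
  then have "g y *v (A y *v Y y) = 0" by (metis inner_eq_zero_iff)
  then have "h y *v (g y *v (A y *v Y y)) = 0" by simp
  then show ?thesis by (simp only: h_cancel(4)[OF y])
qed

lemma trace_A:
  assumes y: "y \<in> U"
  shows "trace (A y) = 0"
proof -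
  have "h y ** (transpose (A y) ** g y) = - A y"
    using y by (simp add: A_skew matrix_distrib hg)
  then have "- trace (A y) = trace (h y ** transpose (A y) ** g y)"
    by (simp add: matrix_mul_assoc trace_def sum_negf)
  also have "trace (h y ** transpose (A y) ** g y) = trace (transpose (A y))"
    using y trace_mul_sym[of "h y ** transpose (A y)" "g y"] by (simp add: matrix_distrib gh)
  also have "\<dots> = trace (A y)" by (simp add: trace_def transpose_def)
  finally show ?thesis by simp
qed

lemma dv_Y: "y \<in> U \<Longrightarrow> dv Y y = 0"
  using trace_A[of y] by (simp add: dv_def A_apply[symmetric] trace_eq_tr)

text \<open>Differentiating \<open>A Y = 0\<close> gives
  \<open>(\<nabla>_e A) Y = - A (A e)\<close>, and \<open>nab_A\<close> identifies the left-hand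
  side with \<open>R(e, Y) Y\<close>.\<close>

lemma Ric_Y_Y:
  assumes y: "y \<in> U"
  shows "Y y \<bullet> (Ric y *v Y y) = - trace (A y ** A y)"
proof -
  have "Riem e (Y y) y *v Y y = - (A y ** A y *v e)" for e
  proof -
    have "dd e (\<lambda>y. A y *v Y y) y = dd e (\<lambda>y. 0) y"
      by (rule dd_cong[OF open_U y A_Y])
    then have "dd e A y *v Y y = - (A y *v dd e Y y)"
      using y by (simp add: ddU smooth A_smooth Y_smooth dd_const eq_neg_iff_add_eq_0 add.commute)
    then have "Riem e (Y y) y *v Y y = - (A y *v cov e Y y)"
      using A_Y[OF y] by (simp add: nab_A[OF y, symmetric] matrix_distrib cov_def)
        (simp add: matrix_vector_mul_assoc[symmetric] A_Y[OF y])
    then show ?thesis by (simp add: A_apply[OF y, symmetric] matrix_vector_mul_assoc)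
  qed
  then show ?thesis
    by (simp add: Ric_form[OF y] tr_minus trace_eq_tr)
qed

text \<open>The bracket \<open>[Y, Z]\<close> in coordinates, since \<open>N y *v Z y\<close> is the
  derivative of \<open>Y\<close> along \<open>Z\<close>.\<close>

definition lie :: "(real^'n \<Rightarrow> real^'n) \<Rightarrow> real^'n \<Rightarrow> real^'n" where
  "lie Z y = dd (Y y) Z y - N y *v Z y"

text \<open>The hypothesis on \<open>T\<close> says that its Lie derivative along \<open>Y\<close> vanishes.\<close>

lemma dd_Y_form:
  assumes "dd (Y y) T y = - (transpose (N y) ** T y) - T y ** N y"
    and "T differentiable (at y)" "Z differentiable (at y)" "Z' differentiable (at y)"
  shows "dd (Y y) (\<lambda>y. Z y \<bullet> (T y *v Z' y)) y = lie Z y \<bullet> (T y *v Z' y) + Z y \<bullet> (T y *v lie Z' y)"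
proof -
  have "(\<lambda>y. T y *v Z' y) differentiable (at y)"
    using bounded_bilinear.FDERIV[OF bounded_bilinear_matrix_vector assms(2,4)[THEN has_derivative_dd]]
    by (auto simp: differentiable_def)
  then show ?thesis
    using assms inner_matrix_vector[of "Z y" "transpose (N y)" "T y *v Z' y"]
    by (simp add: dd_inner dd_matrix_vector lie_def matrix_distrib inner_add_right inner_diff_left inner_diff_right)
qed

section \<open>Invariance of the curvature under the Killing field\<close>

lemma dd_Y_Riem:
  assumes y: "y \<in> U"
  shows "dd (Y y) (Riem u v) y = N y ** Riem u v y - Riem u v y ** N y - Riem (N y *v u) v y - Riem u (N y *v v) y"
proof -
  \<comment> \<open>\<open>dd_Y_\<Gamma>\<close> differentiated along \<open>u\<close>; the
    direction \<open>Y y\<close> moves as well, which produces the last term.\<close>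
  have *: "dd (Y y) (dd u (\<Gamma> v)) y = dd u N y ** \<Gamma> v y + N y ** dd u (\<Gamma> v) y - dd u (\<Gamma> v) y ** N y
     - \<Gamma> v y ** dd u N y - dd u (\<Gamma> (N y *v v)) y - \<Gamma> (dd u N y *v v) y - dd u (dd v N) y - dd (N y *v u) (\<Gamma> v) y" for u v
  proof -
    have N_v: "Cinf_on U (\<lambda>y. N y *v v)" by (intro smooth N_smooth)
    have "dd u (\<lambda>y. dd (Y y) (\<Gamma> v) y) y = dd u (\<lambda>y. N y ** \<Gamma> v y - \<Gamma> v y ** N y - \<Gamma> (N y *v v) y - dd v N y) y"
      by (rule dd_cong[OF open_U y dd_Y_\<Gamma>])
    moreover have "dd u (\<lambda>y. dd (Y y) (\<Gamma> v) y) y = dd u (dd (Y y) (\<Gamma> v)) y + dd (N y *v u) (\<Gamma> v) y"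
      unfolding N_apply[OF y]
      by (rule dd_apply[OF open_U _ _ Y_smooth y]) (auto intro!: linear_dd Cinf_on_differentiable[OF \<Gamma>_smooth] smooth)
    moreover have "dd u (\<lambda>y. \<Gamma> (N y *v v) y) y = dd u (\<Gamma> (N y *v v)) y + \<Gamma> (dd u N y *v v) y"
      using dd_apply[OF open_U \<Gamma>_linear \<Gamma>_smooth N_v y, of u] y by (simp add: ddU smooth N_smooth)
    ultimately show ?thesis
      using y dd_commute[OF open_U y \<Gamma>_smooth, of "Y y" u v]
      by (simp add: ddU smooth N_smooth Cinf_on_apply[OF open_U \<Gamma>_linear \<Gamma>_smooth N_v] algebra_simps)
  qed
  have "dd (Y y) (Riem u v) y = dd (Y y) (dd u (\<Gamma> v)) y - dd (Y y) (dd v (\<Gamma> u)) y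
     + (\<Gamma> u y ** dd (Y y) (\<Gamma> v) y + dd (Y y) (\<Gamma> u) y ** \<Gamma> v y) - (\<Gamma> v y ** dd (Y y) (\<Gamma> u) y + dd (Y y) (\<Gamma> v) y ** \<Gamma> u y)"
    using y unfolding Riem_def[abs_def] by (simp add: ddU smooth)
  then show ?thesis
    by (simp add: * dd_Y_\<Gamma>[OF y] Riem_def matrix_distrib dd_N_sym[OF y, of u v] dd_commute[OF open_U y N_smooth, of u v] algebra_simps)
qed

text \<open>Contraction of \<open>dd_Y_Riem\<close>: the terms with \<open>N\<close> on the
  contracted index cancel by \<open>tr_cyclic\<close>.\<close>

lemma dd_Y_Ric:
  assumes y: "y \<in> U"
  shows "dd (Y y) Ric y = - (transpose (N y) ** Ric y) - Ric y ** N y"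
proof (rule matrix_eqI_inner)
  fix u v
  have lin: "linear (\<lambda>e. Riem e u y *v v)"
    by (intro linear_matrix_apply Riem_linear1 y)
  have "u \<bullet> (dd (Y y) Ric y *v v) = tr (\<lambda>e. N y *v (Riem e u y *v v) - Riem e u y *v (N y *v v)
     - Riem (N y *v e) u y *v v - Riem e (N y *v u) y *v v)"
    by (simp add: dd_Ric_form[OF y] dd_Y_Riem[OF y] matrix_distrib)
  also have "\<dots> = - (u \<bullet> (Ric y *v (N y *v v))) - (N y *v u) \<bullet> (Ric y *v v)"
    by (simp add: tr_diff tr_cyclic[OF lin] Ric_form[OF y])
  also have "\<dots> = u \<bullet> ((- (transpose (N y) ** Ric y) - Ric y ** N y) *v v)"
    using inner_matrix_vector[of u "transpose (N y)" "Ric y *v v"] by (simp add: matrix_distrib inner_diff_right)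
  finally show "u \<bullet> (dd (Y y) Ric y *v v) = u \<bullet> ((- (transpose (N y) ** Ric y) - Ric y ** N y) *v v)" .
qed

lemma dd_Y_h:
  assumes y: "y \<in> U"
  shows "dd (Y y) h y = N y ** h y + h y ** transpose (N y)"
proof -
  have "dd (Y y) h y = - (h y ** dd (Y y) g y ** h y)"
    using y by (simp add: dd_h dd_g matrix_distrib h_cancel hg)
  then show ?thesis
    using y by (simp add: dd_Y_g matrix_distrib h_cancel hg)
qed

lemma dd_Y_Scal:
  assumes y: "y \<in> U"
  shows "dd (Y y) Scal y = 0"
proof -
  have "dd (Y y) Scal y = trace (N y ** (h y ** Ric y) - h y ** Ric y ** N y)"
    using y unfolding Scal_def[abs_def]
    by (simp add: ddU smooth' dd_Y_h dd_Y_Ric matrix_distrib trace_add[symmetric] algebra_simps)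
  then show ?thesis
    using trace_mul_sym[of "N y" "h y ** Ric y"] by (simp add: trace_sub)
qed

lemma dd_Y_Grav:
  assumes y: "y \<in> U"
  shows "dd (Y y) Grav y = - (transpose (N y) ** Grav y) - Grav y ** N y"
  using y unfolding Grav_def[abs_def]
  by (simp add: ddU smooth' dd_Y_Ric dd_Y_Scal dd_Y_g matrix_distrib algebra_simps)

end

section \<open>Fields invariant under a Killing field\<close>

context killing_field
begin

lemma lie_Y: "y \<in> U \<Longrightarrow> lie Y y = 0"
  by (simp add: lie_def N_apply)

lemma lie_cong:
  assumes "open V" "y \<in> V" "\<And>z. z \<in> V \<Longrightarrow> Z z = Z' z"
  shows "lie Z y = lie Z' y"
  using dd_cong[OF assms] assms by (simp add: lie_def)

text \<open>Here \<open>\<alpha>\<close> is the differential of a function that is constant along \<open>Y\<close>.\<close>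

lemma lie_gradient:
  assumes V: "open V" "y \<in> V" "V \<subseteq> U" and \<alpha>: "Cinf_on V \<alpha>"
    and closed: "\<And>u v. dd u \<alpha> y \<bullet> v = dd v \<alpha> y \<bullet> u" and Y: "\<And>z. z \<in> V \<Longrightarrow> Y z \<bullet> \<alpha> z = 0"
  shows "lie (\<lambda>z. h z *v \<alpha> z) y = 0"
proof -
  have y: "y \<in> U" using V by auto
  note \<alpha>_diff = Cinf_on_differentiable[OF \<alpha> V(2)]
  \<comment> \<open>Cartan's formula: as \<alpha> is closed at \<open>y\<close>, the derivative of
    \<open>Y z \<bullet> \<alpha> z = 0\<close> is its Lie derivative along
    \<open>Y\<close>.\<close>
  have "u \<bullet> (transpose (N y) *v \<alpha> y + dd (Y y) \<alpha> y) = 0" for u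
  proof -
    have "dd u (\<lambda>z. Y z \<bullet> \<alpha> z) y = dd u (\<lambda>z. 0) y"
      by (rule dd_cong[OF V(1,2) Y])
    then have "Y y \<bullet> dd u \<alpha> y + (N y *v u) \<bullet> \<alpha> y = 0"
      using y \<alpha>_diff by (simp add: ddU Y_smooth N_apply dd_const)
    then show ?thesis
      using inner_matrix_vector[of u "transpose (N y)" "\<alpha> y"] closed[of u "Y y"]
      by (simp add: inner_add_right inner_commute add.commute del: transpose_matrix_vector)
  qed
  then have *: "transpose (N y) *v \<alpha> y + dd (Y y) \<alpha> y = 0"
    by (metis inner_eq_zero_iff)
  have "lie (\<lambda>z. h z *v \<alpha> z) y = h y *v (transpose (N y) *v \<alpha> y + dd (Y y) \<alpha> y)"
    using y \<alpha>_diff by (simp add: lie_def ddU h_smooth dd_Y_h matrix_distrib algebra_simps del: transpose_matrix_vector)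
  then show ?thesis by (simp only: *) simp
qed

text \<open>Differentiating the eigenvalue equation along \<open>Y\<close>: \<open>[Y, X0]\<close> satisfies it again, up to the
  derivative of the eigenvalue, which vanishes since \<open>[Y, X0]\<close> lies in the span of the \<open>E k\<close>.\<close>

lemma invariant_eigenvector:
  fixes E :: "'k::finite \<Rightarrow> real^'n \<Rightarrow> real^'n"
  assumes V: "open V" "y \<in> V" "V \<subseteq> U" and X0: "Cinf_on V X0" and \<mu>: "Cinf_on V \<mu>"
    and E: "\<And>k. Cinf_on V (E k)" "\<And>k. lie (E k) y = 0" and c: "\<And>k. Cinf_on V (c k)"
    and X0_E: "\<And>z. z \<in> V \<Longrightarrow> X0 z = (\<Sum>k\<in>UNIV. c k z *\<^sub>R E k z)"
    and norm: "\<And>z. z \<in> V \<Longrightarrow> X0 z \<bullet> (g z *v X0 z) = -1"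
    and eigen: "\<And>z k. z \<in> V \<Longrightarrow> X0 z \<bullet> (Grav z *v E k z) = - \<mu> z * (X0 z \<bullet> (g z *v E k z))"
    and line: "\<And>z. z \<in> span (range (\<lambda>k. E k y)) \<Longrightarrow>
       (\<And>k. z \<bullet> (Grav y *v E k y) = - \<mu> y * (z \<bullet> (g y *v E k y))) \<Longrightarrow> z \<in> span {X0 y}"
  shows "dd (Y y) \<mu> y = 0" "lie X0 y = 0"
proof -
  have y: "y \<in> U" using V by auto
  note diff = Cinf_on_differentiable[OF _ V(2)] Cinf_on_differentiable[OF g_smooth y] Cinf_on_differentiable[OF Grav_smooth y]
  note form_g = dd_Y_form[OF dd_Y_g[OF y] diff(2)] and form_G = dd_Y_form[OF dd_Y_Grav[OF y] diff(3)]
  let ?B = "lie X0 y" and ?S = "span (range (\<lambda>k. E k y))"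
  have gE: "(\<lambda>z. X0 z \<bullet> (g z *v E k z)) differentiable (at y)" for k
  proof -
    have "Cinf_on V (\<lambda>z. X0 z \<bullet> (g z *v E k z))"
      by (intro Cinf_on_inner[OF V(1)] Cinf_on_bilinear[OF V(1) bounded_bilinear_matrix_vector] X0 E Cinf_on_subset[OF g_smooth V(3)])
    then show ?thesis by (rule diff)
  qed
  have 1: "?B \<bullet> (Grav y *v E k y) = - \<mu> y * (?B \<bullet> (g y *v E k y)) - dd (Y y) \<mu> y * (X0 y \<bullet> (g y *v E k y))" for k
  proof -
    have "dd (Y y) (\<lambda>z. X0 z \<bullet> (Grav z *v E k z)) y = dd (Y y) (\<lambda>z. - (\<mu> z * (X0 z \<bullet> (g z *v E k z)))) y"
      by (rule dd_cong[OF V(1,2)]) (simp add: eigen)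
    also have "\<dots> = - (\<mu> y * dd (Y y) (\<lambda>z. X0 z \<bullet> (g z *v E k z)) y + dd (Y y) \<mu> y * (X0 y \<bullet> (g y *v E k y)))"
    proof -
      have "(\<lambda>z. \<mu> z * (X0 z \<bullet> (g z *v E k z))) differentiable (at y)"
        by (rule differentiable_mult[OF diff(1)[OF \<mu>] gE])
      then show ?thesis by (simp add: dd_minus dd_mult diff(1)[OF \<mu>] gE)
    qed
    finally show ?thesis
      by (simp add: form_g form_G diff(1)[OF X0] diff(1)[OF E(1)] E(2))
  qed
  have 2: "?B \<bullet> (Grav y *v z) = - \<mu> y * (?B \<bullet> (g y *v z)) - dd (Y y) \<mu> y * (X0 y \<bullet> (g y *v z))" if "z \<in> ?S" for z
  proof -
    have "linear (\<lambda>z. ?B \<bullet> (Grav y *v z) + \<mu> y * (?B \<bullet> (g y *v z)) + dd (Y y) \<mu> y * (X0 y \<bullet> (g y *v z)))"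
      by (intro linearI) (simp_all add: matrix_distrib inner_add_right algebra_simps)
    from linear_eq_0_on_span[OF this _ that] show ?thesis
      using 1 by fastforce
  qed
  have X0_S: "X0 y \<in> ?S"
    unfolding X0_E[OF V(2)] by (intro span_sum span_scale span_base) auto
  \<comment> \<open>Along \<open>Y\<close> the coefficients \<open>c k\<close> alone are
    differentiated, the \<open>E k\<close> commuting with \<open>Y\<close> at \<open>y\<close>, so
    the bracket stays in the span.\<close>
  have B_S: "?B \<in> ?S"
  proof -
    have sc: "(\<lambda>z. c k z *\<^sub>R E k z) differentiable (at y)" for k
      by (rule diff(1)[OF Cinf_on_scaleR[OF V(1) c E(1)]])
    have "?B = lie (\<lambda>z. \<Sum>k\<in>UNIV. c k z *\<^sub>R E k z) y"
      by (rule lie_cong[OF V(1,2) X0_E])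
    also have "\<dots> = (\<Sum>k\<in>UNIV. dd (Y y) (c k) y *\<^sub>R E k y + c k y *\<^sub>R lie (E k) y)"
      by (simp add: lie_def dd_sum[OF sc] dd_scaleR diff(1)[OF c] diff(1)[OF E(1)] linear_sum[OF matrix_vector_mul_linear]
        matrix_distrib sum.distrib sum_subtractf scaleR_diff_right)
    also have "\<dots> \<in> ?S"
      unfolding E(2) by (simp, intro span_sum span_scale, auto intro: span_base)
    finally show ?thesis .
  qed
  have eig: "X0 y \<bullet> (Grav y *v z) = - \<mu> y * (X0 y \<bullet> (g y *v z))" if "z \<in> ?S" for z
  proof -
    have "linear (\<lambda>z. X0 y \<bullet> (Grav y *v z) + \<mu> y * (X0 y \<bullet> (g y *v z)))"
      by (intro linearI) (simp_all add: matrix_distrib inner_add_right algebra_simps)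
    from linear_eq_0_on_span[OF this _ that] show ?thesis
      using eigen[OF V(2)] by fastforce
  qed
  have gsym: "u \<bullet> (g y *v v) = v \<bullet> (g y *v u)" and Gsym: "u \<bullet> (Grav y *v v) = v \<bullet> (Grav y *v u)" for u v
    by (rule form_sym[OF g_sym[OF y]] form_sym[OF Grav_sym[OF y]])+
  \<comment> \<open>By symmetry, \<open>2\<close> at \<open>X0 y\<close> and \<open>eig\<close> at
    \<open>?B\<close> concern the same two products; they differ by the derivative of \<mu> times
    \<open>g(X0, X0) = -1\<close>.\<close>
  show \<mu>0: "dd (Y y) \<mu> y = 0"
    using 2[OF X0_S] eig[OF B_S] norm[OF V(2)] gsym[of ?B "X0 y"] Gsym[of ?B "X0 y"] by simp
  have "?B \<in> span {X0 y}"
    by (rule line[OF B_S]) (simp add: 1 \<mu>0)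
  then obtain k where k: "?B = k *\<^sub>R X0 y"
    by (auto simp: span_singleton)
  have "dd (Y y) (\<lambda>z. X0 z \<bullet> (g z *v X0 z)) y = dd (Y y) (\<lambda>z. -1) y"
    by (rule dd_cong[OF V(1,2) norm])
  then have "2 * (?B \<bullet> (g y *v X0 y)) = 0"
    using gsym[of ?B "X0 y"] by (simp add: form_g diff(1)[OF X0] dd_const)
  then show "?B = 0"
    using norm[OF V(2)] by (simp add: k)
qed

end

text \<open>\<open>Grav_Y_Y\<close> is the \<open>(Y, Y)\<close> entry of the splitting of
  \<open>Grav\<close> on the span of \<open>X0\<close> and \<open>Y\<close>, with
  \<open>g(X, Y) = - \<rho>/\<mu>\<close> inserted. Solved for \<sigma> in
  \<open>\<sigma>_eq\<close>, it makes \<sigma> smooth and invariant under \<open>Y\<close>.\<close>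

locale fluid = killing_field U g \<Gamma> Y
  for U :: "(real^'n::finite) set" and g and \<Gamma> and Y +
  fixes X0 :: "real^'n \<Rightarrow> real^'n" and \<mu> \<sigma> :: "real^'n \<Rightarrow> real"
  assumes X0_smooth: "Cinf_on U X0" and \<mu>_smooth: "Cinf_on U \<mu>" and \<mu>_pos: "y \<in> U \<Longrightarrow> \<mu> y > 0"
    and X0_norm: "y \<in> U \<Longrightarrow> X0 y \<bullet> (g y *v X0 y) = -1"
    and X0_Y: "y \<in> U \<Longrightarrow> X0 y \<bullet> (g y *v Y y) = 0"
    and lie_X0: "y \<in> U \<Longrightarrow> lie X0 y = 0" and dd_Y_\<mu>: "y \<in> U \<Longrightarrow> dd (Y y) \<mu> y = 0"
    and Grav_Y_Y: "y \<in> U \<Longrightarrow> Y y \<bullet> (Grav y *v Y y) = (X0 y \<bullet> (Grav y *v Y y))\<^sup>2 / \<mu> y + \<sigma> y"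
begin

section \<open>The corrected velocity, the tensor \<open>P\<close> and their divergences\<close>

definition \<rho> :: "real^'n \<Rightarrow> real" where
  "\<rho> y = X0 y \<bullet> (Grav y *v Y y)"

definition r :: "real^'n \<Rightarrow> real" where
  "r y = \<rho> y / \<mu> y"

definition X :: "real^'n \<Rightarrow> real^'n" where
  "X y = X0 y + r y *\<^sub>R Y y"

definition P :: "real^'n \<Rightarrow> real^'n^'n" where
  "P y = Grav y - \<mu> y *\<^sub>R outer (g y *v X y) (g y *v X y) - \<sigma> y *\<^sub>R outer (g y *v Y y) (g y *v Y y)"

lemma \<mu>_r: "y \<in> U \<Longrightarrow> \<mu> y * r y = \<rho> y"
  using \<mu>_pos[of y] by (simp add: r_def)

lemma \<rho>_smooth: "Cinf_on U \<rho>"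
  unfolding \<rho>_def[abs_def] by (intro smooth X0_smooth Y_smooth Grav_smooth)

lemma r_smooth: "Cinf_on U r"
  unfolding r_def[abs_def] by (intro Cinf_on_divide[OF open_U] \<rho>_smooth \<mu>_smooth) (use \<mu>_pos in force)

lemma X_smooth: "Cinf_on U X"
  unfolding X_def[abs_def] by (intro smooth X0_smooth r_smooth Y_smooth)

lemma \<sigma>_eq: "y \<in> U \<Longrightarrow> \<sigma> y = Y y \<bullet> (Grav y *v Y y) - \<rho> y * r y"
  by (simp add: Grav_Y_Y \<rho>_def r_def power2_eq_square)

lemma \<sigma>_smooth: "Cinf_on U \<sigma>"
  by (subst Cinf_on_cong[OF open_U \<sigma>_eq]) (auto intro!: smooth Y_smooth Grav_smooth \<rho>_smooth r_smooth)

lemmas all_smooth = smooth' X0_smooth \<mu>_smooth \<rho>_smooth r_smooth X_smooth \<sigma>_smooth Y_smooth Grav_smooth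

lemma dd_Y_\<rho>:
  assumes y: "y \<in> U"
  shows "dd (Y y) \<rho> y = 0"
  using dd_Y_form[OF dd_Y_Grav[OF y], of X0 Y] y unfolding \<rho>_def[abs_def]
  by (simp add: ddU all_smooth lie_X0 lie_Y)

lemma dd_r_\<mu>:
  assumes y: "y \<in> U"
  shows "\<mu> y * dd u r y + dd u \<mu> y * r y = dd u \<rho> y"
proof -
  have "dd u (\<lambda>y. \<mu> y * r y) y = dd u \<rho> y"
    by (rule dd_cong[OF open_U y \<mu>_r])
  then show ?thesis using y by (simp add: ddU all_smooth)
qed

lemma dd_Y_r: "y \<in> U \<Longrightarrow> dd (Y y) r y = 0"
  using dd_r_\<mu>[of y "Y y"] \<mu>_pos[of y] by (simp add: dd_Y_\<rho> dd_Y_\<mu>)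

lemma dd_Y_\<sigma>:
  assumes y: "y \<in> U"
  shows "dd (Y y) \<sigma> y = 0"
proof -
  have "dd (Y y) \<sigma> y = dd (Y y) (\<lambda>y. Y y \<bullet> (Grav y *v Y y) - \<rho> y * r y) y"
    by (rule dd_cong[OF open_U y \<sigma>_eq])
  also have "\<dots> = 0"
    using dd_Y_form[OF dd_Y_Grav[OF y], of Y Y] y
    by (simp add: dd_diff dd_mult Cinf_on_differentiable[where S=U] all_smooth dd_Y_\<rho> dd_Y_r lie_Y)
  finally show ?thesis .
qed

lemma dv_mult_Y:
  assumes "y \<in> U" "Cinf_on U f" "dd (Y y) f y = 0"
  shows "dv (\<lambda>y. f y *\<^sub>R Y y) y = 0"
  using assms by (simp add: dv_scaleR Y_smooth dv_Y)

text \<open>The connection is torsion-free and \<open>[Y, X0] = 0\<close>, so differentiating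
  \<open>X0\<close> along \<open>Y\<close> amounts to differentiating \<open>Y\<close> along
  \<open>X0\<close>.\<close>

lemma cov_Y_X0: "y \<in> U \<Longrightarrow> cov (Y y) X0 y = A y *v X0 y"
  using lie_X0[of y] by (simp add: lie_def cov_def A_def matrix_distrib)

lemma cov_Y_Y: "y \<in> U \<Longrightarrow> cov (Y y) Y y = 0"
  by (simp add: A_apply[symmetric] A_Y)

lemma dd_X_r: "y \<in> U \<Longrightarrow> dd (X y) r y = dd (X0 y) r y"
  by (simp add: X_def dd_dir r_smooth dd_Y_r)

text \<open>The factor 2 has two sources: the derivative of \<open>X0\<close> along \<open>Y\<close>
  and that of \<open>Y\<close> along \<open>X0\<close> both equal \<open>A X0\<close>.\<close>

lemma cov_X_X:
  assumes y: "y \<in> U"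
  shows "cov (X y) X y = cov (X0 y) X0 y + (2 * r y) *\<^sub>R (A y *v X0 y) + dd (X y) r y *\<^sub>R Y y"
proof -
  have "cov (X y) X y = cov (X y) X0 y + (dd (X y) r y *\<^sub>R Y y + r y *\<^sub>R cov (X y) Y y)"
    using y unfolding X_def[abs_def] by (simp add: cov_add cov_scaleR all_smooth)
  moreover have "cov (X y) X0 y = cov (X0 y) X0 y + r y *\<^sub>R (A y *v X0 y)"
    using linear_add[OF cov_linear[OF y X0_smooth]] linear_scale[OF cov_linear[OF y X0_smooth]]
    by (simp add: X_def cov_Y_X0[OF y])
  moreover have "cov (X y) Y y = A y *v X0 y"
    by (simp add: X_def A_apply[OF y, symmetric] matrix_distrib A_Y[OF y])
  moreover have "(2 * r y) *\<^sub>R v = r y *\<^sub>R v + r y *\<^sub>R v" for v :: "real^'n"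
    by (simp add: scaleR_add_left[symmetric])
  ultimately show ?thesis
    by simp
qed

lemma g_form_sym: "y \<in> U \<Longrightarrow> u \<bullet> (g y *v v) = v \<bullet> (g y *v u)"
  by (rule form_sym[OF g_sym])

text \<open>Follows from the constant products \<open>g(X0, X0)\<close> and \<open>g(X0, Y)\<close>,
  the skewness of \<open>A\<close> and \<open>A Y = 0\<close>. Thus in \<open>cov_X_X\<close> the
  term along \<open>Y\<close> is the one that survives pairing with the frame.\<close>

lemma frame_products:
  assumes y: "y \<in> U"
  shows "X0 y \<bullet> (g y *v cov (X0 y) X0 y) = 0" "Y y \<bullet> (g y *v cov (X0 y) X0 y) = 0"
    "X0 y \<bullet> (g y *v (A y *v X0 y)) = 0" "Y y \<bullet> (g y *v (A y *v X0 y)) = 0"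
    "Y y \<bullet> (g y *v X0 y) = 0"
    "X0 y \<bullet> (g y *v X y) = -1" "Y y \<bullet> (g y *v X y) = - r y"
proof -
  have "dd (X0 y) (\<lambda>y. X0 y \<bullet> (g y *v X0 y)) y = dd (X0 y) (\<lambda>y. -1) y"
    by (rule dd_cong[OF open_U y X0_norm])
  then show "X0 y \<bullet> (g y *v cov (X0 y) X0 y) = 0"
    using g_form_sym[OF y, of "X0 y" "cov (X0 y) X0 y"]
    by (simp add: dd_metric[OF y X0_smooth X0_smooth] dd_const)
  show 1: "X0 y \<bullet> (g y *v (A y *v X0 y)) = 0"
    using A_skew_form[OF y, of "X0 y" "X0 y"] A_skew_form'[OF y, of "X0 y"] by simp
  have "dd (X0 y) (\<lambda>y. X0 y \<bullet> (g y *v Y y)) y = dd (X0 y) (\<lambda>y. 0) y"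
    by (rule dd_cong[OF open_U y X0_Y])
  then show "Y y \<bullet> (g y *v cov (X0 y) X0 y) = 0"
    using g_form_sym[OF y, of "Y y" "cov (X0 y) X0 y"] 1
    by (simp add: dd_metric[OF y X0_smooth Y_smooth] dd_const A_apply[OF y])
  show "Y y \<bullet> (g y *v (A y *v X0 y)) = 0"
    using A_skew_form[OF y, of "Y y" "X0 y"] by (simp add: A_Y[OF y])
  show "Y y \<bullet> (g y *v X0 y) = 0"
    using X0_Y[OF y] g_form_sym[OF y] by metis
  then show "X0 y \<bullet> (g y *v X y) = -1" "Y y \<bullet> (g y *v X y) = - r y"
    using X0_Y[OF y] X0_norm[OF y] Y_norm[OF y] by (simp_all add: X_def matrix_distrib inner_add_right)
qed

lemma P_smooth: "Cinf_on U P"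
  unfolding P_def[abs_def] by (intro all_smooth)

lemma P_sym: "y \<in> U \<Longrightarrow> transpose (P y) = P y"
proof -
  have "transpose (outer a a) = outer a a" for a :: "real^'n"
    by (simp add: outer_def transpose_def vec_eq_iff)
  then show "y \<in> U \<Longrightarrow> transpose (P y) = P y"
    by (simp add: P_def matrix_distrib Grav_sym)
qed

lemma up_P:
  assumes y: "y \<in> U"
  shows "up P y = up Grav y - \<mu> y *\<^sub>R outer (X y) (X y) - \<sigma> y *\<^sub>R outer (Y y) (Y y)"
proof -
  have "h y ** outer (g y *v a) (g y *v a) ** h y = outer a a" for a
    unfolding matrix_mult_outer outer_mult_matrix h_sym[OF y] by (simp add: h_cancel(4)[OF y])
  then show ?thesis by (simp add: up_def P_def matrix_distrib)
qed

text \<open>The two fields differ by \<open>\<rho> Y\<close>, which is divergence free because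
  \<rho> is constant along \<open>Y\<close>.\<close>

lemma dv_\<mu>_X:
  assumes y: "y \<in> U"
  shows "dv (\<lambda>y. \<mu> y *\<^sub>R X y) y = dv (\<lambda>y. \<mu> y *\<^sub>R X0 y) y"
proof -
  have "dv (\<lambda>y. \<mu> y *\<^sub>R X y) y = dv (\<lambda>y. \<mu> y *\<^sub>R X0 y + \<rho> y *\<^sub>R Y y) y"
    by (rule dv_cong[OF y]) (simp add: X_def scaleR_add_right \<mu>_r)
  also have "\<dots> = dv (\<lambda>y. \<mu> y *\<^sub>R X0 y) y"
    using dv_mult_Y[OF y \<rho>_smooth dd_Y_\<rho>[OF y]] y by (simp add: dv_add all_smooth)
  finally show ?thesis .
qed

lemma div_P:
  assumes y: "y \<in> U"
  shows "dv2 (up P) y = - (dv (\<lambda>y. \<mu> y *\<^sub>R X0 y) y *\<^sub>R X y) - \<mu> y *\<^sub>R cov (X y) X y"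
proof -
  have up: "Cinf_on U (up Grav)"
    unfolding up_def[abs_def] by (intro all_smooth)
  have "dv2 (up P) y = dv2 (\<lambda>y. up Grav y - \<mu> y *\<^sub>R outer (X y) (X y) - \<sigma> y *\<^sub>R outer (Y y) (Y y)) y"
    by (rule dv2_cong[OF y up_P])
  also have "\<dots> = dv2 (up Grav) y - dv2 (\<lambda>y. \<mu> y *\<^sub>R outer (X y) (X y)) y - dv2 (\<lambda>y. \<sigma> y *\<^sub>R outer (Y y) (Y y)) y"
    using y by (simp add: dv2_diff all_smooth up)
  finally show ?thesis
    using dv_mult_Y[OF y \<sigma>_smooth dd_Y_\<sigma>[OF y]] y
    by (simp add: dv2_Grav dv2_outer all_smooth dv_\<mu>_X cov_Y_Y)
qed

lemma form_div_P:
  assumes y: "y \<in> U"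
  shows "X0 y \<bullet> (g y *v dv2 (up P) y) = dv (\<lambda>y. \<mu> y *\<^sub>R X0 y) y"
    and "Y y \<bullet> (g y *v dv2 (up P) y) = r y * dv (\<lambda>y. \<mu> y *\<^sub>R X0 y) y + \<mu> y * dd (X y) r y"
  using frame_products[OF y] Y_norm[OF y] X0_Y[OF y]
  by (simp_all add: div_P[OF y] cov_X_X[OF y] matrix_distrib inner_diff_right inner_add_right del: transpose_matrix_vector)

lemma dd_X_r_div_P:
  assumes y: "y \<in> U"
  shows "(\<mu> y)\<^sup>2 * dd (X y) r y = \<mu> y * (Y y \<bullet> (g y *v dv2 (up P) y)) - \<rho> y * (X0 y \<bullet> (g y *v dv2 (up P) y))"
  by (simp add: form_div_P[OF y] \<mu>_r[OF y, symmetric] power2_eq_square algebra_simps)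

text \<open>The first equality holds because \<open>\<rho> r\<close> is constant along
  \<open>Y\<close>. For the second, the Leibniz rule for \<open>\<rho> X0 = r (\<mu> X0)\<close>
  reproduces the second formula of \<open>form_div_P\<close>.\<close>

lemma dv_\<rho>:
  assumes y: "y \<in> U"
  shows "dv (\<lambda>y. \<rho> y *\<^sub>R X y) y = dv (\<lambda>y. \<rho> y *\<^sub>R X0 y) y"
    and "dv (\<lambda>y. \<rho> y *\<^sub>R X0 y) y = Y y \<bullet> (g y *v dv2 (up P) y)"
proof -
  have "dv (\<lambda>y. \<rho> y *\<^sub>R X y) y = dv (\<lambda>y. \<rho> y *\<^sub>R X0 y + (\<rho> y * r y) *\<^sub>R Y y) y"
    by (simp add: X_def[abs_def] scaleR_add_right)
  also have "\<dots> = dv (\<lambda>y. \<rho> y *\<^sub>R X0 y) y"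
    using dv_mult_Y[OF y Cinf_on_mult[OF open_U \<rho>_smooth r_smooth]] y
    by (simp add: dv_add all_smooth ddU dd_Y_\<rho> dd_Y_r)
  finally show "dv (\<lambda>y. \<rho> y *\<^sub>R X y) y = dv (\<lambda>y. \<rho> y *\<^sub>R X0 y) y" .
  have "dv (\<lambda>y. \<rho> y *\<^sub>R X0 y) y = dv (\<lambda>y. r y *\<^sub>R (\<mu> y *\<^sub>R X0 y)) y"
    by (rule dv_cong[OF y]) (simp add: \<mu>_r[symmetric] mult.commute)
  also have "\<dots> = \<mu> y * dd (X y) r y + r y * dv (\<lambda>y. \<mu> y *\<^sub>R X0 y) y"
    using y dv_scaleR[OF y r_smooth Cinf_on_scaleR[OF open_U \<mu>_smooth X0_smooth]] by (simp add: dd_dir r_smooth dd_X_r)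
  finally show "dv (\<lambda>y. \<rho> y *\<^sub>R X0 y) y = Y y \<bullet> (g y *v dv2 (up P) y)"
    by (simp add: form_div_P[OF y])
qed

text \<open>\<open>\<nabla>\<^sub>i(P\<^sup>i\<^sup>j Y\<^sub>j) = Y\<^sub>j \<nabla>\<^sub>i P\<^sup>i\<^sup>j\<close> because \<open>P\<close> is symmetric and \<open>\<nabla>Y\<close> is antisymmetric.\<close>

lemma div_P_Y:
  assumes y: "y \<in> U"
  shows "dv (\<lambda>y. (h y ** P y) *v Y y) y = Y y \<bullet> (g y *v dv2 (up P) y)"
proof -
  have sm: "Cinf_on U (up P)"
    unfolding up_def[abs_def] by (intro all_smooth P_smooth)
  have eq: "(h y ** P y) *v Y y = up P y *v (g y *v Y y)" if "y \<in> U" for y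
    using that by (simp add: up_def matrix_distrib h_cancel)
  have c: "cov e (\<lambda>y. (h y ** P y) *v Y y) y = nab e (up P) y *v (g y *v Y y) + up P y *v (g y *v (A y *v e))" for e
  proof -
    have "cov e (\<lambda>y. (h y ** P y) *v Y y) y = cov e (\<lambda>y. up P y *v (g y *v Y y)) y"
      by (rule cov_cong[OF y eq])
    then show ?thesis
      using y sm
      by (simp add: cov_def nab_def ddU all_smooth dd_g A_apply matrix_distrib algebra_simps)
  qed
  have "trace (up P y ** g y ** A y) = 0"
  proof -
    have "trace (up P y ** g y ** A y) = trace (transpose (up P y ** (g y ** A y)))"
      by (simp add: matrix_mul_assoc trace_def transpose_def)
    also have "\<dots> = - trace (g y ** A y ** up P y)"
      using y by (simp add: matrix_distrib up_def h_sym g_sym P_sym A_skew trace_def sum_negf)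
    also have "\<dots> = - trace (up P y ** g y ** A y)"
      using trace_mul_sym[of "g y ** A y" "up P y"] by (simp add: matrix_mul_assoc)
    finally show ?thesis by simp
  qed
  then have "tr (\<lambda>e. up P y *v (g y *v (A y *v e))) = 0"
    by (simp add: trace_eq_tr matrix_vector_mul_assoc matrix_mul_assoc)
  then show ?thesis
    using g_form_sym[OF y, of "Y y" "dv2 (up P) y"]
    by (simp add: dv_def c tr_add dv2_inner)
qed

lemma cov_X_X_div_P:
  assumes y: "y \<in> U"
  shows "\<mu> y *\<^sub>R cov (X y) X y = - dv2 (up P) y - (X0 y \<bullet> (g y *v dv2 (up P) y)) *\<^sub>R X y"
  by (subst form_div_P(1)[OF y]) (simp add: div_P[OF y])

text \<open>The exterior derivative of the lowered \<open>Y\<close>, see \<open>F_eq\<close>: its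
  two terms are covariant derivatives of \<open>Y\<close>, equal by skewness. The sign is negative
  because the entry \<open>i, j\<close> of \<open>g A\<close> is the derivative of the
  \<open>i\<close>-th lowered component along \<open>j\<close>.\<close>

definition F :: "real^'n \<Rightarrow> real^'n^'n" where
  "F y = -2 *\<^sub>R (g y ** A y)"

lemma h_F: "y \<in> U \<Longrightarrow> h y ** F y = -2 *\<^sub>R A y"
  by (simp add: F_def matrix_distrib hg)

text \<open>These three facts characterize the projection of the divergence of \<open>P\<close> onto
  the complement of the frame. The \<open>F\<close> term is the \<open>2 r A X0\<close> of
  \<open>cov_X_X\<close>, since \<open>h F = -2 A\<close> and
  \<open>\<mu> r = \<rho>\<close>.\<close>

lemma cov_X0_X0:
  assumes y: "y \<in> U"
  shows "dv2 (up P) y - (\<rho> y *\<^sub>R (h y ** F y *v X0 y) - \<mu> y *\<^sub>R cov (X0 y) X0 y) \<in> span {X0 y, Y y}"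
    and "X0 y \<bullet> (g y *v (\<rho> y *\<^sub>R (h y ** F y *v X0 y) - \<mu> y *\<^sub>R cov (X0 y) X0 y)) = 0"
    and "Y y \<bullet> (g y *v (\<rho> y *\<^sub>R (h y ** F y *v X0 y) - \<mu> y *\<^sub>R cov (X0 y) X0 y)) = 0"
proof -
  have "dv2 (up P) y - (\<rho> y *\<^sub>R (h y ** F y *v X0 y) - \<mu> y *\<^sub>R cov (X0 y) X0 y)
     = - (dv (\<lambda>y. \<mu> y *\<^sub>R X0 y) y *\<^sub>R X y) - (\<mu> y * dd (X y) r y) *\<^sub>R Y y"
    by (simp add: div_P[OF y] cov_X_X[OF y] h_F[OF y] matrix_distrib algebra_simps \<mu>_r[OF y, symmetric])
  also have "\<dots> \<in> span {X0 y, Y y}"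
    unfolding X_def by (intro span_diff span_neg span_scale span_add span_base) auto
  finally show "dv2 (up P) y - (\<rho> y *\<^sub>R (h y ** F y *v X0 y) - \<mu> y *\<^sub>R cov (X0 y) X0 y) \<in> span {X0 y, Y y}" .
  show "X0 y \<bullet> (g y *v (\<rho> y *\<^sub>R (h y ** F y *v X0 y) - \<mu> y *\<^sub>R cov (X0 y) X0 y)) = 0"
    "Y y \<bullet> (g y *v (\<rho> y *\<^sub>R (h y ** F y *v X0 y) - \<mu> y *\<^sub>R cov (X0 y) X0 y)) = 0"
    using frame_products[OF y] by (simp_all add: h_F[OF y] matrix_distrib inner_diff_right)
qed

text \<open>The \<open>\<Gamma>\<close> terms cancel by symmetry, so partial derivatives may be
  replaced by covariant ones.\<close>

lemma F_eq:
  assumes y: "y \<in> U"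
  shows "F y $ i $ j = dd (axis i 1) (\<lambda>y. (g y *v Y y) $ j) y - dd (axis j 1) (\<lambda>y. (g y *v Y y) $ i) y"
proof -
  have d: "dd u (\<lambda>y. (g y *v Y y) $ k) y = (transpose (\<Gamma> u y) ** g y *v Y y + g y *v (A y *v u)) $ k" for u k
    using y by (simp add: dd_nth ddU all_smooth dd_g A_apply cov_def matrix_distrib algebra_simps)
  have e: "axis k 1 \<bullet> v = v $ k" for k and v :: "real^'n"
    by (simp add: inner_axis')
  have "(transpose (\<Gamma> (axis i 1) y) ** g y *v Y y) $ j = (transpose (\<Gamma> (axis j 1) y) ** g y *v Y y) $ i"
    using inner_matrix_vector[of "axis j 1" "transpose (\<Gamma> (axis i 1) y)" "g y *v Y y"]
      inner_matrix_vector[of "axis i 1" "transpose (\<Gamma> (axis j 1) y)" "g y *v Y y"] \<Gamma>_sym[OF y, of "axis i 1" "axis j 1"]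
    by (simp add: e matrix_vector_mul_assoc del: transpose_matrix_vector)
  moreover have "(g y *v (A y *v axis j 1)) $ i = (g y ** A y) $ i $ j" for i j
    unfolding matrix_vector_mul_assoc by (simp add: matrix_vector_mult_basis column_def)
  moreover have "(g y ** A y) $ j $ i = - (g y ** A y) $ i $ j"
  proof -
    have "transpose (g y ** A y) = - (g y ** A y)"
      using y by (simp add: matrix_distrib g_sym A_skew)
    then have "transpose (g y ** A y) $ i $ j = - (g y ** A y) $ i $ j" by simp
    then show ?thesis by (simp add: transpose_def)
  qed
  ultimately show ?thesis by (simp add: d F_def)
qed

section \<open>Divergence and square of \<open>F\<close>\<close>

lemma up_F: "y \<in> U \<Longrightarrow> up F y = -2 *\<^sub>R (A y ** h y)"
  by (simp add: up_def F_def matrix_distrib hg)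

lemma F_smooth: "Cinf_on U F"
  unfolding F_def[abs_def] by (intro smooth A_smooth)

text \<open>By \<open>nab_A\<close> the covariant derivative of the raised \<open>F\<close> is, up
  to the factor -2, the raised curvature \<open>R(e, Y)\<close>, whose trace is the Ricci
  tensor.\<close>

lemma div_F:
  assumes y: "y \<in> U"
  shows "dv2 (up F) y = -2 *\<^sub>R (h y *v (Ric y *v Y y))"
proof -
  have "nab e (\<lambda>y. -2 *\<^sub>R (A y ** h y)) y = -2 *\<^sub>R (Riem e (Y y) y ** h y)" for e
    using y by (simp add: nab_def ddU smooth A_smooth dd_h nab_A[OF y, symmetric] matrix_distrib algebra_simps)
  then have "dv2 (up F) y \<bullet> z = -2 * tr (\<lambda>e. Riem e (Y y) y *v (h y *v z))" for z
    by (simp add: dv2_cong[OF y up_F] dv2_inner tr_scaleR[symmetric] matrix_distrib)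
  also have "\<dots> z = (-2 *\<^sub>R (h y *v (Ric y *v Y y))) \<bullet> z" for z
    using form_sym[OF Ric_sym[OF y], of "Y y" "h y *v z"] inner_matrix_vector[of "Ric y *v Y y" "h y" z] y
    by (simp add: Ric_form[symmetric] h_sym inner_commute del: transpose_matrix_vector)
  finally show ?thesis
    by (intro vector_eq_rdot[where 'a="real^'n", THEN iffD1] allI)
qed

text \<open>Skewness of \<open>A\<close> turns the square of \<open>F\<close> into
  \<open>-4 tr(A A)\<close>, to which \<open>Ric_Y_Y\<close> applies.\<close>

lemma norm_F:
  assumes y: "y \<in> U"
  shows "(\<Sum>k\<in>UNIV. \<Sum>l\<in>UNIV. F y $ k $ l * up F y $ k $ l) = 4 * (Y y \<bullet> (Ric y *v Y y))"
proof -
  have "(\<Sum>k\<in>UNIV. \<Sum>l\<in>UNIV. F y $ k $ l * up F y $ k $ l) = trace (transpose (F y) ** up F y)"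
    by (subst sum.swap) (simp add: trace_def matrix_matrix_mult_def transpose_def)
  also have "\<dots> = trace (-4 *\<^sub>R (g y ** A y ** A y ** h y))"
    using y by (simp add: up_F F_def matrix_distrib A_skew g_sym)
  also have "\<dots> = -4 * trace (g y ** (A y ** A y ** h y))"
    by (simp add: trace_def sum_distrib_left sum_negf matrix_mul_assoc)
  also have "\<dots> = -4 * trace (A y ** A y)"
    using y by (subst trace_mul_sym) (simp add: h_cancel)
  finally show ?thesis by (simp add: Ric_Y_Y[OF y])
qed

lemma div_F_source:
  assumes y: "y \<in> U"
  shows "dv2 (up F) y = \<rho> y *\<^sub>R X0 y + ((1/2) * (\<Sum>k\<in>UNIV. \<Sum>l\<in>UNIV. F y $ k $ l * up F y $ k $ l)) *\<^sub>R Y y - (h y ** P y) *v Y y"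
proof -
  have gX: "(g y *v X y) \<bullet> Y y = - r y" "(g y *v Y y) \<bullet> Y y = -1"
    using frame_products(7)[OF y] Y_norm[OF y] by (simp_all add: inner_commute)
  have "(h y ** P y) *v Y y = h y *v (Grav y *v Y y) + (\<mu> y * r y) *\<^sub>R X y + \<sigma> y *\<^sub>R Y y"
    using y by (simp add: P_def matrix_vector_mul_assoc[symmetric] matrix_vector_mult_diff_rdistrib
      bounded_bilinear.scaleR_left[OF bounded_bilinear_matrix_vector] outer_mult_vec gX)
      (simp add: matrix_distrib h_cancel hg)
  also have "h y *v (Grav y *v Y y) = 2 *\<^sub>R (h y *v (Ric y *v Y y)) - Scal y *\<^sub>R Y y"
    using y by (simp add: Grav_def matrix_distrib hg algebra_simps)
  finally have 1: "(h y ** P y) *v Y y = 2 *\<^sub>R (h y *v (Ric y *v Y y)) - Scal y *\<^sub>R Y y + \<rho> y *\<^sub>R X y + \<sigma> y *\<^sub>R Y y"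
    by (simp add: \<mu>_r[OF y])
  \<comment> \<open>The \<open>(Y, Y)\<close> entry of \<open>Grav\<close>; here
    \<open>g(Y, Y) = -1\<close> gives \<open>Scal\<close> a positive sign, so that it cancels
    against the one in \<open>1\<close>.\<close>
  have "\<sigma> y + \<rho> y * r y = 2 * (Y y \<bullet> (Ric y *v Y y)) + Scal y"
    using \<sigma>_eq[OF y] Y_norm[OF y] by (simp add: Grav_def matrix_distrib inner_diff_right)
  then have 2: "\<sigma> y = 2 * (Y y \<bullet> (Ric y *v Y y)) + Scal y - \<rho> y * r y" by simp
  show ?thesis
    unfolding div_F[OF y] norm_F[OF y] 1 2 by (simp add: X_def algebra_simps)
qed

end

section \<open>Tensor calculus in a chart\<close>

lemma form_inner: "form B u v = u \<bullet> (B *v v)"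
  by (simp add: form_def inner_vec_def matrix_vector_mult_def sum_distrib_left mult_ac)

lemma flat_eq: "flat g Z c x = g c x *v Z c x"
  by (simp add: flat_def matrix_vector_mult_def vec_eq_iff)

lemma sum_axis: "(\<Sum>i\<in>UNIV. axis k 1 $ i * f i) = f k" for f :: "'n::finite \<Rightarrow> real"
  by (simp add: axis_def if_distrib[of "\<lambda>t. t * _"] cong: if_cong)

locale riemannian_chart =
  fixes D :: "('d::topological_space, real^'n::finite) chart set" and c and g :: "('d, 'n) tensor2"
  assumes D: "smooth_manifold CARD('n) D" and c: "c \<in> D" and g: "pseudo_riemannian D g"
begin

definition U :: "(real^'n) set" where
  "U = snd c ` fst c"

definition gc :: "real^'n \<Rightarrow> real^'n^'n" where
  "gc y = g c (chart_inv c y)"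

text \<open>The upper index labels the rows and the first lower one is contracted with
  \<open>u\<close>, as \<open>metric_connection\<close> expects.\<close>

definition Gc :: "real^'n \<Rightarrow> real^'n \<Rightarrow> real^'n^'n" where
  "Gc u y = (\<chi> k j. \<Sum>i\<in>UNIV. u $ i * christoffel g c (chart_inv c y) k i j)"

text \<open>The model subspace has full dimension and is therefore the whole space.\<close>

lemma U_open: "open U"
proof -
  obtain E :: "(real^'n) set" where E: "subspace E" "dim E = CARD('n)"
    and op: "openin (top_of_set E) (snd c ` fst c)"
    using D c by (auto simp: smooth_manifold_def)
  have "E = UNIV"
    using E dim_eq_full[of E] span_eq_iff[of E] by simp
  then show ?thesis using op by (simp add: U_def)
qed

lemma chart_homeo: "open (fst c)" "homeomorphism (fst c) U (snd c) (chart_inv c)"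
  using D c unfolding smooth_manifold_def U_def by blast+

lemma chart_inv_in: "y \<in> U \<Longrightarrow> chart_inv c y \<in> fst c"
  using chart_homeo(2) by (auto simp: homeomorphism_def)

lemma chart_inv: "y \<in> U \<Longrightarrow> snd c (chart_inv c y) = y" "x \<in> fst c \<Longrightarrow> chart_inv c (snd c x) = x"
  using chart_homeo(2) by (auto simp: homeomorphism_def)

lemma chart_in: "x \<in> fst c \<Longrightarrow> snd c x \<in> U"
  by (simp add: U_def)

lemma partial_eq: "x \<in> fst c \<Longrightarrow> partial c i f x = dd (axis i 1) (\<lambda>y. f (chart_inv c y)) (snd c x)"
  by (simp add: partial_def dd_def o_def)

lemma gc_smooth: "Cinf_on U gc"
  using g c smooth_on_open[OF U_open, of "g c \<circ> chart_inv c"]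
  by (simp add: pseudo_riemannian_def smooth_bilinear_field_def U_def gc_def[abs_def] o_def)

lemma gc_sym: "y \<in> U \<Longrightarrow> transpose (gc y) = gc y" and gc_inv: "y \<in> U \<Longrightarrow> invertible (gc y)"
  using g c chart_inv_in by (auto simp: pseudo_riemannian_def gc_def)

lemma christoffel_smooth: "Cinf_on U (\<lambda>y. christoffel g c (chart_inv c y) k i j)"
proof -
  have s: "Cinf_on U (\<lambda>y. gc y $ i $ j)" for i j
    by (intro Cinf_on_nth[OF U_open] gc_smooth)
  have "Cinf_on U (\<lambda>y. (1/2) * (\<Sum>l\<in>UNIV. matrix_inv (gc y) $ k $ l *
     (dd (axis i 1) (\<lambda>y. gc y $ j $ l) y + dd (axis j 1) (\<lambda>y. gc y $ i $ l) y - dd (axis l 1) (\<lambda>y. gc y $ i $ j) y)))"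
    by (intro Cinf_on_mult[OF U_open] Cinf_on_const[OF U_open] Cinf_on_sum[OF U_open] Cinf_on_nth[OF U_open]
        Cinf_on_matrix_inv[OF U_open gc_smooth gc_inv] Cinf_on_diff[OF U_open] Cinf_on_add[OF U_open] Cinf_on_dd s)
  then show ?thesis
    by (subst Cinf_on_cong[OF U_open])
      (auto simp: christoffel_def partial_eq chart_inv chart_inv_in ginv_def gc_def)
qed

lemma Gc_smooth: "Cinf_on U (Gc u)"
  unfolding Gc_def[abs_def]
  by (intro Cinf_on_vec[OF U_open] Cinf_on_sum[OF U_open] Cinf_on_mult[OF U_open] Cinf_on_const[OF U_open] christoffel_smooth)

lemma Gc_axis: "Gc (axis i 1) y $ k $ j = christoffel g c (chart_inv c y) k i j"
  by (simp add: Gc_def sum_axis)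

lemma Gc_linear: "linear (\<lambda>u. Gc u y)"
  by (intro linearI) (simp_all add: Gc_def vec_eq_iff algebra_simps sum.distrib sum_distrib_left)

lemma Gc_sym:
  assumes y: "y \<in> U"
  shows "Gc u y *v v = Gc v y *v u"
proof -
  have s: "christoffel g c (chart_inv c y) k i j = christoffel g c (chart_inv c y) k j i" for k i j
    using christoffel_iff[OF D c chart_inv_in[OF y] g, of "christoffel g c (chart_inv c y)"] by blast
  have "(Gc u y *v v) $ k = (\<Sum>j\<in>UNIV. \<Sum>i\<in>UNIV. u $ i * christoffel g c (chart_inv c y) k i j * v $ j)" for k
    by (simp add: Gc_def matrix_vector_mult_def sum_distrib_right)
  moreover have "(Gc v y *v u) $ k = (\<Sum>j\<in>UNIV. \<Sum>i\<in>UNIV. v $ i * christoffel g c (chart_inv c y) k j i * u $ j)" for k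
    by (simp add: Gc_def matrix_vector_mult_def sum_distrib_right s)
  moreover have "(\<Sum>j\<in>UNIV. \<Sum>i\<in>UNIV. u $ i * christoffel g c (chart_inv c y) k i j * v $ j)
    = (\<Sum>j\<in>UNIV. \<Sum>i\<in>UNIV. v $ i * christoffel g c (chart_inv c y) k j i * u $ j)" for k
    by (subst sum.swap) (simp add: mult_ac)
  ultimately show ?thesis by (simp add: vec_eq_iff)
qed

lemma dd_gc:
  assumes y: "y \<in> U"
  shows "dd u gc y = transpose (Gc u y) ** gc y + gc y ** Gc u y"
proof -
  have diff: "gc differentiable (at y)"
    by (rule Cinf_on_differentiable[OF gc_smooth y])
  have a: "dd (axis m 1) gc y = transpose (Gc (axis m 1) y) ** gc y + gc y ** Gc (axis m 1) y" for m
  proof -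
    have "partial c m (\<lambda>z. g c z $ i $ j) (chart_inv c y)
      = (\<Sum>k\<in>UNIV. christoffel g c (chart_inv c y) k m i * g c (chart_inv c y) $ k $ j)
        + (\<Sum>k\<in>UNIV. christoffel g c (chart_inv c y) k m j * g c (chart_inv c y) $ i $ k)" for i j
      using christoffel_iff[OF D c chart_inv_in[OF y] g, of "christoffel g c (chart_inv c y)"] by blast
    moreover have "partial c m (\<lambda>z. g c z $ i $ j) (chart_inv c y) = dd (axis m 1) gc y $ i $ j" for i j
    proof -
      have "(\<lambda>y. gc y $ i) differentiable (at y)"
        using Cinf_on_differentiable[OF Cinf_on_nth[OF U_open gc_smooth] y] .
      then show ?thesis
        using y diff by (simp add: partial_eq chart_inv_in chart_inv gc_def[symmetric] dd_nth)
    qed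
    ultimately show ?thesis
      by (simp add: vec_eq_iff matrix_matrix_mult_def transpose_def Gc_axis gc_def mult.commute)
  qed
  have "dd u gc y = (\<Sum>m\<in>UNIV. u $ m *\<^sub>R dd (axis m 1) gc y)"
    by (rule linear_expansion[OF linear_dd[OF diff]])
  also have "\<dots> = (\<Sum>m\<in>UNIV. u $ m *\<^sub>R (transpose (Gc (axis m 1) y) ** gc y + gc y ** Gc (axis m 1) y))"
    by (simp add: a)
  also have "\<dots> = transpose (Gc u y) ** gc y + gc y ** Gc u y"
  proof -
    have "linear (\<lambda>u. transpose (Gc u y) ** gc y + gc y ** Gc u y)"
      by (intro linearI) (simp_all add: linear_add[OF Gc_linear] linear_scale[OF Gc_linear] matrix_distrib algebra_simps)
    from linear_expansion[OF this, of u] show ?thesis ..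
  qed
  finally show ?thesis .
qed

sublocale metric_connection U gc Gc
  by (rule metric_connection.intro) (rule U_open gc_smooth gc_sym gc_inv Gc_smooth Gc_linear Gc_sym dd_gc; assumption?)+

section \<open>Dictionary between chart components and matrix calculus\<close>

lemma ginv_eq: "x \<in> fst c \<Longrightarrow> ginv g c x = h (snd c x)"
  by (simp add: ginv_def h_def gc_def chart_inv)

lemma endo_eq: "x \<in> fst c \<Longrightarrow> endo g B c x = h (snd c x) ** B c x"
  by (simp add: endo_def matrix_matrix_mult_def ginv_eq vec_eq_iff)

lemma raise_eq:
  assumes "x \<in> fst c"
  shows "raise g T c x = h (snd c x) ** T c x ** h (snd c x)"
proof -
  have "h (snd c x) $ j $ l = h (snd c x) $ l $ j" for j l
    using arg_cong[OF h_sym[OF chart_in[OF assms]], of "\<lambda>M. M $ l $ j"] by (simp add: transpose_def)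
  then have "raise g T c x $ i $ j = (\<Sum>k\<in>UNIV. \<Sum>l\<in>UNIV. h (snd c x) $ i $ k * T c x $ k $ l * h (snd c x) $ l $ j)" for i j
    using assms by (simp add: raise_def ginv_eq mult_ac)
  also have "\<dots> i j = (h (snd c x) ** T c x ** h (snd c x)) $ i $ j" for i j
    by (subst sum.swap) (simp add: matrix_matrix_mult_def sum_distrib_right)
  finally show ?thesis by (simp add: vec_eq_iff)
qed

lemma nabla_vec_eq:
  assumes x: "x \<in> fst c" and Z: "Cinf_on U (\<lambda>y. Z c (chart_inv c y))"
  shows "nabla_vec g Z c x i j = cov (axis i 1) (\<lambda>y. Z c (chart_inv c y)) (snd c x) $ j"
  using x Cinf_on_differentiable[OF Z chart_in[OF x]]
  by (simp add: nabla_vec_def cov_def partial_eq dd_nth matrix_vector_mult_def Gc_axis chart_inv)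

lemma covariant_eq:
  assumes x: "x \<in> fst c" and Z: "Cinf_on U (\<lambda>y. Z c (chart_inv c y))"
  shows "covariant g V Z c x = cov (V c x) (\<lambda>y. Z c (chart_inv c y)) (snd c x)"
  using linear_expansion[OF cov_linear[OF chart_in[OF x] Z], of "V c x"]
  by (simp add: covariant_def nabla_vec_eq[of x Z, OF assms] vec_eq_iff)

lemma div_vec_eq:
  assumes x: "x \<in> fst c" and Z: "Cinf_on U (\<lambda>y. Z c (chart_inv c y))"
  shows "div_vec g Z c x = dv (\<lambda>y. Z c (chart_inv c y)) (snd c x)"
  by (simp add: div_vec_def nabla_vec_eq[of x Z, OF assms] dv_def tr_def)

lemma directional_eq:
  assumes x: "x \<in> fst c" and f: "Cinf_on U (\<lambda>y. f c (chart_inv c y))"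
  shows "directional V f c x = dd (V c x) (\<lambda>y. f c (chart_inv c y)) (snd c x)"
  using linear_expansion[OF linear_dd[OF Cinf_on_differentiable[OF f chart_in[OF x]]], of "V c x"] x
  by (simp add: directional_def partial_eq)

lemma nabla_raised_eq:
  assumes x: "x \<in> fst c" and T: "Cinf_on U (\<lambda>y. T c (chart_inv c y))"
  shows "nabla_raised g T c x m i j = nab (axis m 1) (up (\<lambda>y. T c (chart_inv c y))) (snd c x) $ i $ j"
proof -
  let ?T = "up (\<lambda>y. T c (chart_inv c y))" and ?y = "snd c x"
  have y: "?y \<in> U" by (rule chart_in[OF x])
  have T_up: "Cinf_on U ?T"
    unfolding up_def[abs_def] by (intro smooth T)
  have r: "raise g T c (chart_inv c y) = ?T y" if "y \<in> U" for y
    using raise_eq[OF chart_inv_in[OF that]] that by (simp add: up_def chart_inv)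
  have "partial c m (\<lambda>y. raise g T c y $ i $ j) x = dd (axis m 1) (\<lambda>y. ?T y $ i $ j) ?y"
    unfolding partial_eq[OF x] by (rule dd_cong[OF U_open y]) (simp add: r)
  also have "\<dots> = dd (axis m 1) ?T ?y $ i $ j"
    using Cinf_on_differentiable[OF T_up y] Cinf_on_differentiable[OF Cinf_on_nth[OF U_open T_up] y]
    by (simp add: dd_nth)
  finally show ?thesis
    using r[OF y] x
    by (simp add: nabla_raised_def nab_def matrix_matrix_mult_def transpose_def Gc_axis chart_inv mult.commute)
qed

lemma div_tensor_eq:
  assumes x: "x \<in> fst c" and T: "Cinf_on U (\<lambda>y. T c (chart_inv c y))"
  shows "div_tensor g T c x = dv2 (up (\<lambda>y. T c (chart_inv c y))) (snd c x)"
  by (simp add: div_tensor_def dv2_def nabla_raised_eq[of x T, OF assms])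

lemma ricci_eq:
  assumes x: "x \<in> fst c"
  shows "ricci g c x = Ric (snd c x)"
proof -
  have y: "snd c x \<in> U" by (rule chart_in[OF x])
  have p: "partial c a (\<lambda>y. christoffel g c y k i j) x = dd (axis a 1) (Gc (axis i 1)) (snd c x) $ k $ j" for a k i j
  proof -
    have "partial c a (\<lambda>y. christoffel g c y k i j) x = dd (axis a 1) (\<lambda>y. Gc (axis i 1) y $ k $ j) (snd c x)"
      by (simp add: partial_eq[OF x] Gc_axis)
    then show ?thesis
      using Cinf_on_differentiable[OF Gc_smooth y] Cinf_on_differentiable[OF Cinf_on_nth[OF U_open Gc_smooth] y]
      by (simp add: dd_nth)
  qed
  have "ricci g c x $ j $ k = Ric (snd c x) $ j $ k" for j k
    using x by (simp add: ricci_def Ric_def tr_def matrix_vector_mult_basis column_def Riem_def p matrix_matrix_mult_def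
      Gc_axis chart_inv sum_subtractf sum.distrib algebra_simps)
  then show ?thesis by (simp add: vec_eq_iff)
qed

lemma gravity_eq:
  assumes x: "x \<in> fst c"
  shows "gravity g c x = Grav (snd c x)"
proof -
  have "Ric (snd c x) $ j $ k = Ric (snd c x) $ k $ j" for j k
    using arg_cong[OF Ric_sym[OF chart_in[OF x]], of "\<lambda>M. M $ k $ j"] by (simp add: transpose_def)
  then have "scalar_curvature g c x = Scal (snd c x)"
    using x by (simp add: scalar_curvature_def Scal_def ricci_eq ginv_eq trace_def matrix_matrix_mult_def)
  then show ?thesis
    using x by (simp add: gravity_def Grav_def ricci_eq gc_def chart_inv)
qed

lemma vector_field_smooth: "smooth_vector_field D Z \<Longrightarrow> Cinf_on U (\<lambda>y. Z c (chart_inv c y))"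
  using c smooth_on_open[OF U_open, of "Z c \<circ> chart_inv c"]
  by (simp add: smooth_vector_field_def U_def o_def)

lemma function_smooth: "smooth_function D f \<Longrightarrow> Cinf_on U (\<lambda>y. f (chart_inv c y))"
  using c smooth_on_open[OF U_open, of "f \<circ> chart_inv c"]
  by (simp add: smooth_function_def U_def o_def)

lemma killing_equation:
  assumes Z: "Cinf_on U (\<lambda>y. Z c (chart_inv c y))" and K: "killing D g Z" and y: "y \<in> U"
  defines "Z' \<equiv> \<lambda>y. Z c (chart_inv c y)"
  shows "dd (Z' y) gc y + transpose (deriv_matrix Z' y) ** gc y + gc y ** deriv_matrix Z' y = 0"
proof -
  let ?x = "chart_inv c y"
  have x: "?x \<in> fst c" by (rule chart_inv_in[OF y])
  have gd: "gc differentiable (at y)" by (rule Cinf_on_differentiable[OF gc_smooth y])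
  have pg: "partial c k (\<lambda>z. g c z $ i $ j) ?x = dd (axis k 1) gc y $ i $ j" for k i j
    using gd Cinf_on_differentiable[OF Cinf_on_nth[OF U_open gc_smooth] y] y
    by (simp add: partial_eq[OF x] chart_inv gc_def[symmetric] dd_nth)
  have pZ: "partial c i (\<lambda>z. Z c z $ k) ?x = deriv_matrix Z' y $ k $ i" for i k
    using Cinf_on_differentiable[OF Z y] y
    by (simp add: partial_eq[OF x] chart_inv dd_nth deriv_matrix_def Z'_def)
  have e: "dd (Z' y) gc y = (\<Sum>k\<in>UNIV. Z' y $ k *\<^sub>R dd (axis k 1) gc y)"
    by (rule linear_expansion[OF linear_dd[OF gd]])
  have "lie_metric Z g c ?x $ i $ j = 0" for i j
    using K c x by (simp add: killing_def)
  then have "(dd (Z' y) gc y + transpose (deriv_matrix Z' y) ** gc y + gc y ** deriv_matrix Z' y) $ i $ j = 0" for i j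
    unfolding e by (simp add: lie_metric_def pg pZ sum.distrib matrix_matrix_mult_def transpose_def gc_def[symmetric]
      mult.commute) (simp add: Z'_def)
  then show ?thesis by (simp add: vec_eq_iff)
qed

text \<open>Chart representatives are often known on \<open>U\<close> alone, because
  \<open>chart_inv\<close> is arbitrary outside it. This rule and the next three replace them by
  globally defined functions agreeing on \<open>U\<close>.\<close>

lemma div_vec_cong:
  assumes x: "x \<in> fst c" and Z: "Cinf_on U Z'" "\<And>y. y \<in> U \<Longrightarrow> Z c (chart_inv c y) = Z' y"
  shows "div_vec g Z c x = dv Z' (snd c x)"
proof -
  have "Cinf_on U (\<lambda>y. Z c (chart_inv c y))"
    using Z by (subst Cinf_on_cong[OF U_open Z(2)])
  then show ?thesis
    using div_vec_eq[OF x, of Z] dv_cong[OF chart_in[OF x] Z(2)] by simp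
qed

lemma covariant_cong:
  assumes x: "x \<in> fst c" and Z: "Cinf_on U Z'" "\<And>y. y \<in> U \<Longrightarrow> Z c (chart_inv c y) = Z' y"
  shows "covariant g V Z c x = cov (V c x) Z' (snd c x)"
proof -
  have "Cinf_on U (\<lambda>y. Z c (chart_inv c y))"
    using Z by (subst Cinf_on_cong[OF U_open Z(2)])
  then show ?thesis
    using covariant_eq[OF x, of Z] cov_cong[OF chart_in[OF x] Z(2)] by simp
qed

lemma directional_cong:
  assumes x: "x \<in> fst c" and f: "Cinf_on U f'" "\<And>y. y \<in> U \<Longrightarrow> f c (chart_inv c y) = f' y"
  shows "directional V f c x = dd (V c x) f' (snd c x)"
proof -
  have "Cinf_on U (\<lambda>y. f c (chart_inv c y))"
    using f by (subst Cinf_on_cong[OF U_open f(2)])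
  then show ?thesis
    using directional_eq[OF x, of f] dd_cong[OF U_open chart_in[OF x] f(2)] by simp
qed

lemma div_tensor_cong:
  assumes x: "x \<in> fst c" and T: "Cinf_on U T'" "\<And>y. y \<in> U \<Longrightarrow> T c (chart_inv c y) = T' y"
  shows "div_tensor g T c x = dv2 (up T') (snd c x)"
proof -
  have "Cinf_on U (\<lambda>y. T c (chart_inv c y))"
    using T by (subst Cinf_on_cong[OF U_open T(2)])
  moreover have "dv2 (up (\<lambda>y. T c (chart_inv c y))) (snd c x) = dv2 (up T') (snd c x)"
    by (rule dv2_cong[OF chart_in[OF x]]) (simp add: up_def T(2))
  ultimately show ?thesis
    using div_tensor_eq[OF x, of T] by simp
qed

end

section \<open>Observation atlases in a chart\<close>

context
  fixes B :: "'v::euclidean_space \<Rightarrow> 'v \<Rightarrow> real" and V :: "'v set" and r s :: nat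
  assumes B_linear: "\<And>u. linear (B u)" "\<And>v. linear (\<lambda>u. B u v)" and sig: "has_signature B V r s"
begin

lemma signature_basis:
  obtains S where "finite S" "independent S" "span S = V" "card S = r + s"
    "\<And>u v. u \<in> S \<Longrightarrow> v \<in> S \<Longrightarrow> u \<noteq> v \<Longrightarrow> B u v = 0" "\<And>u. u \<in> S \<Longrightarrow> B u u \<noteq> 0"
proof -
  obtain N P where NP: "finite N" "finite P" "card N = r" "card P = s" "N \<inter> P = {}"
    "independent (N \<union> P)" "span (N \<union> P) = V" "\<forall>u\<in>N \<union> P. \<forall>v\<in>N \<union> P. u \<noteq> v \<longrightarrow> B u v = 0"
    "\<forall>u\<in>N. B u u = -1" "\<forall>u\<in>P. B u u = 1"
    using sig unfolding has_signature_def by blast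
  show thesis
  proof (rule that[of "N \<union> P"])
    show "card (N \<union> P) = r + s" using NP card_Un_disjoint by blast
    show "B u u \<noteq> 0" if "u \<in> N \<union> P" for u using NP(9,10) that by force
  qed (use NP in auto)
qed

lemma signature_dim: "dim V = r + s" and signature_subspace: "subspace V"
proof -
  obtain S where "independent S" "span S = V" "card S = r + s"
    using signature_basis by blast
  then show "dim V = r + s" "subspace V"
    using dim_span_eq_card_independent[of S] subspace_span[of S] by auto
qed

lemma signature_sum:
  assumes S: "finite S" "\<And>u v. u \<in> S \<Longrightarrow> v \<in> S \<Longrightarrow> u \<noteq> v \<Longrightarrow> B u v = 0" "e \<in> S"
  shows "B (\<Sum>u\<in>S. a u *\<^sub>R u) e = a e * B e e"
proof -
  have "B (\<Sum>u\<in>S. a u *\<^sub>R u) e = (\<Sum>u\<in>S. a u * B u e)"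
    by (simp add: linear_sum[OF B_linear(2)] linear_scale[OF B_linear(2)])
  also have "\<dots> = (\<Sum>u\<in>S. if u = e then a e * B e e else 0)"
    using S by (intro sum.cong) auto
  finally show ?thesis using S by simp
qed

text \<open>Fourier coefficients in an orthogonal basis of \<open>V\<close>, divided by
  \<open>B e e\<close> because the form may be indefinite.\<close>

lemma signature_projection: "\<exists>u\<in>V. \<forall>v\<in>V. B (z - u) v = 0"
proof -
  obtain S where S: "finite S" "span S = V" "\<And>u v. u \<in> S \<Longrightarrow> v \<in> S \<Longrightarrow> u \<noteq> v \<Longrightarrow> B u v = 0"
    "\<And>u. u \<in> S \<Longrightarrow> B u u \<noteq> 0"
    using signature_basis by blast
  define u where "u = (\<Sum>e\<in>S. (B z e / B e e) *\<^sub>R e)"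
  have "B (z - u) e = 0" if "e \<in> S" for e
    using signature_sum[OF S(1) S(3) that, of "\<lambda>e. B z e / B e e"] S(4)[OF that]
    by (simp add: linear_diff[OF B_linear(2)] u_def)
  then have "B (z - u) v = 0" if "v \<in> V" for v
    using linear_eq_0_on_span[OF B_linear(1), of S "z - u" v] that S(2) by auto
  moreover have "u \<in> V"
    unfolding u_def S(2)[symmetric] by (intro span_sum span_scale span_base)
  ultimately show ?thesis by blast
qed

lemma signature_nondegenerate:
  assumes "u \<in> V" "\<And>v. v \<in> V \<Longrightarrow> B u v = 0"
  shows "u = 0"
proof -
  obtain S where S: "finite S" "span S = V" "\<And>u v. u \<in> S \<Longrightarrow> v \<in> S \<Longrightarrow> u \<noteq> v \<Longrightarrow> B u v = 0"
    "\<And>u. u \<in> S \<Longrightarrow> B u u \<noteq> 0"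
    using signature_basis by blast
  then obtain a where a: "u = (\<Sum>e\<in>S. a e *\<^sub>R e)"
    using assms(1) span_finite[of S] by auto
  have "a e = 0" if "e \<in> S" for e
    using signature_sum[OF S(1) S(3) that, of a] S(4)[OF that] assms(2)[of e] that S(2) span_base
    by (auto simp: a)
  then show ?thesis by (simp add: a)
qed

text \<open>Nondegeneracy on \<open>V\<close> makes the projection unique, so the definite
  description in \<open>orth_proj\<close> denotes.\<close>

lemma orth_proj_iff: "orth_proj B V z = u \<longleftrightarrow> u \<in> V \<and> (\<forall>v\<in>V. B (z - u) v = 0)"
proof -
  have unique: "u = u'" if "u \<in> V" "u' \<in> V" "\<forall>v\<in>V. B (z - u) v = 0" "\<forall>v\<in>V. B (z - u') v = 0" for u u'
  proof -
    have "B (u - u') v = 0" if "v \<in> V" for v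
      using \<open>\<forall>v\<in>V. B (z - u) v = 0\<close> \<open>\<forall>v\<in>V. B (z - u') v = 0\<close> that
      by (simp add: linear_diff[OF B_linear(2)])
    then show ?thesis
      using signature_nondegenerate[of "u - u'"] subspace_diff[OF signature_subspace] that by auto
  qed
  then have "\<exists>!u. u \<in> V \<and> (\<forall>v\<in>V. B (z - u) v = 0)"
    using signature_projection by blast
  then show ?thesis
    unfolding orth_proj_def using theI'[of "\<lambda>u. u \<in> V \<and> (\<forall>v\<in>V. B (z - u) v = 0)"] unique by blast
qed

end

lemma form_linear: "linear (form M u)" "linear (\<lambda>u. form M u v)"
  by (intro linearI; simp add: form_inner matrix_distrib inner_add_left inner_add_right)+

text \<open>\<open>Arg2pi\<close> measures the angle from \<open>cis a\<close> in
  \<open>[0, 2 pi)\<close>; excluding \<open>z = cis a\<close> makes it positive, so the open arc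
  suffices.\<close>

lemma sphere_arc:
  assumes "z \<in> sphere 0 1" "z \<noteq> cis a"
  shows "z \<in> cis ` {a<..<a + 2 * pi}"
proof -
  define y where "y = z * cis (- a)"
  define t where "t = Arg2pi y"
  have "norm y = 1" using assms by (simp add: y_def norm_mult)
  then have "y = cis t" "0 \<le> t" "t < 2 * pi"
    using Arg2pi[of y] by (auto simp: is_Arg_def cis_conv_exp t_def[symmetric])
  then have t: "z * cis (- a) = cis t" "0 \<le> t" "t < 2 * pi"
    by (simp_all add: y_def)
  have z: "z = cis (a + t)"
  proof -
    have "z = z * cis (- a) * cis a" by (simp add: mult.assoc cis_mult)
    then show ?thesis by (simp add: t cis_mult add.commute)
  qed
  with assms(2) have "t \<noteq> 0" by auto
  with t z show ?thesis by (intro image_eqI[of _ _ "a + t"]) auto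
qed

lemma smooth_onE:
  assumes "smooth_on S f" "x \<in> S"
  obtains U h where "open U" "x \<in> U" "\<forall>k. Ck_on k U h" "\<forall>y\<in>U \<inter> S. h y = f y"
  using assms(1)[unfolded smooth_on_def, THEN bspec, OF assms(2)]
  by (elim exE conjE) (rule that)

lemma smooth_on_subset:
  assumes "smooth_on S f" "T \<subseteq> S"
  shows "smooth_on T f"
  unfolding smooth_on_def
proof
  fix x assume "x \<in> T"
  then have "x \<in> S" using assms(2) by (rule rev_subsetD)
  with assms(1) obtain U h where U: "open U" "x \<in> U" "\<forall>k. Ck_on k U h" "\<forall>y\<in>U \<inter> S. h y = f y"
    by (rule smooth_onE)
  have "\<forall>y\<in>U \<inter> T. h y = f y"
    by (rule ballI, rule bspec[OF U(4)]) (use assms(2) in blast)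
  with U(1-3) show "\<exists>U h. open U \<and> x \<in> U \<and> (\<forall>k. Ck_on k U h) \<and> (\<forall>y\<in>U \<inter> T. h y = f y)"
    by (intro exI conjI)
qed

section \<open>Observation charts read in a manifold chart\<close>

locale observed_chart = riemannian_chart D c g
  for D :: "('d::topological_space, real^'n::finite) chart set" and c and g +
  fixes W :: "('w::topological_space, real^'n) chart set" and Obs :: "('d, 'w) obs set" and k :: nat
  assumes W: "smooth_manifold k W" and Obs: "observation_atlas D W g Obs"
begin

definition obs_dom :: "('d, 'w) obs \<Rightarrow> (real^'n) set" where
  "obs_dom a = snd c ` (fst c \<inter> fst a)"

definition obs_proj :: "('d, 'w) obs \<Rightarrow> real^'n \<Rightarrow> real^4" where
  "obs_proj a y = fst (snd a (chart_inv c y))"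

lemma open_chart_image:
  assumes "open S"
  shows "open (snd c ` (fst c \<inter> S))"
proof -
  have "openin (top_of_set U) (snd c ` (fst c \<inter> S))"
    by (rule homeomorphism_imp_open_map[OF chart_homeo(2)]) (use assms in auto)
  then show ?thesis using U_open openin_open_eq by blast
qed

lemma obs_diffeo:
  assumes "a \<in> Obs"
  obtains \<Theta> where "open \<Theta>"
    "homeomorphism (fst a) (\<Theta> \<times> sphere 0 1 \<times> UNIV) (snd a) (inv_into (fst a) (snd a))"
    "smooth_between D (product_charts W) (fst a) (snd a)"
    "smooth_between (product_charts W) D (\<Theta> \<times> sphere 0 1 \<times> UNIV) (inv_into (fst a) (snd a))"
  using Obs assms unfolding observation_atlas_def diffeomorphism_between_def by blast

lemma obs_open: "a \<in> Obs \<Longrightarrow> open (fst a)"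
  using Obs unfolding observation_atlas_def by blast

lemma obs_dom_open: "a \<in> Obs \<Longrightarrow> open (obs_dom a)"
  unfolding obs_dom_def by (intro open_chart_image obs_open)

lemma obs_dom_sub: "obs_dom a \<subseteq> U"
  by (auto simp: obs_dom_def U_def)

lemma obs_dom_inv: "y \<in> obs_dom a \<Longrightarrow> chart_inv c y \<in> fst c \<inter> fst a"
  by (auto simp: obs_dom_def chart_inv)

text \<open>The circle factor of the chart omits the single point \<open>cis t\<close>.\<close>

lemma product_chart:
  assumes "z \<in> sphere 0 1"
  obtains t b where "cis t \<noteq> z" "b \<in> W" "w \<in> fst b" "open (fst b)"
    "(UNIV \<times> cis ` {t<..<t + 2 * pi} \<times> fst b, map_prod id (map_prod (inv_into {t<..<t + 2 * pi} cis) (snd b))) \<in> product_charts W"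
    "inj_on (map_prod (id :: real^4 \<Rightarrow> _) (map_prod (inv_into {t<..<t + 2 * pi} cis) (snd b))) (UNIV \<times> cis ` {t<..<t + 2 * pi} \<times> fst b)"
proof -
  obtain t where t: "cis t \<noteq> z"
    by (metis cis_pi cis_zero one_neq_neg_one)
  obtain b where b: "b \<in> W" "w \<in> fst b"
    using W unfolding smooth_manifold_def by blast
  then have hb: "open (fst b)" "homeomorphism (fst b) (snd b ` fst b) (snd b) (chart_inv b)"
    using W unfolding smooth_manifold_def by blast+
  let ?arc = "cis ` {t<..<t + 2 * pi}" and ?ang = "inv_into {t<..<t + 2 * pi} cis"
  have "(?arc, ?ang) \<in> circle_charts" by (auto simp: circle_charts_def)
  then have "(UNIV \<times> ?arc \<times> fst b, map_prod id (map_prod ?ang (snd b))) \<in> product_charts W"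
    using b(1) unfolding product_charts_def by (intro CollectI exI[of _ "(?arc, ?ang)"] exI[of _ b]) simp
  moreover have "inj_on ?ang ?arc" by (rule inj_on_inv_into) simp
  moreover have "inj_on (snd b) (fst b)"
    by (rule inj_on_inverseI[of _ "chart_inv b"]) (rule homeomorphism_apply1[OF hb(2)])
  ultimately show thesis
    using that[OF t b hb(1)] by (simp add: map_prod_inj_on)
qed

text \<open>A product chart is the identity on its factor \<open>real^4\<close>, so
  \<open>obs_proj a\<close> is the first component of a smooth coordinate expression.\<close>

lemma obs_proj_smooth:
  assumes a: "a \<in> Obs"
  shows "Cinf_on (obs_dom a) (obs_proj a)"
proof (rule Cinf_on_local)
  fix y assume "y \<in> obs_dom a"
  then obtain x where x: "x \<in> fst c" "x \<in> fst a" "y = snd c x"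
    by (auto simp: obs_dom_def)
  obtain \<Theta> where hom: "homeomorphism (fst a) (\<Theta> \<times> sphere 0 1 \<times> UNIV) (snd a) (inv_into (fst a) (snd a))"
    and sm: "smooth_between D (product_charts W) (fst a) (snd a)"
    using obs_diffeo[OF a] by metis
  have im: "snd a ` fst a = \<Theta> \<times> sphere 0 1 \<times> UNIV" and cont: "continuous_on (fst a) (snd a)"
    using hom by (auto simp: homeomorphism_def)
  obtain p z w where pzw: "snd a x = (p, z, w)" by (cases "snd a x")
  then have "z \<in> sphere 0 1" using im x(2) by force
  then obtain t b where tb: "cis t \<noteq> z" "b \<in> W" "w \<in> fst b" "open (fst b)"
    "(UNIV \<times> cis ` {t<..<t + 2 * pi} \<times> fst b, map_prod id (map_prod (inv_into {t<..<t + 2 * pi} cis) (snd b))) \<in> product_charts W"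
    using product_chart by metis
  let ?d = "(UNIV \<times> cis ` {t<..<t + 2 * pi} \<times> fst b, map_prod id (map_prod (inv_into {t<..<t + 2 * pi} cis) (snd b)))
    :: ((real^4) \<times> complex \<times> 'w, (real^4) \<times> real \<times> (real^'n)) chart"
  \<comment> \<open>The arc is not open in the plane. \<open>N\<close> is therefore cut out by the
    open complement of \<open>cis t\<close>, and \<open>sphere_arc\<close> shows that its circle
    components lie in the arc.\<close>
  define N where "N = fst a \<inter> snd a -` (UNIV \<times> (- {cis t}) \<times> fst b)"
  define T where "T = snd c ` (fst c \<inter> N)"
  have "open N"
    unfolding N_def by (rule continuous_open_preimage[OF cont obs_open[OF a]]) (auto intro!: open_Times tb(4))
  then have T: "open T" unfolding T_def by (rule open_chart_image)
  have yT: "y \<in> T" using x tb pzw by (auto simp: T_def N_def)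
  have "fst c \<inter> N \<subseteq> fst c \<inter> fst a \<inter> snd a -` fst ?d"
  proof
    fix q assume q: "q \<in> fst c \<inter> N"
    then have "fst (snd (snd a q)) \<in> sphere 0 1" using im by (force simp: N_def)
    with q show "q \<in> fst c \<inter> fst a \<inter> snd a -` fst ?d"
      using sphere_arc[of "fst (snd (snd a q))" t] by (auto simp: N_def mem_Times_iff)
  qed
  then have "T \<subseteq> snd c ` (fst c \<inter> fst a \<inter> snd a -` fst ?d)"
    unfolding T_def by (rule image_mono)
  moreover have "smooth_on (snd c ` (fst c \<inter> fst a \<inter> snd a -` fst ?d)) (snd ?d \<circ> snd a \<circ> chart_inv c)"
    using sm c tb(5) unfolding smooth_between_def by blast
  ultimately have "Cinf_on T (snd ?d \<circ> snd a \<circ> chart_inv c)"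
    using smooth_on_subset smooth_on_open[OF T] by blast
  then have "Cinf_on T (\<lambda>y. fst ((snd ?d \<circ> snd a \<circ> chart_inv c) y))"
    by (rule Cinf_on_linear[OF T bounded_linear_fst])
  moreover have "(\<lambda>y. fst ((snd ?d \<circ> snd a \<circ> chart_inv c) y)) = obs_proj a"
    by (auto simp: obs_proj_def fun_eq_iff)
  ultimately show "\<exists>T. open T \<and> y \<in> T \<and> Cinf_on T (obs_proj a)"
    using T yT by auto
qed

text \<open>Chain rule along a curve that \<open>F\<close> maps affinely. It serves with arbitrary
  \<open>e\<close> for surjectivity and with \<open>e = 0\<close> for curves inside a fibre.\<close>

lemma dd_along_curve:
  assumes F: "F differentiable (at (q 0))" and q: "(q has_derivative (\<lambda>s. s *\<^sub>R v)) (at (0::real))"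
    and J: "open J" "0 \<in> J" and e: "\<And>s. s \<in> J \<Longrightarrow> F (q s) = p + s *\<^sub>R e"
  shows "dd v F (q 0) = e"
proof -
  have "((\<lambda>s. F (q s)) has_derivative (\<lambda>s. dd (s *\<^sub>R v) F (q 0))) (at 0)"
    by (rule has_derivative_compose[OF q has_derivative_dd[OF F]])
  then have "((\<lambda>s. p + s *\<^sub>R e) has_derivative (\<lambda>s. dd (s *\<^sub>R v) F (q 0))) (at 0)"
    by (rule has_derivative_transform_within_open[OF _ J]) (rule e)
  moreover have "((\<lambda>s. p + s *\<^sub>R e) has_derivative (\<lambda>s. s *\<^sub>R e)) (at 0)"
    by (auto intro!: derivative_eq_intros)
  ultimately have "(\<lambda>s. dd (s *\<^sub>R v) F (q 0)) = (\<lambda>s. s *\<^sub>R e)"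
    by (rule has_derivative_unique)
  from fun_cong[OF this, of 1] show ?thesis by simp
qed

text \<open>The witness is the velocity, seen in \<open>c\<close>, of the line
  \<open>p + s *\<^sub>R e\<close> carried back by the inverse observation chart, the other two
  components being fixed.\<close>

lemma dd_obs_proj_surj:
  assumes a: "a \<in> Obs" and y: "y \<in> obs_dom a"
  obtains v where "dd v (obs_proj a) y = e"
proof -
  let ?I = "inv_into (fst a) (snd a)"
  obtain x where x: "x \<in> fst c" "x \<in> fst a" "y = snd c x"
    using y by (auto simp: obs_dom_def)
  obtain \<Theta> where \<Theta>: "open \<Theta>" and hom: "homeomorphism (fst a) (\<Theta> \<times> sphere 0 1 \<times> UNIV) (snd a) ?I"
    and sm: "smooth_between (product_charts W) D (\<Theta> \<times> sphere 0 1 \<times> UNIV) ?I"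
    using obs_diffeo[OF a] by metis
  have im: "snd a ` fst a = \<Theta> \<times> sphere 0 1 \<times> UNIV" and cont: "continuous_on (\<Theta> \<times> sphere 0 1 \<times> UNIV) ?I"
    and inv: "\<And>u. u \<in> \<Theta> \<times> sphere 0 1 \<times> UNIV \<Longrightarrow> snd a (?I u) = u" "?I (snd a x) = x"
    using hom x(2) by (auto simp: homeomorphism_def)
  obtain p z w where pzw: "snd a x = (p, z, w)" by (cases "snd a x")
  have "(p, z, w) \<in> \<Theta> \<times> sphere 0 1 \<times> UNIV" using im x(2) pzw by force
  then have pz: "p \<in> \<Theta>" "z \<in> sphere 0 1" by auto
  obtain t b where tb: "cis t \<noteq> z" "b \<in> W" "w \<in> fst b"
    "(UNIV \<times> cis ` {t<..<t + 2 * pi} \<times> fst b, map_prod id (map_prod (inv_into {t<..<t + 2 * pi} cis) (snd b))) \<in> product_charts W"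
    "inj_on (map_prod (id :: real^4 \<Rightarrow> _) (map_prod (inv_into {t<..<t + 2 * pi} cis) (snd b))) (UNIV \<times> cis ` {t<..<t + 2 * pi} \<times> fst b)"
    using product_chart[OF pz(2)] by metis
  define d :: "((real^4) \<times> complex \<times> 'w, (real^4) \<times> real \<times> (real^'n)) chart" where
    "d = (UNIV \<times> cis ` {t<..<t + 2 * pi} \<times> fst b, map_prod id (map_prod (inv_into {t<..<t + 2 * pi} cis) (snd b)))"
  have d: "d \<in> product_charts W" "inj_on (snd d) (fst d)"
    using tb(4,5) by (simp_all add: d_def)
  have zarc: "z \<in> cis ` {t<..<t + 2 * pi}" using sphere_arc pz tb(1) by metis
  let ?S = "fst d \<inter> (\<Theta> \<times> sphere 0 1 \<times> UNIV) \<inter> ?I -` fst c"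
  define m where "m s = (p + s *\<^sub>R e, z, w)" for s :: real
  have m_d: "m s \<in> fst d" for s using zarc tb(3) by (auto simp: m_def d_def)
  define q where "q s = snd d (m s)" for s
  define q0 where "q0 = (p, inv_into {t<..<t + 2 * pi} cis z, snd b w)"
  have q_eq: "q s = q0 + s *\<^sub>R (e, 0)" for s by (simp add: q_def m_def d_def q0_def)
  have q_deriv: "(q has_derivative (\<lambda>s. s *\<^sub>R (e, 0))) (at s)" for s
    unfolding q_eq[abs_def] by (auto intro!: derivative_eq_intros)
  have "smooth_on (snd d ` ?S) (snd c \<circ> ?I \<circ> chart_inv d)"
    using sm c d(1) unfolding smooth_between_def by blast
  moreover have m0: "m 0 \<in> ?S"
    using m_d[of 0] pz x inv(2) pzw by (auto simp: m_def)
  \<comment> \<open>The coordinate image need not be open, as the factor from \<open>W\<close> lies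
    in a subspace; smoothness of the inverse thus provides a local extension \<open>H\<close>. Along
    \<open>q\<close>, for parameters in \<open>?J\<close>, it is the inverse itself.\<close>
  ultimately obtain T H where T: "open T" "q 0 \<in> T" "\<forall>k. Ck_on k T H"
    "\<forall>u\<in>T \<inter> snd d ` ?S. H u = (snd c \<circ> ?I \<circ> chart_inv d) u"
    unfolding q_def by (rule smooth_onE[OF _ imageI])
  define J0 where "J0 = {s. p + s *\<^sub>R e \<in> \<Theta>}"
  have J0: "open J0"
  proof -
    have "open ((\<lambda>s. p + s *\<^sub>R e) -` \<Theta>)"
      by (intro open_vimage \<Theta> continuous_intros)
    then show ?thesis by (simp add: J0_def vimage_def)
  qed
  have m_J0: "m s \<in> \<Theta> \<times> sphere 0 1 \<times> UNIV" if "s \<in> J0" for s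
    using that pz by (auto simp: J0_def m_def)
  have "continuous_on J0 (\<lambda>s. ?I (m s))"
    by (rule continuous_on_compose2[OF cont]) (use m_J0 in \<open>auto simp: m_def intro!: continuous_intros\<close>)
  then have "open (J0 \<inter> (\<lambda>s. ?I (m s)) -` fst c)"
    by (rule continuous_open_preimage[OF _ J0 chart_homeo(1)])
  moreover have "open (q -` T)"
    by (rule open_vimage[OF T(1)]) (metis q_deriv has_derivative_continuous continuous_at_imp_continuous_on)
  \<comment> \<open>Parameters for which the point stays over \<open>\<Theta>\<close>, in the chart
    \<open>c\<close> and in the domain of \<open>H\<close>.\<close>
  ultimately have J: "open (J0 \<inter> (\<lambda>s. ?I (m s)) -` fst c \<inter> q -` T)" (is "open ?J") by (rule open_Int)
  have J_0: "0 \<in> ?J" using pz T(2) m0 by (auto simp: J0_def)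
  have Hq: "H (q s) = snd c (?I (m s))" if "s \<in> ?J" for s
  proof -
    have "m s \<in> ?S" using that m_d m_J0 by auto
    moreover have "chart_inv d (q s) = m s"
      unfolding chart_inv_def q_def by (rule inv_into_f_f[OF d(2) m_d])
    ultimately show ?thesis using T(4) that by (auto simp: q_def)
  qed
  have Hq0: "H (q 0) = y"
    using Hq[OF J_0] pzw inv(2) x by (simp add: m_def)
  have "Cinf_on T H" using T(3) by (simp add: Cinf_on_def)
  then have H: "(H has_derivative (\<lambda>u. dd u H (q 0))) (at (q 0))"
    using T(2) by (rule Cinf_on_has_derivative)
  define v where "v = dd (e, 0) H (q 0)"
  have "((\<lambda>s. H (q s)) has_derivative (\<lambda>s. dd (s *\<^sub>R (e, 0)) H (q 0))) (at 0)"
    by (rule has_derivative_compose[OF q_deriv H])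
  moreover have "dd (s *\<^sub>R (e, 0)) H (q 0) = s *\<^sub>R v" for s
    unfolding v_def by (rule linear_scale[OF linear_dd]) (use H in \<open>auto simp: differentiable_def\<close>)
  ultimately have Hq': "((\<lambda>s. H (q s)) has_derivative (\<lambda>s. s *\<^sub>R v)) (at 0)"
    by (simp only:)
  have "dd v (obs_proj a) (H (q 0)) = e"
  proof (rule dd_along_curve[OF _ Hq' J J_0])
    show "obs_proj a differentiable at (H (q 0))"
      unfolding Hq0 by (rule Cinf_on_differentiable[OF obs_proj_smooth[OF a] y])
    show "obs_proj a (H (q s)) = p + s *\<^sub>R e" if s: "s \<in> ?J" for s
    proof -
      have "chart_inv c (H (q s)) = ?I (m s)"
        unfolding Hq[OF s] using s by (intro chart_inv) auto
      then show ?thesis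
        using inv(1)[OF m_J0] s by (simp add: obs_proj_def m_def)
    qed
  qed
  then show thesis using that Hq0 by simp
qed

lemma fibre_at:
  assumes "a \<in> Obs" "x \<in> fst a"
  shows "circle_at Obs x = circle_fibre a x" "compact_at Obs x = compact_fibre a x"
  using Obs assms unfolding observation_atlas_def circle_at_def compact_at_def by blast+

text \<open>Both fibres lie in level sets of the first component of \<open>snd a\<close>, so
  \<open>obs_proj a\<close> is constant along the defining curve of \<open>v\<close>.\<close>

lemma dd_obs_proj_tangent:
  assumes a: "a \<in> Obs" and y: "y \<in> obs_dom a"
    and v: "v \<in> tangent_space c (chart_inv c y) (circle_at Obs (chart_inv c y)) \<or>
       v \<in> tangent_space c (chart_inv c y) (compact_at Obs (chart_inv c y))"
  shows "dd v (obs_proj a) y = 0"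
proof -
  let ?x = "chart_inv c y"
  have x: "?x \<in> fst c" "?x \<in> fst a" using obs_dom_inv[OF y] by auto
  obtain N where N: "v \<in> tangent_space c ?x N" and const: "\<And>u. u \<in> N \<Longrightarrow> fst (snd a u) = fst (snd a ?x)"
    using v fibre_at[OF a x(2)] by (auto simp: circle_fibre_def compact_fibre_def)
  then obtain \<gamma> \<epsilon> where \<gamma>: "\<epsilon> > 0" "\<gamma> 0 = ?x" "\<gamma> ` {-\<epsilon><..<\<epsilon>} \<subseteq> N \<inter> fst c"
    "smooth_on {-\<epsilon><..<\<epsilon>} (snd c \<circ> \<gamma>)" "v = vector_derivative (snd c \<circ> \<gamma>) (at (0::real))"
    unfolding tangent_space_def by blast
  have "Cinf_on {-\<epsilon><..<\<epsilon>} (snd c \<circ> \<gamma>)" by (rule smooth_on_open[OF _ \<gamma>(4)]) simp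
  then have "(snd c \<circ> \<gamma>) differentiable (at 0)"
    by (rule Cinf_on_differentiable) (use \<gamma>(1) in simp)
  then have q: "((snd c \<circ> \<gamma>) has_derivative (\<lambda>s. s *\<^sub>R v)) (at 0)"
    unfolding \<gamma>(5) by (simp add: vector_derivative_works has_vector_derivative_def)
  have q0: "(snd c \<circ> \<gamma>) 0 = y" by (simp add: \<gamma>(2) chart_inv subsetD[OF obs_dom_sub y])
  have "dd v (obs_proj a) ((snd c \<circ> \<gamma>) 0) = 0"
  proof (rule dd_along_curve[OF _ q, of _ "{-\<epsilon><..<\<epsilon>}" "fst (snd a ?x)"])
    show "obs_proj a differentiable at ((snd c \<circ> \<gamma>) 0)"
      unfolding q0 by (rule Cinf_on_differentiable[OF obs_proj_smooth[OF a] y])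
    fix s assume "s \<in> {-\<epsilon><..<\<epsilon>}"
    then have "\<gamma> s \<in> N \<inter> fst c" using \<gamma>(3) by blast
    then show "obs_proj a ((snd c \<circ> \<gamma>) s) = fst (snd a ?x) + s *\<^sub>R 0"
      using const by (simp add: obs_proj_def chart_inv)
  qed (use \<gamma>(1) in auto)
  then show ?thesis by (simp only: q0)
qed

section \<open>Gradients of the base coordinates span the horizontal space\<close>

definition obs_diff :: "('d, 'w) obs \<Rightarrow> 4 \<Rightarrow> real^'n \<Rightarrow> real^'n" where
  "obs_diff a j y = (\<chi> i. dd (axis i 1) (\<lambda>y. obs_proj a y $ j) y)"

definition obs_grad :: "('d, 'w) obs \<Rightarrow> 4 \<Rightarrow> real^'n \<Rightarrow> real^'n" where
  "obs_grad a j y = h y *v obs_diff a j y"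

lemma obs_proj_nth_smooth: "a \<in> Obs \<Longrightarrow> Cinf_on (obs_dom a) (\<lambda>y. obs_proj a y $ j)"
  by (intro Cinf_on_nth obs_dom_open obs_proj_smooth)

lemma obs_diff_smooth: "a \<in> Obs \<Longrightarrow> Cinf_on (obs_dom a) (obs_diff a j)"
  unfolding obs_diff_def[abs_def] by (intro Cinf_on_vec obs_dom_open Cinf_on_dd obs_proj_nth_smooth)

lemma obs_grad_smooth: "a \<in> Obs \<Longrightarrow> Cinf_on (obs_dom a) (obs_grad a j)"
  unfolding obs_grad_def[abs_def]
  by (intro Cinf_on_bilinear[OF _ bounded_bilinear_matrix_vector] obs_dom_open obs_diff_smooth Cinf_on_subset[OF h_smooth obs_dom_sub])

lemma obs_diff_inner:
  assumes "a \<in> Obs" "y \<in> obs_dom a"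
  shows "obs_diff a j y \<bullet> v = dd v (\<lambda>y. obs_proj a y $ j) y"
    and "obs_diff a j y \<bullet> v = dd v (obs_proj a) y $ j"
proof -
  show "obs_diff a j y \<bullet> v = dd v (\<lambda>y. obs_proj a y $ j) y"
    using linear_expansion[OF linear_dd[OF Cinf_on_differentiable[OF obs_proj_nth_smooth[OF assms(1)] assms(2)]], of v j]
    by (simp add: obs_diff_def inner_vec_def mult.commute)
  then show "obs_diff a j y \<bullet> v = dd v (obs_proj a) y $ j"
    by (simp add: dd_nth[OF Cinf_on_differentiable[OF obs_proj_smooth[OF assms(1)] assms(2)]])
qed

text \<open>Symmetry of the second derivatives of a base coordinate, as required by
  \<open>lie_gradient\<close>.\<close>

lemma obs_diff_closed:
  assumes a: "a \<in> Obs" and y: "y \<in> obs_dom a"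
  shows "dd u (obs_diff a j) y \<bullet> v = dd v (obs_diff a j) y \<bullet> u"
proof -
  note d = Cinf_on_differentiable[OF obs_diff_smooth[OF a] y, of j]
  have *: "dd u (obs_diff a j) y \<bullet> v = dd u (dd v (\<lambda>y. obs_proj a y $ j)) y" for u v
  proof -
    have "dd u (\<lambda>y. obs_diff a j y \<bullet> v) y = dd u (dd v (\<lambda>y. obs_proj a y $ j)) y"
      by (rule dd_cong[OF obs_dom_open[OF a] y obs_diff_inner(1)[OF a]])
    then show ?thesis by (simp add: dd_linear[OF bounded_linear_inner_left d])
  qed
  show ?thesis
    unfolding * by (rule dd_commute[OF obs_dom_open[OF a] y obs_proj_nth_smooth[OF a]])
qed

definition hor :: "real^'n \<Rightarrow> (real^'n) set" where
  "hor y = horizontal g Obs c (chart_inv c y)"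

lemma hor_signature: "y \<in> U \<Longrightarrow> has_signature (form (gc y)) (hor y) 1 3"
  using Obs c chart_inv_in unfolding observation_atlas_def hor_def gc_def by blast

lemmas hor_orth_proj_iff = orth_proj_iff[OF form_linear hor_signature]

text \<open>The gradients are orthogonal to both fibres, where the coordinates are constant, and
  independent because the projection is a submersion. The signature gives \<open>hor y\<close>
  dimension 4, so they exhaust it.\<close>

lemma hor_eq:
  assumes a: "a \<in> Obs" and y: "y \<in> obs_dom a"
  shows "hor y = range (\<lambda>b :: real^4. \<Sum>j\<in>UNIV. b $ j *\<^sub>R obs_grad a j y)" (is "_ = range ?f")
    and "inj (\<lambda>b :: real^4. \<Sum>j\<in>UNIV. b $ j *\<^sub>R obs_grad a j y)"
proof -
  have yU: "y \<in> U" by (rule subsetD[OF obs_dom_sub y])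
  have gE: "gc y *v obs_grad a j y = obs_diff a j y" for j
    by (simp add: obs_grad_def h_cancel(3)[OF yU])
  have lin: "linear ?f"
    by (intro linearI) (simp_all add: scaleR_add_left sum.distrib scaleR_sum_right)
  have fv: "(gc y *v ?f b) \<bullet> v = (\<Sum>j\<in>UNIV. b $ j * (dd v (obs_proj a) y $ j))" for b v
    by (simp add: linear_sum[OF matrix_vector_mul_linear] matrix_distrib gE inner_sum_left obs_diff_inner(2)[OF a y])
  show inj: "inj ?f"
  proof (rule linear_injective_0[OF lin, THEN iffD2], intro allI impI)
    fix b assume "?f b = 0"
    then have z: "(\<Sum>j\<in>UNIV. b $ j * (dd v (obs_proj a) y $ j)) = 0" for v
      using fv[of b v] by simp
    have "b $ i = 0" for i
    proof -
      \<comment> \<open>A direction along which, to first order, the \<open>i\<close>-th coordinate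
        alone varies; it isolates \<open>b $ i\<close>.\<close>
      obtain v where "dd v (obs_proj a) y = axis i 1"
        using dd_obs_proj_surj[OF a y] by blast
      then show ?thesis using z[of v] sum_axis[of i "\<lambda>j. b $ j"] by (simp add: mult.commute)
    qed
    then show "b = 0" by (simp add: vec_eq_iff)
  qed
  have "?f b \<in> hor y" for b
  proof -
    have "form (gc y) (?f b) (u + w) = 0"
      if "u \<in> tangent_space c (chart_inv c y) (circle_at Obs (chart_inv c y))"
        "w \<in> tangent_space c (chart_inv c y) (compact_at Obs (chart_inv c y))" for u w
    proof -
      have "form (gc y) (?f b) (u + w) = (gc y *v ?f b) \<bullet> u + (gc y *v ?f b) \<bullet> w"
        using form_sym[OF gc_sym[OF yU], of "?f b" "u + w"] by (simp add: form_inner inner_add_left inner_commute)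
      then show ?thesis
        using that dd_obs_proj_tangent[OF a y] by (simp add: fv)
    qed
    then show ?thesis
      by (auto simp: hor_def horizontal_def orth_compl_def gc_def)
  qed
  then have sub: "range ?f \<subseteq> hor y" by auto
  have "dim (range ?f) = dim (UNIV :: (real^4) set)"
    by (rule dim_image_eq[OF lin]) (use inj in simp)
  then have "dim (hor y) \<le> dim (range ?f)"
    using signature_dim[OF form_linear hor_signature[OF yU]] by simp
  then show "hor y = range ?f"
    using subspace_dim_equal[OF linear_subspace_image[OF lin subspace_UNIV]
        signature_subspace[OF form_linear hor_signature[OF yU]] sub] by simp
qed

end

section \<open>Fluid type domains\<close>

locale fluid_chart = observed_chart D c g W Obs k
  for D :: "('d::topological_space, real^'n::finite) chart set" and c and g
    and W :: "('w::topological_space, real^'n) chart set" and Obs :: "('d, 'w) obs set" and k +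
  fixes Y X0 :: "('d, 'n) vfield" and \<mu> :: "'d \<Rightarrow> real"
  assumes killing: "killing D g Y" and circle: "circle_field D g Obs Y"
    and density: "fluid_density_and_velocity D g Obs \<mu> X0"
begin

definition Yc :: "real^'n \<Rightarrow> real^'n" where "Yc y = Y c (chart_inv c y)"
definition X0c :: "real^'n \<Rightarrow> real^'n" where "X0c y = X0 c (chart_inv c y)"
definition \<mu>c :: "real^'n \<Rightarrow> real" where "\<mu>c y = \<mu> (chart_inv c y)"

lemma Yc_smooth: "Cinf_on U Yc" and X0c_smooth: "Cinf_on U X0c" and \<mu>c_smooth: "Cinf_on U \<mu>c"
  using circle density vector_field_smooth[of Y] vector_field_smooth[of X0] function_smooth[of \<mu>]
  by (simp_all add: circle_field_def fluid_density_and_velocity_def Yc_def[abs_def] X0c_def[abs_def] \<mu>c_def[abs_def])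

sublocale killing_field U gc Gc Yc
proof
  show "Cinf_on U Yc" by (rule Yc_smooth)
  show "Yc y \<bullet> (gc y *v Yc y) = -1" if "y \<in> U" for y
    using circle c chart_inv_in[OF that] by (simp add: circle_field_def form_inner Yc_def gc_def)
  show "dd (Yc y) gc y + transpose (deriv_matrix Yc y) ** gc y + gc y ** deriv_matrix Yc y = 0" if "y \<in> U" for y
    using killing_equation[OF Yc_smooth[unfolded Yc_def[abs_def]] killing that] by (simp add: Yc_def[abs_def])
qed

lemma \<mu>c_pos: "\<mu>c y > 0"
  using density by (simp add: fluid_density_and_velocity_def \<mu>c_def)

lemma X0c_norm: "y \<in> U \<Longrightarrow> X0c y \<bullet> (gc y *v X0c y) = -1"
  using density c chart_inv_in[of y] by (simp add: fluid_density_and_velocity_def form_inner X0c_def gc_def)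

text \<open>A vector of \<open>hor y\<close> is determined by its products with
  \<open>hor y\<close>, so the projected equation can be tested there. The projection disappears,
  and the resulting bilinear identity can be differentiated.\<close>

lemma eigenspace_eq:
  assumes y: "y \<in> U"
  shows "span {X0c y} = {z \<in> hor y. \<forall>v\<in>hor y. z \<bullet> (Grav y *v v) = - \<mu>c y * (z \<bullet> (gc y *v v))}"
proof -
  note x = chart_inv_in[OF y]
  have "span {X0c y} = fluid_eigenspace g Obs c (chart_inv c y) (- \<mu>c y)"
    using density c x by (simp add: fluid_density_and_velocity_def X0c_def \<mu>c_def)
  also have "\<dots> = {z \<in> hor y. orth_proj (form (gc y)) (hor y) (h y ** Grav y *v z) = - \<mu>c y *\<^sub>R z}"
    using x by (simp add: fluid_eigenspace_def hor_def[symmetric] gc_def[symmetric] endo_eq gravity_eq chart_inv(1)[OF y])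
  also have "\<dots> = {z \<in> hor y. \<forall>v\<in>hor y. z \<bullet> (Grav y *v v) = - \<mu>c y * (z \<bullet> (gc y *v v))}"
  proof -
    have "form (gc y) (h y ** Grav y *v z - - \<mu>c y *\<^sub>R z) v = z \<bullet> (Grav y *v v) - - \<mu>c y * (z \<bullet> (gc y *v v))" for z v
    proof -
      have "(h y ** Grav y *v z) \<bullet> (gc y *v v) = v \<bullet> (gc y *v (h y ** Grav y *v z))"
        by (rule form_sym[OF gc_sym[OF y]])
      also have "\<dots> = v \<bullet> (Grav y *v z)"
        using y by (simp add: matrix_vector_mul_assoc matrix_mul_assoc gh)
      also have "\<dots> = z \<bullet> (Grav y *v v)"
        by (rule form_sym[OF Grav_sym[OF y]])
      finally show ?thesis by (simp add: form_inner inner_add_left)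
    qed
    moreover have "- \<mu>c y *\<^sub>R z \<in> hor y" if "z \<in> hor y" for z
      by (rule subspace_scale[OF signature_subspace[OF form_linear hor_signature[OF y]] that])
    ultimately show ?thesis
      unfolding hor_orth_proj_iff[OF y] by auto
  qed
  finally show ?thesis .
qed

lemma X0c_eigen:
  assumes "y \<in> U"
  shows "X0c y \<in> hor y" "v \<in> hor y \<Longrightarrow> X0c y \<bullet> (Grav y *v v) = - \<mu>c y * (X0c y \<bullet> (gc y *v v))"
  using span_base[of "X0c y" "{X0c y}"] eigenspace_eq[OF assms] by auto

lemma X0c_Yc:
  assumes y: "y \<in> U"
  shows "X0c y \<bullet> (gc y *v Yc y) = 0"
proof -
  let ?x = "chart_inv c y"
  note x = chart_inv_in[OF y]
  obtain a where a: "a \<in> Obs" "?x \<in> fst a"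
    using Obs unfolding observation_atlas_def by blast
  \<comment> \<open>Horizontality is orthogonality to sums \<open>u + w\<close>; the constant curve
    supplies \<open>w = 0\<close>.\<close>
  have "0 \<in> tangent_space c ?x (compact_at Obs ?x)"
  proof -
    have "smooth_on {-1<..<1} (snd c \<circ> (\<lambda>t::real. ?x))"
      unfolding smooth_on_def
      by (intro ballI exI[of _ UNIV] exI[of _ "snd c \<circ> (\<lambda>t::real. ?x)"]) (simp add: o_def Ck_on_const)
    moreover have "vector_derivative (snd c \<circ> (\<lambda>t::real. ?x)) (at 0) = 0"
      by (simp add: o_def)
    moreover have "?x \<in> compact_at Obs ?x"
      using a unfolding compact_at_def by (intro UN_I[of a]) (simp_all add: compact_fibre_def)
    ultimately show ?thesis
      using x unfolding tangent_space_def
      by (intro CollectI exI[of _ "\<lambda>t. ?x"] exI[of _ 1]) auto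
  qed
  moreover have "Yc y \<in> tangent_space c ?x (circle_at Obs ?x)"
    using circle c x by (simp add: circle_field_def Yc_def)
  ultimately have "Yc y \<in> {u + w | u w. u \<in> tangent_space c ?x (circle_at Obs ?x) \<and> w \<in> tangent_space c ?x (compact_at Obs ?x)}"
    by (intro CollectI exI[of _ "Yc y"] exI[of _ 0]) simp
  then have "form (gc y) (X0c y) (Yc y) = 0"
    using X0c_eigen(1)[OF y] unfolding hor_def horizontal_def orth_compl_def gc_def by blast
  then show ?thesis by (simp add: form_inner)
qed

lemma Yc_obs_diff:
  assumes a: "a \<in> Obs" and y: "y \<in> obs_dom a"
  shows "Yc y \<bullet> obs_diff a j y = 0"
proof -
  have "Yc y \<in> tangent_space c (chart_inv c y) (circle_at Obs (chart_inv c y))"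
    using circle c obs_dom_inv[OF y] by (simp add: circle_field_def Yc_def)
  then show ?thesis
    using dd_obs_proj_tangent[OF a y] obs_diff_inner(2)[OF a y, of j "Yc y"] by (simp add: inner_commute)
qed

lemma lie_obs_grad:
  assumes a: "a \<in> Obs" and y: "y \<in> obs_dom a"
  shows "lie (obs_grad a j) y = 0"
  unfolding obs_grad_def[abs_def]
  by (rule lie_gradient[OF obs_dom_open[OF a] y obs_dom_sub obs_diff_smooth[OF a] obs_diff_closed[OF a y] Yc_obs_diff[OF a]])

text \<open>The Gram matrix of the gradients is invertible because \<open>g\<close> is nondegenerate on \<open>H\<^sub>x\<close>.\<close>

lemma X0c_coefficients:
  assumes a: "a \<in> Obs"
  obtains f where "\<And>j. Cinf_on (obs_dom a) (f j)"
    "\<And>y. y \<in> obs_dom a \<Longrightarrow> X0c y = (\<Sum>j\<in>UNIV. f j y *\<^sub>R obs_grad a j y)"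
proof -
  define M where "M y = (\<chi> i j. obs_grad a i y \<bullet> (gc y *v obs_grad a j y))" for y
  define b where "b y = (\<chi> i. obs_grad a i y \<bullet> (gc y *v X0c y))" for y
  note op = obs_dom_open[OF a]
  have gs: "Cinf_on (obs_dom a) gc" and Xs: "Cinf_on (obs_dom a) X0c"
    by (intro Cinf_on_subset[OF _ obs_dom_sub] gc_smooth X0c_smooth)+
  have M_smooth: "Cinf_on (obs_dom a) M" and b_smooth: "Cinf_on (obs_dom a) b"
    unfolding M_def[abs_def] b_def[abs_def]
    by (intro Cinf_on_vec[OF op] Cinf_on_inner[OF op] Cinf_on_bilinear[OF op bounded_bilinear_matrix_vector]
      obs_grad_smooth[OF a] gs Xs)+
  have M_mult: "M y *v e = (\<chi> i. obs_grad a i y \<bullet> (gc y *v (\<Sum>j\<in>UNIV. e $ j *\<^sub>R obs_grad a j y)))" for y e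
  proof -
    have "gc y *v (\<Sum>j\<in>UNIV. e $ j *\<^sub>R obs_grad a j y) = (\<Sum>j\<in>UNIV. e $ j *\<^sub>R (gc y *v obs_grad a j y))"
      by (simp only: linear_sum[OF matrix_vector_mul_linear] linear_scale[OF matrix_vector_mul_linear])
    moreover have "M y *v e = (\<chi> i. \<Sum>j\<in>UNIV. M y $ i $ j * e $ j)"
      by (simp add: matrix_vector_mult_def)
    moreover have "M y $ i $ j = obs_grad a i y \<bullet> (gc y *v obs_grad a j y)" for i j
      by (simp add: M_def)
    ultimately show ?thesis
      by (simp only: inner_sum_right inner_scaleR_right mult.commute)
  qed
  have inv: "invertible (M y)" if y: "y \<in> obs_dom a" for y
  proof -
    have yU: "y \<in> U" by (rule subsetD[OF obs_dom_sub y])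
    have "e = 0" if "M y *v e = 0" for e
    proof -
      let ?z = "\<Sum>j\<in>UNIV. e $ j *\<^sub>R obs_grad a j y"
      have z: "obs_grad a i y \<bullet> (gc y *v ?z) = 0" for i
        using that by (simp add: M_mult vec_eq_iff)
      have "form (gc y) ?z v = 0" if v: "v \<in> hor y" for v
      proof -
        obtain f :: "real^4" where "v = (\<Sum>j\<in>UNIV. f $ j *\<^sub>R obs_grad a j y)"
          using v unfolding hor_eq(1)[OF a y] by blast
        then have "v \<bullet> (gc y *v ?z) = 0"
          by (simp add: inner_sum_left z)
        then show ?thesis
          using form_sym[OF gc_sym[OF yU], of ?z v] by (simp add: form_inner)
      qed
      moreover have "?z \<in> hor y" unfolding hor_eq(1)[OF a y] by blast
      ultimately have "?z = 0"
        using signature_nondegenerate[OF form_linear hor_signature[OF yU]] by blast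
      then show "e = 0"
        using injD[OF hor_eq(2)[OF a y], of e 0] by simp
    qed
    then show ?thesis
      unfolding invertible_left_inverse matrix_left_invertible_ker by blast
  qed
  \<comment> \<open>Coefficients exist pointwise by \<open>hor_eq\<close>; solving the Gram system
    exhibits them as smooth functions.\<close>
  define f where "f j y = (matrix_inv (M y) *v b y) $ j" for j y
  show thesis
  proof (rule that[of f])
    show "Cinf_on (obs_dom a) (f j)" for j
      unfolding f_def[abs_def]
      by (intro Cinf_on_nth[OF op] Cinf_on_bilinear[OF op bounded_bilinear_matrix_vector] Cinf_on_matrix_inv[OF op M_smooth inv] b_smooth)
    fix y assume y: "y \<in> obs_dom a"
    have yU: "y \<in> U" by (rule subsetD[OF obs_dom_sub y])
    obtain e :: "real^4" where e: "X0c y = (\<Sum>j\<in>UNIV. e $ j *\<^sub>R obs_grad a j y)"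
      using X0c_eigen(1)[OF yU] unfolding hor_eq(1)[OF a y] by blast
    have "b y = M y *v e" unfolding M_mult e[symmetric] by (simp add: b_def)
    then have "matrix_inv (M y) *v b y = e"
      by (simp add: matrix_vector_mul_assoc matrix_inv_works[OF inv[OF y]])
    then show "X0c y = (\<Sum>j\<in>UNIV. f j y *\<^sub>R obs_grad a j y)"
      by (simp add: f_def e)
  qed
qed

text \<open>Near \<open>y\<close>, \<open>invariant_eigenvector\<close> applies with the gradients
  of a single observation chart as the fields \<open>E\<close>.\<close>

lemma invariant:
  assumes y: "y \<in> U"
  shows "dd (Yc y) \<mu>c y = 0" "lie X0c y = 0"
proof -
  obtain a where a: "a \<in> Obs" "chart_inv c y \<in> fst a"
    using Obs unfolding observation_atlas_def by blast
  have ya: "y \<in> obs_dom a"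
    unfolding obs_dom_def using a chart_inv_in[OF y] chart_inv(1)[OF y] by force
  obtain f where f: "\<And>j. Cinf_on (obs_dom a) (f j)"
    "\<And>y. y \<in> obs_dom a \<Longrightarrow> X0c y = (\<Sum>j\<in>UNIV. f j y *\<^sub>R obs_grad a j y)"
    by (rule X0c_coefficients[OF a(1)]) blast
  have grad_hor: "obs_grad a j z \<in> hor z" if "z \<in> obs_dom a" for j z
  proof -
    have "obs_grad a j z = (\<Sum>i\<in>UNIV. axis j 1 $ i *\<^sub>R obs_grad a i z)"
      by (simp add: axis_def if_distrib[of "\<lambda>t. t *\<^sub>R _"] cong: if_cong)
    then show ?thesis unfolding hor_eq(1)[OF a(1) that] by blast
  qed
  have sub: "span (range (\<lambda>j. obs_grad a j y)) \<subseteq> hor y"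
    by (rule span_minimal) (use grad_hor[OF ya] signature_subspace[OF form_linear hor_signature[OF y]] in auto)
  \<comment> \<open>Equations tested on the gradients extend to \<open>hor y\<close> by linearity,
    and \<open>eigenspace_eq\<close> then places \<open>z\<close> on the line of
    \<open>X0c y\<close>.\<close>
  have line: "z \<in> span {X0c y}"
    if z: "z \<in> span (range (\<lambda>j. obs_grad a j y))"
      "\<And>j. z \<bullet> (Grav y *v obs_grad a j y) = - \<mu>c y * (z \<bullet> (gc y *v obs_grad a j y))" for z
  proof -
    have "z \<bullet> (Grav y *v v) = - \<mu>c y * (z \<bullet> (gc y *v v))" if v: "v \<in> hor y" for v
    proof -
      have "v \<in> span (range (\<lambda>j. obs_grad a j y))"
        using v unfolding hor_eq(1)[OF a(1) ya] by (auto intro!: span_sum span_scale intro: span_base)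
      moreover have "linear (\<lambda>v. z \<bullet> (Grav y *v v) + \<mu>c y * (z \<bullet> (gc y *v v)))"
        by (intro linearI) (simp_all add: matrix_distrib inner_add_right algebra_simps)
      ultimately have "z \<bullet> (Grav y *v v) + \<mu>c y * (z \<bullet> (gc y *v v)) = 0"
        by (rule linear_eq_0_on_span[rotated 2]) (auto simp: z(2))
      then show ?thesis by simp
    qed
    then show ?thesis
      using sub z(1) by (auto simp: eigenspace_eq[OF y])
  qed
  note inv = invariant_eigenvector[OF obs_dom_open[OF a(1)] ya obs_dom_sub
      Cinf_on_subset[OF X0c_smooth obs_dom_sub] Cinf_on_subset[OF \<mu>c_smooth obs_dom_sub]
      obs_grad_smooth[OF a(1)] lie_obs_grad[OF a(1) ya] f(1) f(2)]
  have n: "X0c z \<bullet> (gc z *v X0c z) = -1" if "z \<in> obs_dom a" for z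
    using X0c_norm subsetD[OF obs_dom_sub that] .
  have e: "X0c z \<bullet> (Grav z *v obs_grad a j z) = - \<mu>c z * (X0c z \<bullet> (gc z *v obs_grad a j z))" if "z \<in> obs_dom a" for z j
    using X0c_eigen(2)[OF subsetD[OF obs_dom_sub that] grad_hor[OF that]] .
  show "dd (Yc y) \<mu>c y = 0" "lie X0c y = 0"
    by (rule inv; (assumption | rule n e line); assumption?)+
qed

lemma fluidI:
  assumes "\<And>y. y \<in> U \<Longrightarrow> Yc y \<bullet> (Grav y *v Yc y) = (X0c y \<bullet> (Grav y *v Yc y))\<^sup>2 / \<mu>c y + \<sigma> y"
  shows "fluid U gc Gc Yc X0c \<mu>c \<sigma>"
  by unfold_locales (use X0c_smooth \<mu>c_smooth \<mu>c_pos X0c_norm X0c_Yc invariant assms in auto)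

end

text \<open>\<open>M\<close> is negative definite on the span, so every vector splits into a part in
  the span and an orthogonal one. A competitor \<open>w\<close> hence differs from \<open>u\<close>
  by a vector orthogonal to everything, which is 0 as \<open>M\<close> is invertible.\<close>

lemma orth_proj_complement:
  fixes M :: "real^'n::finite^'n"
  assumes M: "transpose M = M" "invertible M"
    and pair: "form M a a = -1" "form M b b = -1" "form M a b = 0"
    and u: "form M a u = 0" "form M b u = 0" "q - u \<in> span {a, b}"
  shows "orth_proj (form M) (orth_compl (form M) (span {a, b})) q = u"
proof -
  have sym: "form M v w = form M w v" for v w
    unfolding form_inner by (rule form_sym[OF M(1)])
  have compl: "v \<in> orth_compl (form M) (span {a, b}) \<longleftrightarrow> form M v a = 0 \<and> form M v b = 0" for v
  proof -
    have "form M v w = 0" if "form M v a = 0 \<and> form M v b = 0" "w \<in> span {a, b}" for w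
      using linear_eq_0_on_span[OF form_linear(1)[of M v], of "{a, b}" w] that by auto
    moreover have "a \<in> span {a, b}" "b \<in> span {a, b}"
      by (simp_all add: span_base)
    ultimately show ?thesis
      unfolding orth_compl_def by blast
  qed
  show ?thesis
    unfolding orth_proj_def
  proof (rule the_equality)
    have "form M (q - u) v = 0" if "v \<in> orth_compl (form M) (span {a, b})" for v
      using that u(3) sym by (auto simp: orth_compl_def)
    then show "u \<in> orth_compl (form M) (span {a, b}) \<and> (\<forall>v\<in>orth_compl (form M) (span {a, b}). form M (q - u) v = 0)"
      using u(1,2) by (simp add: compl sym[of u])
    fix w assume w: "w \<in> orth_compl (form M) (span {a, b}) \<and> (\<forall>v\<in>orth_compl (form M) (span {a, b}). form M (q - w) v = 0)"
    define d where "d = w - u"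
    have d: "form M d a = 0" "form M d b = 0"
      using w u(1,2) by (simp_all add: compl d_def linear_diff[OF form_linear(2)] sym[of u])
    have "form M d v = 0" for v
    proof -
      \<comment> \<open>The component of \<open>v\<close> orthogonal to \<open>a\<close> and
        \<open>b\<close>; the signs are positive because both have square -1.\<close>
      define v' where "v' = v + form M v a *\<^sub>R a + form M v b *\<^sub>R b"
      have "v' \<in> orth_compl (form M) (span {a, b})"
        by (simp add: compl v'_def linear_add[OF form_linear(2)] linear_scale[OF form_linear(2)] pair sym[of b a])
      then have "form M (q - w) v' = 0" "form M (q - u) v' = 0"
        using w \<open>\<And>v. v \<in> orth_compl (form M) (span {a, b}) \<Longrightarrow> form M (q - u) v = 0\<close> by blast+
      then have "form M d v' = 0"
        by (simp add: d_def linear_diff[OF form_linear(2)])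
      then show ?thesis
        by (simp add: v'_def linear_add[OF form_linear(1)] linear_scale[OF form_linear(1)] d)
    qed
    then have "v \<bullet> (M *v d) = 0" for v
      using sym[of v d] by (simp add: form_inner)
    then have "M *v d = 0" by (metis inner_eq_zero_iff)
    then have "matrix_inv M *v (M *v d) = 0" by simp
    then have "d = 0" by (simp add: matrix_vector_mul_assoc matrix_inv_works[OF M(2)])
    then show "w = u" by (simp add: d_def)
  qed
qed

section \<open>Transfer of the chart identities to the manifold\<close>

theorem theorem1:
  fixes D :: "('d::{second_countable_topology,t2_space}, real^'n) chart set"
    and W :: "('w::{second_countable_topology,t2_space}, real^'n) chart set"
    and g :: "('d, 'n) tensor2"
    and A :: "('d, 'w) obs set"
    and Y X0 X :: "('d, 'n) vfield"
    and G F P :: "('d, 'n) tensor2"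
    and \<mu> \<sigma> :: "'d \<Rightarrow> real"
    and \<rho> :: "('d, 'n) scalar"
  defines "G \<equiv> gravity g"
    and "F \<equiv> ext_deriv (flat g Y)"
    and "\<rho> \<equiv> \<lambda>c x. form (G c x) (X0 c x) (Y c x)"
    and "X \<equiv> \<lambda>c x. X0 c x + (\<rho> c x / \<mu> x) *\<^sub>R Y c x"
    and "P \<equiv> \<lambda>c x. G c x - \<mu> x *\<^sub>R outer (flat g X c x) (flat g X c x)
                         - \<sigma> x *\<^sub>R outer (flat g Y c x) (flat g Y c x)"
  assumes domain: "fluid_type_domain D W g A"
    and Y: "circle_field D g A Y"
    and \<mu>_X0: "fluid_density_and_velocity D g A \<mu> X0"
    and \<sigma>: "\<And>c x u v. c \<in> D \<Longrightarrow> x \<in> fst c \<Longrightarrow>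
               u \<in> span {X0 c x, Y c x} \<Longrightarrow> v \<in> span {X0 c x, Y c x} \<Longrightarrow>
               form (G c x) u v =
                 form (\<mu> x *\<^sub>R outer (flat g X c x) (flat g X c x)
                       + \<sigma> x *\<^sub>R outer (flat g Y c x) (flat g Y c x)) u v"
  shows "\<forall>c\<in>D. \<forall>x\<in>fst c.
    \<comment> \<open>1\<close>
    (div_vec g (\<lambda>c x. \<mu> x *\<^sub>R X c x) c x = div_vec g (\<lambda>c x. \<mu> x *\<^sub>R X0 c x) c x \<and>
     div_vec g (\<lambda>c x. \<mu> x *\<^sub>R X0 c x) c x = form (g c x) (X0 c x) (div_tensor g P c x) \<and>
     (\<mu> x)\<^sup>2 * directional X (\<lambda>c x. \<rho> c x / \<mu> x) c x
       = \<mu> x * form (g c x) (Y c x) (div_tensor g P c x)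
         - \<rho> c x * form (g c x) (X0 c x) (div_tensor g P c x) \<and>
     form (g c x) (Y c x) (div_tensor g P c x) = div_vec g (\<lambda>c x. endo g P c x *v Y c x) c x) \<and>
    \<comment> \<open>2\<close>
    (div_vec g (\<lambda>c x. \<rho> c x *\<^sub>R X c x) c x = div_vec g (\<lambda>c x. \<rho> c x *\<^sub>R X0 c x) c x \<and>
     div_vec g (\<lambda>c x. \<rho> c x *\<^sub>R X0 c x) c x = div_vec g (\<lambda>c x. endo g P c x *v Y c x) c x \<and>
     div_vec g (\<lambda>c x. endo g P c x *v Y c x) c x = form (g c x) (Y c x) (div_tensor g P c x)) \<and>
    \<comment> \<open>3\<close>
    (\<mu> x *\<^sub>R covariant g X X c x
       = - div_tensor g P c x - form (g c x) (X0 c x) (div_tensor g P c x) *\<^sub>R X c x \<and>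
     \<mu> x *\<^sub>R covariant g X0 X0 c x
       = \<rho> c x *\<^sub>R (endo g F c x *v X0 c x)
         - orth_proj (form (g c x)) (orth_compl (form (g c x)) (span {X0 c x, Y c x}))
             (div_tensor g P c x)) \<and>
    \<comment> \<open>4\<close>
    (div_tensor g F c x
       = \<rho> c x *\<^sub>R X0 c x + ((1/2) * square_norm g F c x) *\<^sub>R Y c x - endo g P c x *v Y c x \<and>
     (\<forall>j. (\<Sum>i\<in>UNIV. nabla_raised g F c x i i j)
       = \<rho> c x * X0 c x $ j + (1/2) * square_norm g F c x * Y c x $ j
         - (\<Sum>i\<in>UNIV. raise g P c x $ i $ j * flat g Y c x $ i)))"
proof (intro ballI)
  fix c x assume c: "c \<in> D" and x: "x \<in> fst c"
  have "fluid_chart D c g W A (CARD('n) - 5) Y X0 \<mu>"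
    using domain Y \<mu>_X0 c
    by (simp add: fluid_chart_def fluid_chart_axioms_def observed_chart_def observed_chart_axioms_def riemannian_chart_def
      fluid_type_domain_def complete_observation_atlas_def)
  then interpret ch: fluid_chart D c g W A "CARD('n) - 5" Y X0 \<mu> .
  let ?y = "snd c x"
  have y: "?y \<in> ch.U" by (rule ch.chart_in[OF x])
  define \<sigma>c where "\<sigma>c z = \<sigma> (chart_inv c z)" for z
  \<comment> \<open>These hold by definition for every \<open>z\<close>, whereas the identities for
    \<open>G\<close>, \<rho>, \<open>X\<close>, \<open>P\<close> and \<open>F\<close> below are
    restricted to the image of the chart.\<close>
  have pull: "g c (chart_inv c z) = ch.gc z" "Y c (chart_inv c z) = ch.Yc z" "X0 c (chart_inv c z) = ch.X0c z"
    "\<mu> (chart_inv c z) = ch.\<mu>c z" "\<sigma> (chart_inv c z) = \<sigma>c z" for z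
    by (simp_all add: ch.gc_def ch.Yc_def ch.X0c_def ch.\<mu>c_def \<sigma>c_def)
  have G_pull: "G c (chart_inv c z) = ch.Grav z" if "z \<in> ch.U" for z
    using ch.gravity_eq[OF ch.chart_inv_in[OF that]] ch.chart_inv(1)[OF that] by (simp add: G_def)
  have \<rho>_pull: "\<rho> c (chart_inv c z) = ch.X0c z \<bullet> (ch.Grav z *v ch.Yc z)" if "z \<in> ch.U" for z
    by (simp add: \<rho>_def form_inner G_pull[OF that] pull)
  have "fluid ch.U ch.gc ch.Gc ch.Yc ch.X0c ch.\<mu>c \<sigma>c"
  proof (rule ch.fluidI)
    fix z assume z: "z \<in> ch.U"
    let ?r = "\<rho> c (chart_inv c z)"
    \<comment> \<open>\<open>g(X0, Y) = 0\<close> and \<open>g(Y, Y) = -1\<close> leave the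
      contribution of the \<open>Y\<close> part of \<open>X\<close>.\<close>
    have gX: "(flat g X c (chart_inv c z)) \<bullet> ch.Yc z = - (?r / ch.\<mu>c z)"
      using form_sym[OF ch.gc_sym[OF z], of "ch.Yc z" "ch.X0c z"] ch.Y_norm[OF z] ch.X0c_Yc[OF z]
      by (simp add: flat_eq X_def pull matrix_distrib inner_add_right inner_commute)
    have gY: "(flat g Y c (chart_inv c z)) \<bullet> ch.Yc z = -1"
      using ch.Y_norm[OF z] by (simp add: flat_eq pull inner_commute)
    note gXY = gX gY gX[unfolded inner_commute[of _ "ch.Yc z"]] gY[unfolded inner_commute[of _ "ch.Yc z"]]
    \<comment> \<open>The hypothesis on \<sigma> at \<open>u = v = Y\<close>, the entry that
      \<open>Grav_Y_Y\<close> asks for.\<close>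
    have "ch.Yc z \<bullet> (ch.Grav z *v ch.Yc z) = ch.\<mu>c z * (?r / ch.\<mu>c z)\<^sup>2 + \<sigma>c z"
      using \<sigma>[OF c ch.chart_inv_in[OF z], of "ch.Yc z" "ch.Yc z"] ch.\<mu>c_pos[of z]
      by (simp add: pull G_pull[OF z] form_inner matrix_distrib outer_mult_vec gXY inner_add_right inner_diff_right
        span_base power2_eq_square)
    then show "ch.Yc z \<bullet> (ch.Grav z *v ch.Yc z) = (ch.X0c z \<bullet> (ch.Grav z *v ch.Yc z))\<^sup>2 / ch.\<mu>c z + \<sigma>c z"
      using ch.\<mu>c_pos[of z] by (simp add: \<rho>_pull[OF z] power2_eq_square)
  qed
  then interpret fl: fluid ch.U ch.gc ch.Gc ch.Yc ch.X0c ch.\<mu>c \<sigma>c .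
  have \<rho>_pull': "\<rho> c (chart_inv c z) = fl.\<rho> z" if "z \<in> ch.U" for z
    by (simp add: \<rho>_pull[OF that] fl.\<rho>_def)
  have X_pull: "X c (chart_inv c z) = fl.X z" if "z \<in> ch.U" for z
    by (simp add: X_def fl.X_def fl.r_def \<rho>_pull'[OF that] pull)
  have P_pull: "P c (chart_inv c z) = fl.P z" if "z \<in> ch.U" for z
    by (simp add: P_def fl.P_def G_pull[OF that] X_pull[OF that] flat_eq pull)
  have at_x: "chart_inv c ?y = x" by (rule ch.chart_inv(2)[OF x])
  note vals = pull[of ?y, unfolded at_x] X_pull[OF y, unfolded at_x] P_pull[OF y, unfolded at_x]
    \<rho>_pull'[OF y, unfolded at_x]
  have F_val: "F c (chart_inv c z) = fl.F z" if z: "z \<in> ch.U" for z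
  proof -
    have "F c (chart_inv c z) $ i $ j = fl.F z $ i $ j" for i j
      by (simp add: F_def ext_deriv_def fl.F_eq[OF z] ch.partial_eq[OF ch.chart_inv_in[OF z]] flat_eq pull
        ch.chart_inv(1)[OF z])
    then show ?thesis by (simp add: vec_eq_iff)
  qed
  have divP: "div_tensor g P c x = ch.dv2 (ch.up fl.P) ?y"
    by (rule ch.div_tensor_cong[where T=P, OF x fl.P_smooth P_pull])
  have divF: "div_tensor g F c x = ch.dv2 (ch.up fl.F) ?y"
    by (rule ch.div_tensor_cong[where T=F, OF x fl.F_smooth F_val])
  note sm = ch.smooth fl.all_smooth fl.P_smooth
  have div_\<mu>X: "div_vec g (\<lambda>c x. \<mu> x *\<^sub>R X c x) c x = ch.dv (\<lambda>y. ch.\<mu>c y *\<^sub>R fl.X y) ?y"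
    by (rule ch.div_vec_cong[OF x]) (intro sm, simp add: pull X_pull)
  have div_\<mu>X0: "div_vec g (\<lambda>c x. \<mu> x *\<^sub>R X0 c x) c x = ch.dv (\<lambda>y. ch.\<mu>c y *\<^sub>R ch.X0c y) ?y"
    by (rule ch.div_vec_cong[OF x]) (intro sm, simp add: pull)
  have div_\<rho>X: "div_vec g (\<lambda>c x. \<rho> c x *\<^sub>R X c x) c x = ch.dv (\<lambda>y. fl.\<rho> y *\<^sub>R fl.X y) ?y"
    by (rule ch.div_vec_cong[OF x]) (intro sm, simp add: \<rho>_pull' X_pull)
  have div_\<rho>X0: "div_vec g (\<lambda>c x. \<rho> c x *\<^sub>R X0 c x) c x = ch.dv (\<lambda>y. fl.\<rho> y *\<^sub>R ch.X0c y) ?y"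
    by (rule ch.div_vec_cong[OF x]) (intro sm, simp add: \<rho>_pull' pull)
  have endo_P: "endo g P c (chart_inv c z) = ch.h z ** fl.P z" if "z \<in> ch.U" for z
    using ch.endo_eq[OF ch.chart_inv_in[OF that], of P] by (simp add: P_pull[OF that] ch.chart_inv(1)[OF that])
  have div_PY: "div_vec g (\<lambda>c x. endo g P c x *v Y c x) c x = ch.dv (\<lambda>y. (ch.h y ** fl.P y) *v ch.Yc y) ?y"
    by (rule ch.div_vec_cong[OF x]) (intro sm, simp add: endo_P pull)
  have dir: "directional X (\<lambda>c x. \<rho> c x / \<mu> x) c x = dd (fl.X ?y) fl.r ?y"
    using ch.directional_cong[OF x fl.r_smooth, of "\<lambda>c x. \<rho> c x / \<mu> x" X] by (simp add: vals fl.r_def \<rho>_pull' pull)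
  have covX: "covariant g X X c x = ch.cov (fl.X ?y) fl.X ?y"
    using ch.covariant_cong[where Z=X and V=X, OF x fl.X_smooth X_pull] by (simp add: vals)
  have covX0: "covariant g X0 X0 c x = ch.cov (ch.X0c ?y) ch.X0c ?y"
    using ch.covariant_cong[where Z=X0 and V=X0, OF x fl.X0_smooth pull(3)] by (simp add: vals)
  have endo_F: "endo g F c x = ch.h ?y ** fl.F ?y"
    using ch.endo_eq[OF x, of F] F_val[OF y] by (simp add: at_x)
  have sq: "square_norm g F c x = (\<Sum>k\<in>UNIV. \<Sum>l\<in>UNIV. fl.F ?y $ k $ l * ch.up fl.F ?y $ k $ l)"
    using F_val[OF y] by (simp add: square_norm_def ch.raise_eq[OF x] ch.up_def at_x)
  \<comment> \<open>The projection is identified through its characterizing properties in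
    \<open>cov_X0_X0\<close> rather than computed.\<close>
  have proj: "orth_proj (form (g c x)) (orth_compl (form (g c x)) (span {X0 c x, Y c x})) (div_tensor g P c x)
     = fl.\<rho> ?y *\<^sub>R (ch.h ?y ** fl.F ?y *v ch.X0c ?y) - ch.\<mu>c ?y *\<^sub>R ch.cov (ch.X0c ?y) ch.X0c ?y"
    unfolding divP vals
    by (rule orth_proj_complement[OF ch.gc_sym[OF y] ch.gc_inv[OF y]])
      (simp_all only: form_inner fl.X0_norm[OF y] ch.Y_norm[OF y] fl.X0_Y[OF y] fl.cov_X0_X0[OF y])
  \<comment> \<open>The index form contracts the first index of \<open>P\<close>,
    \<open>endo\<close> the second; symmetry of \<open>P\<close> reconciles them.\<close>
  have raise_P: "(\<Sum>i\<in>UNIV. raise g P c x $ i $ j * flat g Y c x $ i) = (endo g P c x *v Y c x) $ j" for j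
  proof -
    have "transpose (ch.up fl.P ?y) = ch.up fl.P ?y"
      using y by (simp add: ch.up_def matrix_distrib ch.h_sym fl.P_sym)
    from arg_cong[OF this, of "\<lambda>M. M $ j $ _"]
    have s: "ch.up fl.P ?y $ i $ j = ch.up fl.P ?y $ j $ i" for i
      by (simp add: transpose_def)
    have "(\<Sum>i\<in>UNIV. raise g P c x $ i $ j * flat g Y c x $ i) = (ch.up fl.P ?y *v (ch.gc ?y *v ch.Yc ?y)) $ j"
      by (simp add: ch.raise_eq[OF x] vals ch.up_def[symmetric] s flat_eq matrix_vector_mult_def[of "ch.up fl.P ?y"])
    also have "ch.up fl.P ?y *v (ch.gc ?y *v ch.Yc ?y) = endo g P c x *v Y c x"
      using y endo_P[OF y] by (simp add: at_x vals ch.up_def matrix_vector_mul_assoc ch.h_cancel)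
    finally show ?thesis .
  qed
  have c4: "div_tensor g F c x
       = \<rho> c x *\<^sub>R X0 c x + ((1/2) * square_norm g F c x) *\<^sub>R Y c x - endo g P c x *v Y c x"
    using fl.div_F_source[OF y] endo_P[OF y] by (simp add: divF sq vals at_x)
  have c4': "(\<Sum>i\<in>UNIV. nabla_raised g F c x i i j)
       = \<rho> c x * X0 c x $ j + (1/2) * square_norm g F c x * Y c x $ j
         - (\<Sum>i\<in>UNIV. raise g P c x $ i $ j * flat g Y c x $ i)" for j
    using arg_cong[OF c4, of "\<lambda>v. v $ j"] by (simp add: div_tensor_def raise_P)
  have c3b: "\<mu> x *\<^sub>R covariant g X0 X0 c x
       = \<rho> c x *\<^sub>R (endo g F c x *v X0 c x)
         - orth_proj (form (g c x)) (orth_compl (form (g c x)) (span {X0 c x, Y c x})) (div_tensor g P c x)"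
    unfolding proj unfolding covX0 endo_F vals by simp
  have c3a: "\<mu> x *\<^sub>R covariant g X X c x = - div_tensor g P c x - form (g c x) (X0 c x) (div_tensor g P c x) *\<^sub>R X c x"
    unfolding covX divP form_inner vals by (rule fl.cov_X_X_div_P[OF y])
  have c2: "div_vec g (\<lambda>c x. \<rho> c x *\<^sub>R X c x) c x = div_vec g (\<lambda>c x. \<rho> c x *\<^sub>R X0 c x) c x \<and>
     div_vec g (\<lambda>c x. \<rho> c x *\<^sub>R X0 c x) c x = div_vec g (\<lambda>c x. endo g P c x *v Y c x) c x \<and>
     div_vec g (\<lambda>c x. endo g P c x *v Y c x) c x = form (g c x) (Y c x) (div_tensor g P c x)"
    unfolding div_\<rho>X div_\<rho>X0 div_PY divP form_inner vals
    using fl.dv_\<rho>[OF y] fl.div_P_Y[OF y] by simp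
  have c1: "div_vec g (\<lambda>c x. \<mu> x *\<^sub>R X c x) c x = div_vec g (\<lambda>c x. \<mu> x *\<^sub>R X0 c x) c x \<and>
     div_vec g (\<lambda>c x. \<mu> x *\<^sub>R X0 c x) c x = form (g c x) (X0 c x) (div_tensor g P c x) \<and>
     (\<mu> x)\<^sup>2 * directional X (\<lambda>c x. \<rho> c x / \<mu> x) c x
       = \<mu> x * form (g c x) (Y c x) (div_tensor g P c x)
         - \<rho> c x * form (g c x) (X0 c x) (div_tensor g P c x) \<and>
     form (g c x) (Y c x) (div_tensor g P c x) = div_vec g (\<lambda>c x. endo g P c x *v Y c x) c x"
    unfolding div_\<mu>X div_\<mu>X0 div_PY divP dir form_inner vals
    using fl.dv_\<mu>_X[OF y] fl.form_div_P(1)[OF y] fl.dd_X_r_div_P[OF y] fl.div_P_Y[OF y] by simp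
  show "(div_vec g (\<lambda>c x. \<mu> x *\<^sub>R X c x) c x = div_vec g (\<lambda>c x. \<mu> x *\<^sub>R X0 c x) c x \<and>
     div_vec g (\<lambda>c x. \<mu> x *\<^sub>R X0 c x) c x = form (g c x) (X0 c x) (div_tensor g P c x) \<and>
     (\<mu> x)\<^sup>2 * directional X (\<lambda>c x. \<rho> c x / \<mu> x) c x
       = \<mu> x * form (g c x) (Y c x) (div_tensor g P c x)
         - \<rho> c x * form (g c x) (X0 c x) (div_tensor g P c x) \<and>
     form (g c x) (Y c x) (div_tensor g P c x) = div_vec g (\<lambda>c x. endo g P c x *v Y c x) c x) \<and>
    (div_vec g (\<lambda>c x. \<rho> c x *\<^sub>R X c x) c x = div_vec g (\<lambda>c x. \<rho> c x *\<^sub>R X0 c x) c x \<and>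
     div_vec g (\<lambda>c x. \<rho> c x *\<^sub>R X0 c x) c x = div_vec g (\<lambda>c x. endo g P c x *v Y c x) c x \<and>
     div_vec g (\<lambda>c x. endo g P c x *v Y c x) c x = form (g c x) (Y c x) (div_tensor g P c x)) \<and>
    (\<mu> x *\<^sub>R covariant g X X c x
       = - div_tensor g P c x - form (g c x) (X0 c x) (div_tensor g P c x) *\<^sub>R X c x \<and>
     \<mu> x *\<^sub>R covariant g X0 X0 c x
       = \<rho> c x *\<^sub>R (endo g F c x *v X0 c x)
         - orth_proj (form (g c x)) (orth_compl (form (g c x)) (span {X0 c x, Y c x}))
             (div_tensor g P c x)) \<and>
    (div_tensor g F c x
       = \<rho> c x *\<^sub>R X0 c x + ((1/2) * square_norm g F c x) *\<^sub>R Y c x - endo g P c x *v Y c x \<and>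
     (\<forall>j. (\<Sum>i\<in>UNIV. nabla_raised g F c x i i j)
       = \<rho> c x * X0 c x $ j + (1/2) * square_norm g F c x * Y c x $ j
         - (\<Sum>i\<in>UNIV. raise g P c x $ i $ j * flat g Y c x $ i)))"
    by (intro conjI allI c1[THEN conjunct1] c1[THEN conjunct2, THEN conjunct1]
      c1[THEN conjunct2, THEN conjunct2, THEN conjunct1] c1[THEN conjunct2, THEN conjunct2, THEN conjunct2]
      c2[THEN conjunct1] c2[THEN conjunct2, THEN conjunct1] c2[THEN conjunct2, THEN conjunct2] c3a c3b c4 c4')
qed

end
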